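(* Assume that $F\subseteq\mathbb{R}$. Let $\lambda\in\Lambda$ and let $\sigma^\lambda\colon\mathbf{H}_K\to M_{d_\lambda}(K)$ be any matrix representation afforded by $E^\lambda_\varepsilon$. Then $\sigma^\lambda$ is balanced if and only if there exists a symmetric matrix $\Omega^\lambda\in M_{d_\lambda}(\mathcal{O})$ such that $$\det(\Omega^\lambda)\in\mathcal{O}^\times\quad\text{and}\quad\Omega^\lambda\,\sigma^\lambda(T_{w^{-1}})=\sigma^\lambda(T_w)^{\mathrm{tr}}\,\Omega^\lambda\quad\text{for all }w\in W.$$
   Context: Basic setting. $(W,S)$ is a Coxeter system with $W$ finite and length function $l$. $\Gamma$ is an abelian group (written additively) with a fixed monomial order, i.e. a total order $\leq$ such that $g\le g'$ implies $g+h\le g'+h$. $L\colon W\to\Gamma$ is a weight function, i.e. $L(ww')=L(w)+L(w')$ whenever $l(ww')=l(w)+l(w')$; assume $L(s)>0$ for all $s\in S$. Let $\mathbb{Z}_W=\mathbb{Z}[2\cos(2\pi/m_{st})\mid s,t\in S]$, $m_{st}$ the order of $st$. $R\subseteq\mathbb{C}$ is a subring containing $\mathbb{Z}_W$, with field of fractions $F$. $A=R[\Gamma]$ is the group ring with $R$-basis $\{\varepsilon^g\mid g\in\Gamma\}$, $\varepsilon^g\varepsilon^{g'}=\varepsilon^{g+g'}$; it is an integral domain with field of fractions $K$. $\mathbf{H}$ is the Iwahori--Hecke algebra: the associative $A$-algebra, free with basis $\{T_w\mid w\in W\}$ and identity $T_1$, such that for $s\in S$, $w\in W$: $T_sT_w=T_{sw}$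 if $l(sw)>l(w)$ and $T_sT_w=T_{sw}+(v_s-v_s^{-1})T_w$ if $l(sw)<l(w)$, where $v_s=\varepsilon^{L(s)}$. Put $\mathbf{H}_K=K\otimes_A\mathbf{H}$. Representations. $F$ is a splitting field for $W$; $\{E^\lambda\mid\lambda\in\Lambda\}$ are the irreducible $F[W]$-modules up to isomorphism, $d_\lambda=\dim E^\lambda$. $\mathbf{H}_K$ is split semisimple and its irreducible modules up to isomorphism are $E^\lambda_\varepsilon$ ($\lambda\in\Lambda$), determined by $\mathrm{trace}(w,E^\lambda)=\theta_1(\mathrm{trace}(T_w,E^\lambda_\varepsilon))$ for all $w\in W$, where $\theta_1\colon A\to R$ is the $R$-linear ring homomorphism with $\theta_1(\varepsilon^g)=1$ for all $g$. Define $0\ne\mathbf{c}_\lambda\in A$ by $\sum_{w}\mathrm{trace}(T_w,E^\lambda_\varepsilon)\,\mathrm{trace}(T_{w^{-1}},E^\lambda_\varepsilon)=d_\lambda\mathbf{c}_\lambda$; one can write $\mathbf{c}_\lambda=f_\lambda\varepsilon^{-2\mathbf{a}_\lambda}+$ (combination of $\varepsilon^g$ with $g>-2\mathbf{a}_\lambda$), where $\mathbf{a}_\lambda\in\Gamma$, $\mathbf{a}_\lambda\ge0$, and $f_\lambda$ is a positive real number. Balanced representations. Let $F[\Gamma_{>0}]$ be the set of $F$-linear combinations of $\varepsilon^g$ with $g>0$. Each $0\ne x\in K$ can be written $x=r_x\varepsilon^{g_x}\frac{1+p}{1+q}$ with $p,q\in F[\Gamma_{>0}]$ and unique $0\neq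 r_x\in F$, $g_x\in\Gamma$; set $g_0=+\infty$. $\mathcal{O}=\{x\in K\mid g_x\ge0\}$ is a valuation ring with maximal ideal $\mathfrak{p}=\{x\mid g_x>0\}$. A matrix representation $\sigma^\lambda\colon\mathbf{H}_K\to M_{d_\lambda}(K)$ afforded by $E^\lambda_\varepsilon$ (with respect to some basis) is balanced if $\varepsilon^{\mathbf{a}_\lambda}\sigma^\lambda_{ij}(T_w)\in\mathcal{O}$ for all $w\in W$ and all $i,j\in\{1,\ldots,d_\lambda\}$. *)

theory Defs
  imports
    "HOL-Library.Poly_Mapping"
    "HOL-Computational_Algebra.Polynomial_Factorial"
    "HOL-Algebra.Algebra"
    "HOL-Algebra.Algebraic_Closure_Type"
    "Jordan_Normal_Form.Determinant"
begin

section \<open>Coxeter systems and weight functions\<close>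

definition word_prod :: "('w, 'x) monoid_scheme \<Rightarrow> 'w list \<Rightarrow> 'w" where
  "word_prod W ws = foldr (\<lambda>x y. x \<otimes>\<^bsub>W\<^esub> y) ws \<one>\<^bsub>W\<^esub>"

text \<open>
  The congruence on words over \<open>S\<close> generated by the relations \<open>(st)\<^sup>m = 1\<close>, where \<open>m\<close> is the
  order of \<open>st\<close>.  An infinite order is encoded in the library as \<open>0\<close> and yields no relation;
  \<open>s = t\<close> yields \<open>ss = 1\<close>, so that the monoid presented is a group.
\<close>

inductive cox_cong :: "('w, 'x) monoid_scheme \<Rightarrow> 'w set \<Rightarrow> 'w list \<Rightarrow> 'w list \<Rightarrow> bool"
  for W :: "('w, 'x) monoid_scheme" and S :: "'w set"
where
  relator: "\<lbrakk>u \<in> lists S; v \<in> lists S; s \<in> S; t \<in> S\<rbrakk> \<Longrightarrow>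
    cox_cong W S (u @ concat (replicate (group.ord W (s \<otimes>\<^bsub>W\<^esub> t)) [s, t]) @ v) (u @ v)"
| refl: "u \<in> lists S \<Longrightarrow> cox_cong W S u u"
| sym: "cox_cong W S u v \<Longrightarrow> cox_cong W S v u"
| trans: "\<lbrakk>cox_cong W S u v; cox_cong W S v w\<rbrakk> \<Longrightarrow> cox_cong W S u w"

text \<open>\<open>W\<close> is the group with generators \<open>S\<close>, of order 2, and defining relations
  \<open>(st)\<^sup>m = 1\<close>, \<open>m\<close> the order of \<open>st\<close>.\<close>

definition coxeter_system :: "('w, 'x) monoid_scheme \<Rightarrow> 'w set \<Rightarrow> bool" where
  "coxeter_system W S \<longleftrightarrow>
     group W \<and> S \<subseteq> carrier W \<and> (\<forall>s\<in>S. group.ord W s = 2) \<and>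
     word_prod W ` lists S = carrier W \<and>
     (\<forall>u\<in>lists S. \<forall>v\<in>lists S. word_prod W u = word_prod W v \<longleftrightarrow> cox_cong W S u v)"

definition cox_length :: "('w, 'x) monoid_scheme \<Rightarrow> 'w set \<Rightarrow> 'w \<Rightarrow> nat" where
  "cox_length W S w = (LEAST n. \<exists>ws\<in>lists S. length ws = n \<and> word_prod W ws = w)"

definition weight_function ::
  "('w, 'x) monoid_scheme \<Rightarrow> 'w set \<Rightarrow> ('w \<Rightarrow> 'g::linordered_ab_group_add) \<Rightarrow> bool" where
  "weight_function W S L \<longleftrightarrow>
     (\<forall>w\<in>carrier W. \<forall>w'\<in>carrier W.
        cox_length W S (w \<otimes>\<^bsub>W\<^esub> w') = cox_length W S w + cox_length W S w' \<longrightarrow>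
        L (w \<otimes>\<^bsub>W\<^esub> w') = L w + L w')"


section \<open>Coefficient rings\<close>

definition Z_W :: "('w, 'x) monoid_scheme \<Rightarrow> 'w set \<Rightarrow> complex set" where
  "Z_W W S = generate_ring ring_of_type_algebra
     {complex_of_real (2 * cos (2 * pi / real (group.ord W (s \<otimes>\<^bsub>W\<^esub> t)))) | s t. s \<in> S \<and> t \<in> S}"

definition frac_field :: "complex set \<Rightarrow> complex set" where
  "frac_field R = {a / b | a b. a \<in> R \<and> b \<in> R \<and> b \<noteq> 0}"

text \<open>
  All group rings \<open>R[\<Gamma>]\<close> with \<open>R \<subseteq> \<complex>\<close> are taken inside the domain \<open>\<complex>[\<Gamma>]\<close>, the type
  \<open>'g \<Rightarrow>\<^sub>0 complex\<close> with the convolution product, and their fields of fractions inside the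
  fraction field of \<open>\<complex>[\<Gamma>]\<close>.
\<close>

type_synonym 'g gfrac = "('g \<Rightarrow>\<^sub>0 complex) fract"

definition group_alg :: "complex set \<Rightarrow> ('g::linordered_ab_group_add \<Rightarrow>\<^sub>0 complex) set" where
  "group_alg R = {p. \<forall>g. Poly_Mapping.lookup p g \<in> R}"

definition group_alg_pos :: "complex set \<Rightarrow> ('g::linordered_ab_group_add \<Rightarrow>\<^sub>0 complex) set" where
  "group_alg_pos R = {p \<in> group_alg R. \<forall>g\<in>Poly_Mapping.keys p. 0 < g}"

definition K_field :: "complex set \<Rightarrow> 'g::linordered_ab_group_add gfrac set" where
  "K_field R =
     {to_fract a / to_fract b | a b. a \<in> group_alg R \<and> b \<in> group_alg R \<and> b \<noteq> 0}"

definition eps :: "'g::linordered_ab_group_add \<Rightarrow> 'g gfrac" where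
  "eps g = to_fract (Poly_Mapping.single g 1)"

definition theta1 :: "('g::linordered_ab_group_add \<Rightarrow>\<^sub>0 complex) \<Rightarrow> complex" where
  "theta1 p = (\<Sum>g\<in>Poly_Mapping.keys p. Poly_Mapping.lookup p g)"

text \<open>The exponent \<open>g\<^sub>x\<close> in \<open>x = r\<^sub>x \<epsilon>\<^sup>g\<^sup>x (1+p)/(1+q)\<close>; meaningful for nonzero \<open>x \<in> K\<close> only.\<close>

definition g_exp :: "complex set \<Rightarrow> 'g::linordered_ab_group_add gfrac \<Rightarrow> 'g" where
  "g_exp F x = (THE g. \<exists>r\<in>F - {0}. \<exists>p\<in>group_alg_pos F. \<exists>q\<in>group_alg_pos F.
     x = to_fract (Poly_Mapping.single 0 r) * eps g * (to_fract (1 + p) / to_fract (1 + q)))"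

definition O_ring :: "complex set \<Rightarrow> 'g::linordered_ab_group_add gfrac set" where
  "O_ring R = {x \<in> K_field R. x = 0 \<or> 0 \<le> g_exp (frac_field R) x}"

definition O_units :: "complex set \<Rightarrow> 'g::linordered_ab_group_add gfrac set" where
  "O_units R = {x \<in> O_ring R. \<exists>y\<in>O_ring R. x * y = 1}"


section \<open>Matrix representations\<close>

definition mats :: "'k set \<Rightarrow> nat \<Rightarrow> 'k mat set" where
  "mats C n = {M \<in> carrier_mat n n. elements_mat M \<subseteq> C}"

definition mat_trace :: "'k::comm_monoid_add mat \<Rightarrow> 'k" where
  "mat_trace M = (\<Sum>i<dim_row M. M $$ (i, i))"

text \<open>In this section \<open>k\<close> is a subfield of the field \<open>'k\<close>.\<close>

definition irreducible_mats :: "'k::field set \<Rightarrow> nat \<Rightarrow> 'k mat set \<Rightarrow> bool" where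
  "irreducible_mats k n \<M> \<longleftrightarrow> 0 < n \<and>
     (\<forall>U. U \<subseteq> {v \<in> carrier_vec n. set\<^sub>v v \<subseteq> k} \<and> 0\<^sub>v n \<in> U \<and>
          (\<forall>u\<in>U. \<forall>v\<in>U. u + v \<in> U) \<and> (\<forall>c\<in>k. \<forall>u\<in>U. c \<cdot>\<^sub>v u \<in> U) \<and>
          (\<forall>M\<in>\<M>. \<forall>u\<in>U. M *\<^sub>v u \<in> U)
       \<longrightarrow> U = {0\<^sub>v n} \<or> U = {v \<in> carrier_vec n. set\<^sub>v v \<subseteq> k})"

text \<open>Isomorphism over \<open>k\<close>, that is, a change of basis of \<open>k\<^sup>n\<close>.\<close>

definition equiv_reps ::
  "'k::field set \<Rightarrow> nat \<Rightarrow> 'a set \<Rightarrow> ('a \<Rightarrow> 'k mat) \<Rightarrow> ('a \<Rightarrow> 'k mat) \<Rightarrow> bool" where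
  "equiv_reps k n D \<rho> \<tau> \<longleftrightarrow>
     (\<exists>P\<in>mats k n. \<exists>Q\<in>mats k n. \<forall>x\<in>D. similar_mat_wit (\<rho> x) (\<tau> x) P Q)"

definition group_rep ::
  "'k::field set \<Rightarrow> nat \<Rightarrow> ('w, 'x) monoid_scheme \<Rightarrow> ('w \<Rightarrow> 'k mat) \<Rightarrow> bool" where
  "group_rep k n W \<rho> \<longleftrightarrow>
     (\<forall>w\<in>carrier W. \<rho> w \<in> mats k n) \<and> \<rho> \<one>\<^bsub>W\<^esub> = 1\<^sub>m n \<and>
     (\<forall>x\<in>carrier W. \<forall>y\<in>carrier W. \<rho> (x \<otimes>\<^bsub>W\<^esub> y) = \<rho> x * \<rho> y)"

definition irred_group_rep ::
  "'k::field set \<Rightarrow> nat \<Rightarrow> ('w, 'x) monoid_scheme \<Rightarrow> ('w \<Rightarrow> 'k mat) \<Rightarrow> bool" where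
  "irred_group_rep k n W \<rho> \<longleftrightarrow> group_rep k n W \<rho> \<and> irreducible_mats k n (\<rho> ` carrier W)"

text \<open>\<open>k\<close> is a splitting field for \<open>W\<close>: every irreducible representation over \<open>k\<close> has only scalar
  endomorphisms.\<close>

definition splitting_field :: "'k::field set \<Rightarrow> ('w, 'x) monoid_scheme \<Rightarrow> bool" where
  "splitting_field k W \<longleftrightarrow>
     (\<forall>n \<rho>. irred_group_rep k n W \<rho> \<longrightarrow>
        (\<forall>M\<in>mats k n. (\<forall>w\<in>carrier W. M * \<rho> w = \<rho> w * M) \<longrightarrow> (\<exists>c\<in>k. M = c \<cdot>\<^sub>m 1\<^sub>m n)))"

text \<open>The \<open>E l\<close>, of degrees \<open>d l\<close>, for \<open>l \<in> \<Lambda>\<close>, are the irreducible representations of \<open>W\<close> over \<open>k\<close>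
  up to isomorphism.\<close>

definition irred_reps_family ::
  "'k::field set \<Rightarrow> ('w, 'x) monoid_scheme \<Rightarrow> 'l set \<Rightarrow> ('l \<Rightarrow> nat) \<Rightarrow> ('l \<Rightarrow> 'w \<Rightarrow> 'k mat) \<Rightarrow> bool"
where
  "irred_reps_family k W \<Lambda> d E \<longleftrightarrow>
     (\<forall>l\<in>\<Lambda>. irred_group_rep k (d l) W (E l)) \<and>
     (\<forall>n \<rho>. irred_group_rep k n W \<rho> \<longrightarrow>
        (\<exists>!l. l \<in> \<Lambda> \<and> d l = n \<and> equiv_reps k n (carrier W) \<rho> (E l)))"

definition algebra_rep ::
  "'k::field set \<Rightarrow> nat \<Rightarrow> ('k, 'h) module \<Rightarrow> ('h \<Rightarrow> 'k mat) \<Rightarrow> bool" where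
  "algebra_rep k n H \<sigma> \<longleftrightarrow>
     (\<forall>x\<in>carrier H. \<sigma> x \<in> mats k n) \<and> \<sigma> \<one>\<^bsub>H\<^esub> = 1\<^sub>m n \<and>
     (\<forall>x\<in>carrier H. \<forall>y\<in>carrier H. \<sigma> (x \<oplus>\<^bsub>H\<^esub> y) = \<sigma> x + \<sigma> y \<and> \<sigma> (x \<otimes>\<^bsub>H\<^esub> y) = \<sigma> x * \<sigma> y) \<and>
     (\<forall>c\<in>k. \<forall>x\<in>carrier H. \<sigma> (c \<odot>\<^bsub>H\<^esub> x) = c \<cdot>\<^sub>m \<sigma> x)"


section \<open>The Iwahori--Hecke algebra and its representations\<close>

text \<open>
  The Iwahori--Hecke algebra over a subring \<open>B\<close> of the fraction field of \<open>\<complex>[\<Gamma>]\<close>.  For \<open>B = A\<close>,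
  embedded via \<open>to_fract\<close>, this is \<open>\<^bold>H\<close>.  As \<open>\<^bold>H\<close> is free over \<open>A\<close> on the \<open>T\<^sub>w\<close>, the algebra
  \<open>K \<otimes>\<^sub>A \<^bold>H\<close> is free over \<open>K\<close> on the \<open>1 \<otimes> T\<^sub>w\<close> with the same multiplication rules: it is the case \<open>B = K\<close>.
  (The locale \<open>algebra\<close> of the library covers commutative algebras only.)
\<close>

definition hecke_algebra ::
  "'g::linordered_ab_group_add gfrac set \<Rightarrow> ('w, 'x) monoid_scheme \<Rightarrow> 'w set \<Rightarrow> ('w \<Rightarrow> 'g) \<Rightarrow>
   ('g gfrac, 'h) module \<Rightarrow> ('w \<Rightarrow> 'h) \<Rightarrow> bool" where
  "hecke_algebra B W S L H T \<longleftrightarrow>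
     ring H \<and> Module.module (ring_of_type_algebra\<lparr>carrier := B\<rparr>) H \<and>
     (\<forall>b\<in>B. \<forall>x\<in>carrier H. \<forall>y\<in>carrier H.
        (b \<odot>\<^bsub>H\<^esub> x) \<otimes>\<^bsub>H\<^esub> y = b \<odot>\<^bsub>H\<^esub> (x \<otimes>\<^bsub>H\<^esub> y) \<and>
        x \<otimes>\<^bsub>H\<^esub> (b \<odot>\<^bsub>H\<^esub> y) = b \<odot>\<^bsub>H\<^esub> (x \<otimes>\<^bsub>H\<^esub> y)) \<and>
     T \<in> carrier W \<rightarrow> carrier H \<and>
     (\<forall>h\<in>carrier H. \<exists>!c. c \<in> carrier W \<rightarrow>\<^sub>E B \<and>
        h = (\<Oplus>\<^bsub>H\<^esub>w\<in>carrier W. c w \<odot>\<^bsub>H\<^esub> T w)) \<and>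
     T \<one>\<^bsub>W\<^esub> = \<one>\<^bsub>H\<^esub> \<and>
     (\<forall>s\<in>S. \<forall>w\<in>carrier W.
        (cox_length W S (s \<otimes>\<^bsub>W\<^esub> w) > cox_length W S w \<longrightarrow>
           T s \<otimes>\<^bsub>H\<^esub> T w = T (s \<otimes>\<^bsub>W\<^esub> w)) \<and>
        (cox_length W S (s \<otimes>\<^bsub>W\<^esub> w) < cox_length W S w \<longrightarrow>
           T s \<otimes>\<^bsub>H\<^esub> T w =
             T (s \<otimes>\<^bsub>W\<^esub> w) \<oplus>\<^bsub>H\<^esub> (eps (L s) - inverse (eps (L s))) \<odot>\<^bsub>H\<^esub> T w))"

text \<open>\<open>E\<^sub>\<epsilon>\<close> is an irreducible representation of \<open>K \<otimes>\<^sub>A \<^bold>H\<close> corresponding to the representation \<open>E\<close> of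
  \<open>W\<close>: \<open>trace(T\<^sub>w, E\<^sub>\<epsilon>) \<in> A\<close> is mapped by \<open>\<theta>\<^sub>1\<close> to \<open>trace(w, E)\<close>.\<close>

definition generic_rep ::
  "complex set \<Rightarrow> ('w, 'x) monoid_scheme \<Rightarrow> ('g::linordered_ab_group_add gfrac, 'h) module \<Rightarrow>
   ('w \<Rightarrow> 'h) \<Rightarrow> nat \<Rightarrow> ('w \<Rightarrow> complex mat) \<Rightarrow> ('h \<Rightarrow> 'g gfrac mat) \<Rightarrow> bool" where
  "generic_rep R W H T n E E\<^sub>\<epsilon> \<longleftrightarrow>
     algebra_rep (K_field R) n H E\<^sub>\<epsilon> \<and>
     irreducible_mats (K_field R) n (E\<^sub>\<epsilon> ` carrier H) \<and>
     (\<forall>w\<in>carrier W. \<exists>p\<in>group_alg R.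
        mat_trace (E\<^sub>\<epsilon> (T w)) = to_fract p \<and> mat_trace (E w) = theta1 p)"

text \<open>\<open>\<^bold>c\<^sub>\<lambda>\<close> and \<open>\<^bold>a\<^sub>\<lambda>\<close> for \<open>n = d\<^sub>\<lambda>\<close>; the element \<open>\<^bold>c\<^sub>\<lambda> \<in> A\<close> is taken as an element of the fraction field.\<close>

definition c_elt ::
  "('w, 'x) monoid_scheme \<Rightarrow> ('w \<Rightarrow> 'h) \<Rightarrow> nat \<Rightarrow>
   ('h \<Rightarrow> 'g::linordered_ab_group_add gfrac mat) \<Rightarrow> 'g gfrac" where
  "c_elt W T n E\<^sub>\<epsilon> =
     (\<Sum>w\<in>carrier W. mat_trace (E\<^sub>\<epsilon> (T w)) * mat_trace (E\<^sub>\<epsilon> (T (inv\<^bsub>W\<^esub> w)))) / of_nat n"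

definition a_invariant ::
  "('w, 'x) monoid_scheme \<Rightarrow> ('w \<Rightarrow> 'h) \<Rightarrow> nat \<Rightarrow>
   ('h \<Rightarrow> 'g::linordered_ab_group_add gfrac mat) \<Rightarrow> 'g" where
  "a_invariant W T n E\<^sub>\<epsilon> = (THE a. 0 \<le> a \<and> (\<exists>f::real. \<exists>p. 0 < f \<and>
     (\<forall>g\<in>Poly_Mapping.keys p. - (a + a) < g) \<and>
     c_elt W T n E\<^sub>\<epsilon> = to_fract (Poly_Mapping.single (- (a + a)) (complex_of_real f) + p)))"

definition balanced ::
  "complex set \<Rightarrow> ('w, 'x) monoid_scheme \<Rightarrow> ('w \<Rightarrow> 'h) \<Rightarrow> nat \<Rightarrow>
   'g::linordered_ab_group_add \<Rightarrow> ('h \<Rightarrow> 'g gfrac mat) \<Rightarrow> bool" where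
  "balanced R W T n a \<sigma> \<longleftrightarrow>
     (\<forall>w\<in>carrier W. \<forall>i<n. \<forall>j<n. eps a * \<sigma> (T w) $$ (i, j) \<in> O_ring R)"

end

theory Submission
  imports Defs
begin

text \<open>
  Write \<open>\<tau> w\<close> for \<open>\<sigma> (T w)\<close>, and let \<open>G = \<Sum>\<^sub>w (\<tau> w)\<^sup>T (\<tau> w)\<close>.  The Casimir property of \<open>\<Sum>\<^sub>w T\<^sub>w \<otimes> T\<^bsub>inv w\<^esub>\<close> shows
  that \<open>G\<close> satisfies the intertwining relation required of \<open>\<Omega>\<close>, and that \<open>\<Sum>\<^sub>w (\<tau> w)\<^sup>T G (\<tau> w) = d c G\<close>.
  If \<open>\<sigma>\<close> is balanced, then \<open>\<epsilon>\<^sup>2\<^sup>a G\<close> is integral, and its residue is a Gram matrix of real matrices,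
  which is nonsingular by the Schur relations.

  Conversely, \<open>G\<close> is a scalar multiple of a given \<open>\<Omega>\<close>.  Let \<open>g\<close> be least such that all
  \<open>\<epsilon>\<^sup>g \<tau> w\<close> are integral.  Since sums of squares of reals do not cancel, the residue of \<open>\<epsilon>\<^sup>2\<^sup>g G\<close> is
  nonzero, hence a nonzero multiple of the nonsingular residue of \<open>\<Omega>\<close>, hence positive definite.
  Comparing exponents on both sides of \<open>\<Sum>\<^sub>w (\<tau> w)\<^sup>T G (\<tau> w) = d c G\<close> yields \<open>g \<le> a\<close>.

  That the commutant of \<open>\<tau>\<close> is trivial, which all of this uses, follows from the splitting field
  assumption on \<open>W\<close>: the Gram determinant of the trace form on lifts of the matrix units specialises
  to \<open>1\<close> under \<open>\<theta>\<^sub>1\<close>, so the \<open>\<tau> w\<close> span the full matrix algebra.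
\<close>

section \<open>Residues of the valuation\<close>

text \<open>The entries of \<open>\<tau> w\<close> lie in K and cannot be specialised by
  \<open>theta1\<close>; only the traces are known to lie in A with a known image. This is why the
  passage from W to the generic algebra goes through the trace form. The exponent a is a definite
  description, to be identified from c. Once G is nonsingular, it conjugates
  \<open>\<tau> (inv w)\<close> into the transpose of \<open>\<tau> w\<close>, so d c is the sum of
  the squares of the character values. Over the reals its leading exponent is therefore twice the
  least exponent of the character values, and its leading coefficient is positive. In the converse,
  the identity for d c G is scaled by the fourth power of \<open>eps g\<close>. The left side then
  has nonzero residue, while the right side is d times the scaled c times a scaled, integral entry
  of G; for a < g the scaled c would have residue zero. All fractions live in the fraction field of
  \<complex>[\<Gamma>], so integrality splits into membership of K and existence of a complex
  residue.\<close>

lemma lookup_single_times: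
  fixes p :: "'g::linordered_ab_group_add \<Rightarrow>\<^sub>0 complex"
  shows "Poly_Mapping.lookup (Poly_Mapping.single g c * p) h = c * Poly_Mapping.lookup p (h - g)"
proof -
  have eq: "(h = g + q) = (q = h - g)" for q
    by (auto simp: algebra_simps)
  have "Poly_Mapping.lookup (Poly_Mapping.single g c * p) h =
    (\<Sum>k. (c when g = k) * (\<Sum>q. Poly_Mapping.lookup p q when h = k + q))"
    by (simp add: lookup_mult lookup_single)
  also have "\<dots> = (\<Sum>k. c * (\<Sum>q. Poly_Mapping.lookup p q when h = g + q) when g = k)"
    by (intro Sum_any.cong) (auto simp: when_def)
  also have "\<dots> = c * (\<Sum>q. Poly_Mapping.lookup p q when h = g + q)"
    by simp
  also have "(\<Sum>q. Poly_Mapping.lookup p q when h = g + q) = Poly_Mapping.lookup p (h - g)"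
    by (simp add: eq)
  finally show ?thesis .
qed

text \<open>The monoid algebra of the nonnegative exponents. Inverting its elements with nonzero
  constant term gives the valuation ring.\<close>

definition nonneg_keys :: "('g::linordered_ab_group_add \<Rightarrow>\<^sub>0 complex) set" where
  "nonneg_keys = {p. \<forall>g\<in>Poly_Mapping.keys p. 0 \<le> g}"

lemma nonneg_keysI: "(\<And>g. g < 0 \<Longrightarrow> Poly_Mapping.lookup p g = 0) \<Longrightarrow> p \<in> nonneg_keys"
  unfolding nonneg_keys_def by (force simp: in_keys_iff not_le[symmetric])

lemma nonneg_keysD: "p \<in> nonneg_keys \<Longrightarrow> g < 0 \<Longrightarrow> Poly_Mapping.lookup p g = 0"
  unfolding nonneg_keys_def by (force simp: in_keys_iff)

lemma single_nonneg_keys: "0 \<le> g \<Longrightarrow> Poly_Mapping.single g c \<in> nonneg_keys"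
  by (rule nonneg_keysI) (auto simp: lookup_single when_def)

lemma one_nonneg_keys: "1 \<in> nonneg_keys"
  by (rule nonneg_keysI) (auto simp: lookup_one when_def)

lemma add_nonneg_keys: "p \<in> nonneg_keys \<Longrightarrow> q \<in> nonneg_keys \<Longrightarrow> p + q \<in> nonneg_keys"
  by (rule nonneg_keysI) (simp add: lookup_add nonneg_keysD)

lemma uminus_nonneg_keys: "p \<in> nonneg_keys \<Longrightarrow> - p \<in> nonneg_keys"
  by (simp add: nonneg_keys_def)

lemma mult_nonneg_keys: "p \<in> nonneg_keys \<Longrightarrow> q \<in> nonneg_keys \<Longrightarrow> p * q \<in> nonneg_keys"
  using keys_mult[of p q] by (fastforce simp: nonneg_keys_def)

text \<open>Two nonnegative exponents add up to zero only if both vanish. So splitting off the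
  constant term of \<open>p\<close> leaves a product that does not reach exponent 0.\<close>

lemma lookup_0_mult:
  assumes "p \<in> nonneg_keys" "q \<in> nonneg_keys"
  shows "Poly_Mapping.lookup (p * q) 0 = Poly_Mapping.lookup p 0 * Poly_Mapping.lookup q 0"
proof -
  define r where "r = p - Poly_Mapping.single 0 (Poly_Mapping.lookup p 0)"
  have r: "0 < g" if "g \<in> Poly_Mapping.keys r" for g
  proof -
    have "g \<noteq> 0" using that by (auto simp: in_keys_iff r_def lookup_minus)
    with that have "g \<in> Poly_Mapping.keys p"
      by (auto simp: in_keys_iff r_def lookup_minus lookup_single)
    with assms(1) have "0 \<le> g" by (auto simp: nonneg_keys_def)
    with \<open>g \<noteq> 0\<close> show ?thesis by simp
  qed
  have "0 \<notin> Poly_Mapping.keys (r * q)"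
    using keys_mult[of r q] r assms(2) by (fastforce simp: nonneg_keys_def dest: add_pos_nonneg)
  moreover have "p * q = Poly_Mapping.single 0 (Poly_Mapping.lookup p 0) * q + r * q"
    by (simp add: r_def algebra_simps)
  ultimately show ?thesis
    by (simp add: lookup_add lookup_single_times in_keys_iff)
qed

text \<open>The residue is the image in the residue field \<open>\<complex>\<close> of an element of the valuation ring of
  the field of fractions of \<open>\<complex>[\<Gamma>]\<close>.\<close>

definition has_residue :: "'g::linordered_ab_group_add gfrac \<Rightarrow> complex \<Rightarrow> bool" where
  "has_residue x r \<longleftrightarrow> (\<exists>a\<in>nonneg_keys. \<exists>b\<in>nonneg_keys. Poly_Mapping.lookup b 0 \<noteq> 0 \<and>
     x = to_fract a / to_fract b \<and> r = Poly_Mapping.lookup a 0 / Poly_Mapping.lookup b 0)"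

lemma has_residueI:
  "\<lbrakk>a \<in> nonneg_keys; b \<in> nonneg_keys; Poly_Mapping.lookup b 0 \<noteq> 0\<rbrakk> \<Longrightarrow>
   has_residue (to_fract a / to_fract b) (Poly_Mapping.lookup a 0 / Poly_Mapping.lookup b 0)"
  unfolding has_residue_def by blast

lemma has_residueE:
  assumes "has_residue x r"
  obtains a b where "a \<in> nonneg_keys" "b \<in> nonneg_keys" "Poly_Mapping.lookup b 0 \<noteq> 0" "b \<noteq> 0"
     "x = to_fract a / to_fract b" "r = Poly_Mapping.lookup a 0 / Poly_Mapping.lookup b 0"
  using assms unfolding has_residue_def by force

text \<open>The representing fraction is not in any reduced form, so well-definedness is checked by
  cross multiplication and comparison of constant terms.\<close>

lemma has_residue_unique:
  assumes "has_residue x r" "has_residue x s"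
  shows "r = s"
proof -
  obtain a b where ab: "a \<in> nonneg_keys" "b \<in> nonneg_keys" "Poly_Mapping.lookup b 0 \<noteq> 0" "b \<noteq> 0"
     "x = to_fract a / to_fract b" "r = Poly_Mapping.lookup a 0 / Poly_Mapping.lookup b 0"
    using assms(1) by (rule has_residueE)
  obtain a' b' where ab': "a' \<in> nonneg_keys" "b' \<in> nonneg_keys" "Poly_Mapping.lookup b' 0 \<noteq> 0" "b' \<noteq> 0"
     "x = to_fract a' / to_fract b'" "s = Poly_Mapping.lookup a' 0 / Poly_Mapping.lookup b' 0"
    using assms(2) by (rule has_residueE)
  have "to_fract (a * b') = to_fract (a' * b)"
    using ab ab' by (simp add: field_simps)
  then have "a * b' = a' * b" by (simp only: to_fract_eq_iff)
  then have "Poly_Mapping.lookup (a * b') 0 = Poly_Mapping.lookup (a' * b) 0" by simp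
  then show ?thesis unfolding ab(6) ab'(6) using ab(1-3) ab'(1-3)
    by (simp add: lookup_0_mult frac_eq_eq)
qed

lemma has_residue_add:
  assumes "has_residue x r" "has_residue y s"
  shows "has_residue (x + y) (r + s)"
proof -
  obtain a b where ab: "a \<in> nonneg_keys" "b \<in> nonneg_keys" "Poly_Mapping.lookup b 0 \<noteq> 0" "b \<noteq> 0"
     "x = to_fract a / to_fract b" "r = Poly_Mapping.lookup a 0 / Poly_Mapping.lookup b 0"
    using assms(1) by (rule has_residueE)
  obtain a' b' where ab': "a' \<in> nonneg_keys" "b' \<in> nonneg_keys" "Poly_Mapping.lookup b' 0 \<noteq> 0" "b' \<noteq> 0"
     "y = to_fract a' / to_fract b'" "s = Poly_Mapping.lookup a' 0 / Poly_Mapping.lookup b' 0"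
    using assms(2) by (rule has_residueE)
  have "x + y = to_fract (a * b' + a' * b) / to_fract (b * b')"
    using ab ab' by (simp add: field_simps)
  moreover have "r + s = Poly_Mapping.lookup (a * b' + a' * b) 0 / Poly_Mapping.lookup (b * b') 0"
    unfolding ab(6) ab'(6) using ab(1-3) ab'(1-3) by (simp add: add_frac_eq lookup_add lookup_0_mult)
  ultimately show ?thesis unfolding has_residue_def using ab ab'
    by (intro bexI[of _ "a * b' + a' * b"] bexI[of _ "b * b'"] conjI)
       (auto simp: lookup_0_mult intro: mult_nonneg_keys add_nonneg_keys)
qed

lemma has_residue_mult:
  assumes "has_residue x r" "has_residue y s"
  shows "has_residue (x * y) (r * s)"
proof -
  obtain a b where ab: "a \<in> nonneg_keys" "b \<in> nonneg_keys" "Poly_Mapping.lookup b 0 \<noteq> 0" "b \<noteq> 0"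
     "x = to_fract a / to_fract b" "r = Poly_Mapping.lookup a 0 / Poly_Mapping.lookup b 0"
    using assms(1) by (rule has_residueE)
  obtain a' b' where ab': "a' \<in> nonneg_keys" "b' \<in> nonneg_keys" "Poly_Mapping.lookup b' 0 \<noteq> 0" "b' \<noteq> 0"
     "y = to_fract a' / to_fract b'" "s = Poly_Mapping.lookup a' 0 / Poly_Mapping.lookup b' 0"
    using assms(2) by (rule has_residueE)
  show ?thesis unfolding has_residue_def using ab ab'
    by (intro bexI[of _ "a * a'"] bexI[of _ "b * b'"] conjI)
       (auto simp: lookup_0_mult intro: mult_nonneg_keys)
qed

lemma has_residue_to_fract: "p \<in> nonneg_keys \<Longrightarrow> has_residue (to_fract p) (Poly_Mapping.lookup p 0)"
  using has_residueI[of p 1] by (simp add: one_nonneg_keys lookup_one)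

lemma has_residue_0: "has_residue 0 0"
  using has_residue_to_fract[of 0] by (simp add: nonneg_keys_def)

lemma has_residue_1: "has_residue 1 1"
  using has_residue_to_fract[of 1] by (simp add: one_nonneg_keys lookup_one)

lemma has_residue_uminus: "has_residue x r \<Longrightarrow> has_residue (- x) (- r)"
  using has_residue_mult[OF has_residue_to_fract[OF uminus_nonneg_keys[OF one_nonneg_keys]], of x r]
  by (simp add: lookup_one)

lemma has_residue_inverse:
  assumes "has_residue x r" "r \<noteq> 0"
  shows "has_residue (inverse x) (inverse r)"
proof -
  obtain a b where ab: "a \<in> nonneg_keys" "b \<in> nonneg_keys" "Poly_Mapping.lookup b 0 \<noteq> 0" "b \<noteq> 0"
     "x = to_fract a / to_fract b" "r = Poly_Mapping.lookup a 0 / Poly_Mapping.lookup b 0"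
    using assms(1) by (rule has_residueE)
  show ?thesis unfolding has_residue_def using ab assms(2)
    by (intro bexI[of _ b] bexI[of _ a] conjI) auto
qed

lemma has_residue_sum:
  "(\<And>i. i \<in> I \<Longrightarrow> has_residue (f i) (r i)) \<Longrightarrow> has_residue (\<Sum>i\<in>I. f i) (\<Sum>i\<in>I. r i)"
  by (induction I rule: infinite_finite_induct) (auto intro: has_residue_0 has_residue_add)

lemma has_residue_prod:
  "(\<And>i. i \<in> I \<Longrightarrow> has_residue (f i) (r i)) \<Longrightarrow> has_residue (\<Prod>i\<in>I. f i) (\<Prod>i\<in>I. r i)"
  by (induction I rule: infinite_finite_induct) (auto intro: has_residue_1 has_residue_mult)

section \<open>Monomials and the exponent of an element\<close>

lemma eps_add: "eps (g + h) = eps g * eps h"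
  unfolding eps_def by (simp flip: to_fract_mult add: mult_single)

lemma eps_0: "eps 0 = 1"
  by (simp add: eps_def)

lemma eps_nonzero: "eps g \<noteq> 0"
  using eps_add[of g "- g"] by (auto simp: eps_0)

lemma inverse_eps: "inverse (eps g) = eps (- g)"
  using eps_add[of g "- g"] by (simp add: eps_0 inverse_unique)

lemma has_residue_eps: "0 < g \<Longrightarrow> has_residue (eps g) 0"
  using has_residue_to_fract[OF single_nonneg_keys[OF less_imp_le], of g 1]
  by (auto simp: eps_def lookup_single when_def split: if_splits)

text \<open>A factor \<open>eps (h - g)\<close> with \<open>g < h\<close> lies in the maximal ideal,
  so raising the exponent preserves integrality and kills the residue.\<close>

lemma has_residue_eps_mult:
  assumes "g \<le> h" "has_residue (eps g * x) r"
  shows "\<exists>s. has_residue (eps h * x) s \<and> (g < h \<longrightarrow> s = 0)"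
proof (cases "g = h")
  case False
  with assms have "g < h" by simp
  then have "has_residue (eps (h - g) * (eps g * x)) (0 * r)"
    by (intro has_residue_mult has_residue_eps assms) simp
  moreover have "eps (h - g) * (eps g * x) = eps h * x"
    by (simp flip: mult.assoc eps_add)
  ultimately show ?thesis by auto
qed (use assms in auto)

text \<open>A nonzero residue certifies that the exponent is the least one making \<open>x\<close>
  integral. All comparisons of exponents below rest on this.\<close>

lemma has_residue_exponent_le:
  assumes "has_residue (eps g * x) r" "r \<noteq> 0" "has_residue (eps h * x) s"
  shows "g \<le> h"
proof (rule ccontr)
  assume "\<not> g \<le> h"
  with has_residue_eps_mult[OF _ assms(3), of g] have "has_residue (eps g * x) 0" by (auto simp: not_le less_imp_le)
  with assms has_residue_unique show False by blast
qed

text \<open>The support is finite and the order total, so there is a least exponent, and dividing by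
  its monomial moves the leading term to exponent 0.\<close>

lemma normalize_leading:
  fixes p :: "'g::linordered_ab_group_add \<Rightarrow>\<^sub>0 complex"
  assumes "p \<noteq> 0"
  obtains g where "g \<in> Poly_Mapping.keys p" "Poly_Mapping.single (- g) 1 * p \<in> nonneg_keys"
    "Poly_Mapping.lookup (Poly_Mapping.single (- g) 1 * p) 0 = Poly_Mapping.lookup p g"
    "Poly_Mapping.lookup p g \<noteq> 0"
proof -
  define g where "g = Min (Poly_Mapping.keys p)"
  have "g \<in> Poly_Mapping.keys p" unfolding g_def using assms by (intro Min_in) auto
  moreover have "Poly_Mapping.lookup (Poly_Mapping.single (- g) 1 * p) h = 0" if "h < 0" for h
  proof -
    have "h + g < g" using that by (simp add: add_less_le_mono)
    then have "h + g \<notin> Poly_Mapping.keys p" unfolding g_def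
      using Min_le[OF finite_keys] by (metis not_less)
    then show ?thesis by (simp add: lookup_single_times in_keys_iff)
  qed
  then have "Poly_Mapping.single (- g) 1 * p \<in> nonneg_keys" by (rule nonneg_keysI)
  ultimately show ?thesis using that[of g] by (simp add: lookup_single_times in_keys_iff)
qed

text \<open>Numerator and denominator are both divided by their leading monomials; the quotient of
  the two corrections is the monomial sought.\<close>

lemma exists_valuation:
  assumes "x \<noteq> (0 :: 'g::linordered_ab_group_add gfrac)"
  shows "\<exists>g r. has_residue (eps g * x) r \<and> r \<noteq> 0"
proof -
  obtain a b where x: "x = to_fract a / to_fract b" "b \<noteq> 0"
    by (cases x) (auto simp: Fract_conv_to_fract)
  with assms have "a \<noteq> 0" by auto
  then obtain g where g: "Poly_Mapping.single (- g) 1 * a \<in> nonneg_keys"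
    "Poly_Mapping.lookup (Poly_Mapping.single (- g) 1 * a) 0 \<noteq> 0"
    by (metis normalize_leading)
  obtain h where h: "Poly_Mapping.single (- h) 1 * b \<in> nonneg_keys"
    "Poly_Mapping.lookup (Poly_Mapping.single (- h) 1 * b) 0 \<noteq> 0"
    using x by (metis normalize_leading)
  have "eps (h - g) * x = eps (- g) * inverse (eps (- h)) * x"
    by (simp add: inverse_eps flip: eps_add)
  also have "\<dots> = to_fract (Poly_Mapping.single (- g) 1 * a) / to_fract (Poly_Mapping.single (- h) 1 * b)"
    by (simp add: x field_simps eps_def)
  finally have *: "eps (h - g) * x = \<dots>" .
  show ?thesis
    using has_residueI[OF g(1) h] g(2) h(2) unfolding *[symmetric] by (metis divide_eq_0_iff)
qed

lemma has_residue_0_iff: "has_residue 0 r \<longleftrightarrow> r = 0"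
  using has_residue_0 has_residue_unique by blast

text \<open>The maximum of the individual exponents makes every member integral, and it is attained
  at a member whose residue therefore survives.\<close>

lemma exists_common_valuation:
  fixes f :: "'i \<Rightarrow> 'g::linordered_ab_group_add gfrac"
  assumes "finite I" "i \<in> I" "f i \<noteq> 0"
  obtains g r where "\<And>i. i \<in> I \<Longrightarrow> has_residue (eps g * f i) (r i)" "\<exists>i\<in>I. r i \<noteq> 0"
proof -
  have "\<forall>i\<in>{i\<in>I. f i \<noteq> 0}. \<exists>g r. has_residue (eps g * f i) r \<and> r \<noteq> 0"
    using exists_valuation by blast
  then obtain v where v: "\<forall>i\<in>{i\<in>I. f i \<noteq> 0}. \<exists>r. has_residue (eps (v i) * f i) r \<and> r \<noteq> 0"
    by (metis (no_types, lifting))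
  define g where "g = Max (v ` {i\<in>I. f i \<noteq> 0})"
  have le: "v j \<le> g" if "j \<in> I" "f j \<noteq> 0" for j
    unfolding g_def using that assms by (intro Max_ge) auto
  have ex: "\<exists>r. has_residue (eps g * f j) r" if "j \<in> I" for j
  proof (cases "f j = 0")
    case False
    then show ?thesis using le[OF that False] v that has_residue_eps_mult by blast
  qed (auto intro: has_residue_0)
  have "g \<in> v ` {i\<in>I. f i \<noteq> 0}" unfolding g_def using assms by (intro Max_in) auto
  then obtain j where j: "j \<in> I" "f j \<noteq> 0" "g = v j" by auto
  from ex obtain r where r: "\<And>i. i \<in> I \<Longrightarrow> has_residue (eps g * f i) (r i)" by metis
  moreover have "r j \<noteq> 0" using v j r[OF j(1)] has_residue_unique by blast
  ultimately show ?thesis using that j by blast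
qed

text \<open>Reads the coefficients of an element of \<complex>[\<Gamma>] off its residue. A negative
  leading exponent would give residue zero after normalisation, although the leading coefficient is
  nonzero.\<close>

lemma has_residue_to_fractD:
  fixes q :: "'g::linordered_ab_group_add \<Rightarrow>\<^sub>0 complex"
  assumes "has_residue (to_fract q) r"
  shows "q \<in> nonneg_keys \<and> Poly_Mapping.lookup q 0 = r"
proof (cases "q = 0")
  case True
  then show ?thesis using assms by (simp add: has_residue_0_iff nonneg_keys_def)
next
  case False
  then obtain g where g: "g \<in> Poly_Mapping.keys q" "Poly_Mapping.single (- g) 1 * q \<in> nonneg_keys"
    "Poly_Mapping.lookup (Poly_Mapping.single (- g) 1 * q) 0 \<noteq> 0"
    by (metis normalize_leading)
  have "\<not> g < 0"
  proof
    assume "g < 0"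
    have "has_residue (eps (- g) * to_fract q) (0 * r)"
      by (intro has_residue_mult has_residue_eps assms) (use \<open>g < 0\<close> in simp)
    moreover have "eps (- g) * to_fract q = to_fract (Poly_Mapping.single (- g) 1 * q)"
      by (simp add: eps_def)
    ultimately show False using has_residue_to_fract[OF g(2)] g(3) has_residue_unique by fastforce
  qed
  have "q \<in> nonneg_keys"
  proof (rule nonneg_keysI)
    fix h :: 'g assume "h < 0"
    then have "h - g < 0" using \<open>\<not> g < 0\<close> by (meson diff_less_0_iff_less less_le_trans not_less)
    then show "Poly_Mapping.lookup q h = 0"
      using nonneg_keysD[OF g(2), of "h - g"] by (simp add: lookup_single_times)
  qed
  then show ?thesis using has_residue_to_fract assms has_residue_unique by blast
qed


section \<open>Fractions with coefficients in a subring, and the valuation ring inside K\<close>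

lemma subring_of_typeD:
  assumes "subring R (ring_of_type_algebra :: 'a::comm_ring_1 ring)"
  shows "0 \<in> R" "1 \<in> R" "x \<in> R \<Longrightarrow> y \<in> R \<Longrightarrow> x + y \<in> R"
    "x \<in> R \<Longrightarrow> y \<in> R \<Longrightarrow> x * y \<in> R" "x \<in> R \<Longrightarrow> - x \<in> R"
proof -
  interpret ring "ring_of_type_algebra :: 'a ring" by (rule ring_from_type_algebra)
  interpret subring R "ring_of_type_algebra :: 'a ring" by (rule assms)
  show "0 \<in> R" "1 \<in> R" using subringE(2,3)[OF assms] by (simp_all add: ring_of_type_algebra_def)
  show "x + y \<in> R" if "x \<in> R" "y \<in> R" for x y
    using subringE(7)[OF assms that] by (simp add: ring_of_type_algebra_def)
  show "x * y \<in> R" if "x \<in> R" "y \<in> R" for x y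
    using subringE(6)[OF assms that] by (simp add: ring_of_type_algebra_def)
  show "- x \<in> R" if "x \<in> R" for x
  proof -
    have "\<ominus>\<^bsub>ring_of_type_algebra\<^esub> x \<in> R" by (rule subringE(5)[OF assms that])
    moreover have "\<ominus>\<^bsub>ring_of_type_algebra\<^esub> x = - x"
      by (rule minus_equality) (simp_all add: ring_of_type_algebra_def)
    ultimately show ?thesis by simp
  qed
qed

lemma sum_in_closed:
  fixes f :: "'i \<Rightarrow> 'a::comm_monoid_add"
  assumes "0 \<in> k" "\<And>x y. x \<in> k \<Longrightarrow> y \<in> k \<Longrightarrow> x + y \<in> k" "\<And>i. i \<in> I \<Longrightarrow> f i \<in> k"
  shows "(\<Sum>i\<in>I. f i) \<in> k"
  using assms(3) by (induction I rule: infinite_finite_induct) (auto intro: assms(1,2))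

lemma prod_in_closed:
  fixes f :: "'i \<Rightarrow> 'a::comm_monoid_mult"
  assumes "1 \<in> k" "\<And>x y. x \<in> k \<Longrightarrow> y \<in> k \<Longrightarrow> x * y \<in> k" "\<And>i. i \<in> I \<Longrightarrow> f i \<in> k"
  shows "(\<Prod>i\<in>I. f i) \<in> k"
  using assms(3) by (induction I rule: infinite_finite_induct) (auto intro: assms(1,2))

context
  fixes R :: "complex set"
  assumes R: "subring R (ring_of_type_algebra :: complex ring)"
begin

lemma group_alg_closed:
  shows "0 \<in> group_alg R" "1 \<in> group_alg R"
    "p \<in> group_alg R \<Longrightarrow> q \<in> group_alg R \<Longrightarrow> p + q \<in> group_alg R"
    "p \<in> group_alg R \<Longrightarrow> q \<in> group_alg R \<Longrightarrow> p * q \<in> group_alg R"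
    "p \<in> group_alg R \<Longrightarrow> - p \<in> group_alg R"
    "c \<in> R \<Longrightarrow> Poly_Mapping.single g c \<in> group_alg R"
proof -
  note cl = subring_of_typeD[OF R]
  show "0 \<in> group_alg R" "1 \<in> group_alg R" "c \<in> R \<Longrightarrow> Poly_Mapping.single g c \<in> group_alg R"
    using cl by (auto simp: group_alg_def lookup_one lookup_single when_def)
  show "p \<in> group_alg R \<Longrightarrow> q \<in> group_alg R \<Longrightarrow> p + q \<in> group_alg R"
    "p \<in> group_alg R \<Longrightarrow> - p \<in> group_alg R"
    using cl by (auto simp: group_alg_def lookup_add)
  show "p * q \<in> group_alg R" if "p \<in> group_alg R" "q \<in> group_alg R"
  proof -
    have "(c when P) \<in> R" if "c \<in> R" for c P using that cl(1) by (simp add: when_def)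
    then show ?thesis using that cl
      by (auto simp: group_alg_def lookup_mult Sum_any.expand_set intro!: sum_in_closed cl(4))
  qed
qed

lemma K_fieldI:
  "a \<in> group_alg R \<Longrightarrow> b \<in> group_alg R \<Longrightarrow> b \<noteq> 0 \<Longrightarrow> to_fract a / to_fract b \<in> K_field R"
  unfolding K_field_def by blast

lemma to_fract_in_K_field: "a \<in> group_alg R \<Longrightarrow> to_fract a \<in> K_field R"
  using K_fieldI[of a 1] group_alg_closed by simp

lemma K_field_closed:
  shows "0 \<in> K_field R" "1 \<in> K_field R" "eps g \<in> K_field R"
    "x \<in> K_field R \<Longrightarrow> y \<in> K_field R \<Longrightarrow> x + y \<in> K_field R"
    "x \<in> K_field R \<Longrightarrow> y \<in> K_field R \<Longrightarrow> x * y \<in> K_field R"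
    "x \<in> K_field R \<Longrightarrow> - x \<in> K_field R"
    "x \<in> K_field R \<Longrightarrow> inverse x \<in> K_field R"
proof -
  note cl = group_alg_closed
  show "0 \<in> K_field R" "1 \<in> K_field R" "eps g \<in> K_field R"
    using to_fract_in_K_field[OF cl(1)] to_fract_in_K_field[OF cl(2)]
      to_fract_in_K_field[OF cl(6)[OF subring_of_typeD(2)[OF R]]] by (simp_all add: eps_def)
  show "x + y \<in> K_field R" "x * y \<in> K_field R" if "x \<in> K_field R" "y \<in> K_field R"
  proof -
    from that obtain a b a' b' where x: "x = to_fract a / to_fract b" "y = to_fract a' / to_fract b'"
      and *: "b \<noteq> 0" "b' \<noteq> 0" "a \<in> group_alg R" "b \<in> group_alg R" "a' \<in> group_alg R" "b' \<in> group_alg R"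
      by (auto simp: K_field_def)
    have "x + y = to_fract (a * b' + a' * b) / to_fract (b * b')" "x * y = to_fract (a * a') / to_fract (b * b')"
      using * by (simp_all add: x add_frac_eq)
    then show "x + y \<in> K_field R" "x * y \<in> K_field R" using * by (metis cl(3,4) K_fieldI mult_eq_0_iff)+
  qed
  show "- x \<in> K_field R" if "x \<in> K_field R"
  proof -
    from that obtain a b where "x = to_fract a / to_fract b" "a \<in> group_alg R" "b \<in> group_alg R" "b \<noteq> 0"
      by (auto simp: K_field_def)
    moreover from this have "- x = to_fract (- a) / to_fract b" by simp
    ultimately show ?thesis using K_fieldI cl(5) by metis
  qed
  show "inverse x \<in> K_field R" if "x \<in> K_field R"
  proof (cases "x = 0")
    case False
    with that show ?thesis unfolding K_field_def by (force simp: inverse_eq_divide)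
  qed (use \<open>0 \<in> K_field R\<close> in simp)
qed

text \<open>The remainder is divided by the leading coefficient, which is why \<open>p\<close> has
  coefficients in the fraction field and not in \<open>R\<close>.\<close>

lemma group_alg_leading_form:
  assumes "a \<in> group_alg R" "a \<noteq> 0"
  obtains g r p where "r \<in> R" "r \<noteq> 0" "p \<in> group_alg_pos (frac_field R)"
    "a = Poly_Mapping.single g r * (1 + p)"
proof -
  obtain g where g: "Poly_Mapping.single (- g) 1 * a \<in> nonneg_keys" "Poly_Mapping.lookup a g \<noteq> 0"
    using assms(2) by (metis normalize_leading)
  define r where "r = Poly_Mapping.lookup a g"
  define p where "p = Poly_Mapping.single (- g) (1 / r) * a - 1"
  have r: "r \<in> R" "r \<noteq> 0" using assms g by (auto simp: r_def group_alg_def)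
  have look: "Poly_Mapping.lookup p h = (if h = 0 then 0 else Poly_Mapping.lookup a (h + g) / r)" for h
    using r by (auto simp: p_def lookup_minus lookup_single_times lookup_one r_def)
  have "Poly_Mapping.lookup p h \<in> frac_field R" for h
    using r assms(1) subring_of_typeD(1,2)[OF R] unfolding look frac_field_def group_alg_def
    by (cases "h = 0") force+
  moreover have "0 < h" if "h \<in> Poly_Mapping.keys p" for h
  proof (rule ccontr)
    assume "\<not> 0 < h"
    with that have "h < 0" "Poly_Mapping.lookup a (h + g) \<noteq> 0"
      by (auto simp: in_keys_iff look split: if_splits)
    with nonneg_keysD[OF g(1), of h] show False by (simp add: lookup_single_times)
  qed
  ultimately have "p \<in> group_alg_pos (frac_field R)" by (simp add: group_alg_pos_def group_alg_def)
  moreover have "a = Poly_Mapping.single g r * (1 + p)"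
  proof -
    have "Poly_Mapping.single g r * (1 + p) =
      Poly_Mapping.single g r * Poly_Mapping.single (- g) (1 / r) * a"
      by (simp add: p_def algebra_simps)
    also have "\<dots> = a" using r by (simp add: mult_single)
    finally show ?thesis by simp
  qed
  ultimately show ?thesis using that r by blast
qed

lemma leading_form_has_residue:
  assumes "p \<in> group_alg_pos F" "q \<in> group_alg_pos F"
    and "x = to_fract (Poly_Mapping.single 0 r) * eps g * (to_fract (1 + p) / to_fract (1 + q))"
  shows "has_residue (eps (- g) * x) r"
proof -
  have 1: "1 + p \<in> nonneg_keys" "Poly_Mapping.lookup (1 + p) 0 = 1" if "p \<in> group_alg_pos F" for p
  proof -
    have "p \<in> nonneg_keys" "Poly_Mapping.lookup p 0 = 0"
      using that by (auto simp: group_alg_pos_def nonneg_keys_def in_keys_iff less_imp_le)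
    then show "1 + p \<in> nonneg_keys" "Poly_Mapping.lookup (1 + p) 0 = 1"
      by (simp_all add: add_nonneg_keys one_nonneg_keys lookup_add lookup_one)
  qed
  have "has_residue (to_fract (Poly_Mapping.single 0 r)) r"
    using has_residue_to_fract[OF single_nonneg_keys[of 0 r]] by simp
  from has_residue_mult[OF this has_residueI[OF 1(1)[OF assms(1)] 1(1)[OF assms(2)]]]
  have "has_residue (to_fract (Poly_Mapping.single 0 r) * (to_fract (1 + p) / to_fract (1 + q))) r"
    by (simp add: 1(2) assms(1,2) del: to_fract_add)
  moreover have "eps (- g) * x = to_fract (Poly_Mapping.single 0 r) * (to_fract (1 + p) / to_fract (1 + q))"
    by (simp add: assms(3) inverse_eps[symmetric] eps_nonzero del: to_fract_add)
  ultimately show ?thesis by simp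
qed

text \<open>\<open>g_exp\<close> is a definite description, so existence and uniqueness are both
  due. The leading forms of numerator and denominator supply an exponent; two admissible exponents
  bound each other because each yields a nonzero residue.\<close>

lemma g_exp_works:
  assumes "x \<in> K_field R" "x \<noteq> 0"
  shows "\<exists>r\<in>frac_field R - {0}. has_residue (eps (- g_exp (frac_field R) x) * x) r"
proof -
  let ?P = "\<lambda>g. \<exists>r\<in>frac_field R - {0}. \<exists>p\<in>group_alg_pos (frac_field R). \<exists>q\<in>group_alg_pos (frac_field R).
     x = to_fract (Poly_Mapping.single 0 r) * eps g * (to_fract (1 + p) / to_fract (1 + q))"
  obtain a b where x: "x = to_fract a / to_fract b" and ab: "a \<in> group_alg R" "b \<in> group_alg R" "b \<noteq> 0"
    using assms by (auto simp: K_field_def)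
  with assms have "a \<noteq> 0" by auto
  obtain g r p where a: "r \<in> R" "r \<noteq> 0" "p \<in> group_alg_pos (frac_field R)"
    "a = Poly_Mapping.single g r * (1 + p)"
    by (rule group_alg_leading_form[OF ab(1) \<open>a \<noteq> 0\<close>])
  obtain h s q where b: "s \<in> R" "s \<noteq> 0" "q \<in> group_alg_pos (frac_field R)"
    "b = Poly_Mapping.single h s * (1 + q)"
    by (rule group_alg_leading_form[OF ab(2,3)])
  have "Poly_Mapping.single g r * Poly_Mapping.single 0 s =
    Poly_Mapping.single 0 r * Poly_Mapping.single (g - h) 1 * Poly_Mapping.single h s"
    by (simp add: mult_single)
  then have "Poly_Mapping.single g r = Poly_Mapping.single 0 (r / s) * Poly_Mapping.single (g - h) 1 * Poly_Mapping.single h s"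
    using b by (simp add: mult_single)
  then have "to_fract (Poly_Mapping.single g r) / to_fract (Poly_Mapping.single h s) =
    to_fract (Poly_Mapping.single 0 (r / s)) * eps (g - h)"
    using ab(3) b(4) by (auto simp: eps_def)
  then have "x = to_fract (Poly_Mapping.single 0 (r / s)) * eps (g - h) * (to_fract (1 + p) / to_fract (1 + q))"
    by (simp add: x a(4) b(4) times_divide_times_eq[symmetric] del: to_fract_add times_divide_eq_right times_divide_eq_left)
  moreover have "r / s \<in> frac_field R - {0}" using a b by (auto simp: frac_field_def)
  ultimately have ex: "?P (g - h)" using a(3) b(3) by blast
  have res: "\<exists>r\<in>frac_field R - {0}. has_residue (eps (- g) * x) r" if "?P g" for g
    using that leading_form_has_residue by blast
  have le: "g \<le> h" if "?P g" "?P h" for g h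
    using res[OF that(1)] res[OF that(2)] has_residue_exponent_le[of "- h" x _ "- g"] by auto
  have "g_exp (frac_field R) x = g - h"
    unfolding g_exp_def
  proof (rule the_equality[where P = ?P])
    show "?P (g - h)" by (rule ex)
    show "g' = g - h" if "?P g'" for g' using le[OF that ex] le[OF ex that] by (rule antisym)
  qed
  with res[OF ex] show ?thesis by simp
qed

text \<open>Separates the two sides of integrality: membership of K is a closure property, and the
  rest is a statement in the ambient field which does not mention \<open>R\<close>.\<close>

lemma O_ring_iff: "x \<in> O_ring R \<longleftrightarrow> x \<in> K_field R \<and> (\<exists>r. has_residue x r)"
proof (cases "x \<in> K_field R \<and> x \<noteq> 0")
  case True
  let ?g = "g_exp (frac_field R) x"
  obtain r where r: "has_residue (eps (- ?g) * x) r" "r \<noteq> 0" using g_exp_works True by blast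
  have "\<exists>r. has_residue x r" if "0 \<le> ?g"
    using has_residue_eps_mult[OF _ r(1), of 0] that by (auto simp: eps_0)
  moreover have "0 \<le> ?g" if "has_residue x s" for s
    using has_residue_exponent_le[OF r, of 0 s] that by (simp add: eps_0)
  ultimately show ?thesis using True by (auto simp: O_ring_def)
qed (auto simp: O_ring_def has_residue_0_iff)

text \<open>A residue is a priori any complex number; a nonzero one is the leading coefficient of
  the normal form, hence in F. Through this fact a real F makes all residues real.\<close>

lemma residue_in_frac_field:
  assumes "x \<in> K_field R" "has_residue x r"
  shows "r \<in> frac_field R"
proof (cases "r = 0")
  case True
  then show ?thesis using subring_of_typeD[OF R] by (force simp: frac_field_def)
next
  case False
  then have "x \<noteq> 0" using assms(2) has_residue_0_iff by blast
  let ?g = "g_exp (frac_field R) x"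
  obtain s where s: "s \<in> frac_field R" "s \<noteq> 0" "has_residue (eps (- ?g) * x) s"
    using g_exp_works assms(1) \<open>x \<noteq> 0\<close> by blast
  have x: "has_residue (eps 0 * x) r" using assms(2) by (simp add: eps_0)
  have "- ?g = 0"
    using has_residue_exponent_le[OF x False s(3)] has_residue_exponent_le[OF s(3,2) x]
    by (rule antisym[rotated])
  with s(3) x have "has_residue (eps 0 * x) s" by simp
  with x s(1) has_residue_unique show ?thesis by blast
qed

text \<open>The residue map is multiplicative, so a unit has nonzero residue; conversely a nonzero
  residue survives inversion.\<close>

lemma O_units_iff: "x \<in> O_units R \<longleftrightarrow> x \<in> K_field R \<and> (\<exists>r. has_residue x r \<and> r \<noteq> 0)"
proof
  assume "x \<in> O_units R"
  then obtain y r s where "x \<in> K_field R" "x * y = 1" "has_residue x r" "has_residue y s"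
    by (auto simp: O_units_def O_ring_iff)
  moreover from this have "r * s = 1" using has_residue_mult has_residue_1 has_residue_unique by metis
  ultimately show "x \<in> K_field R \<and> (\<exists>r. has_residue x r \<and> r \<noteq> 0)" by auto
next
  assume *: "x \<in> K_field R \<and> (\<exists>r. has_residue x r \<and> r \<noteq> 0)"
  then have "x \<noteq> 0" using has_residue_0_iff by blast
  with * show "x \<in> O_units R" unfolding O_units_def O_ring_iff
    by (intro CollectI conjI bexI[of _ "inverse x"])
      (auto simp: O_ring_iff intro: K_field_closed(7) has_residue_inverse)
qed

end

section \<open>Coxeter groups and Schur relations\<close>

text \<open>The size is an argument because it is not part of the matrix type: an empty sum has to
  be the zero matrix of size \<open>n\<close>.\<close>

definition matsum :: "nat \<Rightarrow> ('i \<Rightarrow> 'k::comm_ring_1 mat) \<Rightarrow> 'i set \<Rightarrow> 'k mat" where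
  "matsum n f I = mat n n (\<lambda>(i, j). \<Sum>w\<in>I. f w $$ (i, j))"

lemma matsum_carrier [simp]: "matsum n f I \<in> carrier_mat n n"
  by (simp add: matsum_def)

lemma matsum_index: "i < n \<Longrightarrow> j < n \<Longrightarrow> matsum n f I $$ (i, j) = (\<Sum>w\<in>I. f w $$ (i, j))"
  by (simp add: matsum_def)

lemma mat_mult_index:
  "A \<in> carrier_mat n m \<Longrightarrow> B \<in> carrier_mat m l \<Longrightarrow> i < n \<Longrightarrow> j < l \<Longrightarrow>
   (A * B) $$ (i, j) = (\<Sum>k<m. A $$ (i, k) * B $$ (k, j))"
  by (auto simp: scalar_prod_def lessThan_atLeast0)

lemma matsum_empty: "matsum n f {} = 0\<^sub>m n n"
  by (auto simp: matsum_def)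

lemma matsum_insert:
  "finite I \<Longrightarrow> i \<notin> I \<Longrightarrow> f i \<in> carrier_mat n n \<Longrightarrow> matsum n f (insert i I) = f i + matsum n f I"
  by (auto simp: matsum_def)

lemma mult_matsum:
  assumes "M \<in> carrier_mat n n" "\<And>w. w \<in> I \<Longrightarrow> f w \<in> carrier_mat n n"
  shows "M * matsum n f I = matsum n (\<lambda>w. M * f w) I"
proof (rule eq_matI)
  fix i j assume "i < dim_row (matsum n (\<lambda>w. M * f w) I)" "j < dim_col (matsum n (\<lambda>w. M * f w) I)"
  then have ij: "i < n" "j < n" by (simp_all add: matsum_def)
  have "(M * matsum n f I) $$ (i, j) = (\<Sum>k<n. \<Sum>w\<in>I. M $$ (i, k) * f w $$ (k, j))"
    using ij by (simp add: mat_mult_index[OF assms(1) matsum_carrier] matsum_index sum_distrib_left)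
  also have "\<dots> = (\<Sum>w\<in>I. (M * f w) $$ (i, j))"
    using ij by (subst sum.swap) (simp add: mat_mult_index[OF assms(1) assms(2)])
  finally show "(M * matsum n f I) $$ (i, j) = matsum n (\<lambda>w. M * f w) I $$ (i, j)"
    using ij by (simp add: matsum_index)
qed (use assms in \<open>auto simp: matsum_def\<close>)

lemma matsum_mult:
  assumes "M \<in> carrier_mat n n" "\<And>w. w \<in> I \<Longrightarrow> f w \<in> carrier_mat n n"
  shows "matsum n f I * M = matsum n (\<lambda>w. f w * M) I"
proof (rule eq_matI)
  fix i j assume "i < dim_row (matsum n (\<lambda>w. f w * M) I)" "j < dim_col (matsum n (\<lambda>w. f w * M) I)"
  then have ij: "i < n" "j < n" by (simp_all add: matsum_def)
  have "(matsum n f I * M) $$ (i, j) = (\<Sum>k<n. \<Sum>w\<in>I. f w $$ (i, k) * M $$ (k, j))"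
    using ij by (simp add: mat_mult_index[OF matsum_carrier assms(1)] matsum_index sum_distrib_right)
  also have "\<dots> = (\<Sum>w\<in>I. (f w * M) $$ (i, j))"
    using ij by (subst sum.swap) (simp add: mat_mult_index[OF assms(2) assms(1)])
  finally show "(matsum n f I * M) $$ (i, j) = matsum n (\<lambda>w. f w * M) I $$ (i, j)"
    using ij by (simp add: matsum_index)
qed (use assms in \<open>auto simp: matsum_def\<close>)

lemma matsum_cong:
  "(\<And>w. w \<in> I \<Longrightarrow> f w = g w) \<Longrightarrow> matsum n f I = matsum n g I"
  by (simp add: matsum_def cong: sum.cong)

lemma matsum_reindex_bij_betw:
  "bij_betw h I J \<Longrightarrow> matsum n (\<lambda>w. f (h w)) I = matsum n f J"
  unfolding matsum_def by (auto intro!: cong_mat sum.reindex_bij_betw[where g = "\<lambda>w. f w $$ _"])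

lemma mat_trace_mult_comm:
  assumes "A \<in> carrier_mat n m" "B \<in> carrier_mat m n"
  shows "mat_trace (A * B) = mat_trace (B * A :: 'k::comm_ring_1 mat)"
proof -
  have "mat_trace (A * B) = (\<Sum>i<n. \<Sum>k<m. A $$ (i, k) * B $$ (k, i))"
    using assms by (simp add: mat_trace_def mat_mult_index[OF assms] del: index_mult_mat(1))
  also have "\<dots> = (\<Sum>k<m. \<Sum>i<n. B $$ (k, i) * A $$ (i, k))"
    by (subst sum.swap) (simp add: mult.commute)
  also have "\<dots> = mat_trace (B * A)"
    using assms by (simp add: mat_trace_def mat_mult_index[OF assms(2,1)] del: index_mult_mat(1))
  finally show ?thesis .
qed

lemma similar_mat_wit_trace:
  assumes "similar_mat_wit A B P Q"
  shows "mat_trace A = mat_trace (B :: 'k::comm_ring_1 mat)"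
proof -
  define n where "n = dim_row A"
  have c: "A = P * B * Q" "Q * P = 1\<^sub>m n" "B \<in> carrier_mat n n" "P \<in> carrier_mat n n" "Q \<in> carrier_mat n n"
    using similar_mat_witD[OF n_def assms] by blast+
  have "mat_trace A = mat_trace (Q * (P * B))"
    unfolding c(1) by (rule mat_trace_mult_comm[of _ n n]) (use c(3-5) in auto)
  also have "Q * (P * B) = B" using c(2-5) assoc_mult_mat[of Q n n P n B n] by simp
  finally show ?thesis .
qed

lemma transpose_smult_mat: "(c \<cdot>\<^sub>m A)\<^sup>T = c \<cdot>\<^sub>m A\<^sup>T"
  by (rule eq_matI) auto

section \<open>Length function of a finite Coxeter group\<close>

locale coxeter_group = group W for W (structure) +
  fixes S
  assumes coxeter: "coxeter_system W S" and finite_carrier: "finite (carrier W)"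
begin

abbreviation len where "len \<equiv> cox_length W S"

lemma S_carrier: "s \<in> S \<Longrightarrow> s \<in> carrier W"
  using coxeter by (auto simp: coxeter_system_def)

lemma S_square: "s \<in> S \<Longrightarrow> s \<otimes> s = \<one>"
  using coxeter pow_ord_eq_1[of s] S_carrier[of s] by (auto simp: coxeter_system_def numeral_2_eq_2)

lemma S_cancel: "s \<in> S \<Longrightarrow> w \<in> carrier W \<Longrightarrow> s \<otimes> (s \<otimes> w) = w"
  by (simp add: S_carrier S_square flip: m_assoc)

lemma S_cancel_right: "s \<in> S \<Longrightarrow> w \<in> carrier W \<Longrightarrow> (w \<otimes> s) \<otimes> s = w"
  by (simp add: S_carrier S_square m_assoc)

lemma inv_S: "s \<in> S \<Longrightarrow> inv s = s"
  using S_square S_carrier inv_equality by blast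

lemma word_prod_Cons: "word_prod W (s # ws) = s \<otimes> word_prod W ws"
  by (simp add: word_prod_def)

lemma word_prod_closed: "ws \<in> lists S \<Longrightarrow> word_prod W ws \<in> carrier W"
  by (induction ws) (auto simp: word_prod_def S_carrier)

lemma word_prod_snoc: "ws \<in> lists S \<Longrightarrow> s \<in> S \<Longrightarrow> word_prod W (ws @ [s]) = word_prod W ws \<otimes> s"
  by (induction ws) (auto simp: word_prod_Cons S_carrier word_prod_closed m_assoc, simp add: word_prod_def S_carrier)

lemma word_prod_rev: "ws \<in> lists S \<Longrightarrow> word_prod W (rev ws) = inv (word_prod W ws)"
proof (induction ws)
  case (Cons s ws)
  then have "word_prod W (rev ws @ [s]) = inv (word_prod W ws) \<otimes> s"
    by (subst word_prod_snoc) auto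
  with Cons show ?case by (simp add: word_prod_Cons inv_mult_group S_carrier word_prod_closed inv_S)
qed (simp add: word_prod_def)

lemma len_le: "ws \<in> lists S \<Longrightarrow> len (word_prod W ws) \<le> length ws"
  unfolding cox_length_def by (rule Least_le) blast

lemma reduced_word:
  assumes "w \<in> carrier W"
  obtains ws where "ws \<in> lists S" "length ws = len w" "word_prod W ws = w"
proof -
  have "word_prod W ` lists S = carrier W" using coxeter by (auto simp: coxeter_system_def)
  with assms have "w \<in> word_prod W ` lists S" by simp
  then have "\<exists>n. \<exists>ws\<in>lists S. length ws = n \<and> word_prod W ws = w" by blast
  from LeastI_ex[OF this] show ?thesis using that unfolding cox_length_def by blast
qed

lemma len_one: "len \<one> = 0"
  using len_le[of "[]"] by (simp add: word_prod_def)

lemma len_inv_le: "w \<in> carrier W \<Longrightarrow> len (inv w) \<le> len w"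
proof -
  assume "w \<in> carrier W"
  then obtain ws where "ws \<in> lists S" "length ws = len w" "word_prod W ws = w" by (rule reduced_word)
  then show ?thesis using len_le[of "rev ws"] by (simp add: word_prod_rev in_lists_conv_set)
qed

lemma len_inv: "w \<in> carrier W \<Longrightarrow> len (inv w) = len w"
  using len_inv_le[of w] len_inv_le[of "inv w"] by simp

lemma len_S_mult_le: "s \<in> S \<Longrightarrow> w \<in> carrier W \<Longrightarrow> len (s \<otimes> w) \<le> len w + 1"
proof -
  assume "s \<in> S" "w \<in> carrier W"
  moreover obtain ws where "ws \<in> lists S" "length ws = len w" "word_prod W ws = w"
    using \<open>w \<in> carrier W\<close> by (rule reduced_word)
  ultimately show ?thesis using len_le[of "s # ws"] by (simp add: word_prod_Cons)
qed

text \<open>Every relator is a power of a two-letter word, so the parity of the length is an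
  invariant of the element.\<close>

lemma cox_cong_even: "cox_cong W S u v \<Longrightarrow> even (length u) = even (length v)"
proof (induction rule: cox_cong.induct)
  case (relator u v s t)
  have "even (length (concat (replicate m [s, t])))" for m by (induction m) auto
  then show ?case by simp
qed auto

text \<open>Otherwise \<open>s \<otimes> w\<close> would have words of lengths
  \<open>len w + 1\<close> and \<open>len w\<close>, which the presentation makes congruent despite
  their different parities.\<close>

lemma len_S_mult_neq: 
  assumes "s \<in> S" "w \<in> carrier W"
  shows "len (s \<otimes> w) \<noteq> len w"
proof
  assume eq: "len (s \<otimes> w) = len w"
  obtain u where u: "u \<in> lists S" "length u = len w" "word_prod W u = w"
    using assms(2) by (rule reduced_word)
  obtain v where v: "v \<in> lists S" "length v = len (s \<otimes> w)" "word_prod W v = s \<otimes> w"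
    by (rule reduced_word[of "s \<otimes> w"]) (use assms S_carrier in auto)
  have "word_prod W (s # u) = word_prod W v" "s # u \<in> lists S"
    using u v assms by (simp_all add: word_prod_Cons)
  then have "cox_cong W S (s # u) v"
    using v(1) coxeter unfolding coxeter_system_def by blast
  from cox_cong_even[OF this] u v eq show False by simp
qed

lemma len_mult_S: "s \<in> S \<Longrightarrow> w \<in> carrier W \<Longrightarrow> len (w \<otimes> s) = len (s \<otimes> inv w)"
  by (simp add: S_carrier inv_S inv_mult_group len_inv flip: len_inv[of "w \<otimes> s"])

lemma len_mult_S_le: "s \<in> S \<Longrightarrow> w \<in> carrier W \<Longrightarrow> len (w \<otimes> s) \<le> len w + 1"
  using len_S_mult_le[of s "inv w"] by (simp add: len_mult_S len_inv)

text \<open>Peels the first letter off a reduced word. Unlike induction on arbitrary words, it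
  supplies the length condition under which the Hecke relation is a plain product.\<close>

lemma len_induct [consumes 1, case_names one mult]:
  assumes "w \<in> carrier W" "P \<one>"
    and "\<And>s w. s \<in> S \<Longrightarrow> w \<in> carrier W \<Longrightarrow> len w < len (s \<otimes> w) \<Longrightarrow> P w \<Longrightarrow> P (s \<otimes> w)"
  shows "P w"
  using assms(1)
proof (induction "len w" arbitrary: w rule: less_induct)
  case less
  obtain ws where ws: "ws \<in> lists S" "length ws = len w" "word_prod W ws = w"
    using less(2) by (rule reduced_word)
  show ?case
  proof (cases ws)
    case Nil
    then show ?thesis using ws assms(2) by (simp add: word_prod_def)
  next
    case (Cons s u)
    with ws have u: "s \<in> S" "word_prod W u \<in> carrier W" "w = s \<otimes> word_prod W u" "len (word_prod W u) < len w"
      using len_le[of u] by (auto simp: word_prod_Cons word_prod_closed)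
    then show ?thesis using less(1)[OF u(4,2)] assms(3)[OF u(1,2)] by simp
  qed
qed

text \<open>Records a representation by its values on the standard basis. With \<xi> equal to
  \<open>eps (L s) - inverse (eps (L s))\<close> these are the Hecke relations, with \<xi> zero
  those of the group algebra, so both share the Casimir argument.\<close>

definition hecke_rep :: "('a \<Rightarrow> 'k::comm_ring_1) \<Rightarrow> nat \<Rightarrow> ('a \<Rightarrow> 'k mat) \<Rightarrow> bool" where
  "hecke_rep \<xi> n \<tau> \<longleftrightarrow> (\<forall>w\<in>carrier W. \<tau> w \<in> carrier_mat n n) \<and> \<tau> \<one> = 1\<^sub>m n \<and>
     (\<forall>s\<in>S. \<forall>w\<in>carrier W.
        (len w < len (s \<otimes> w) \<longrightarrow> \<tau> s * \<tau> w = \<tau> (s \<otimes> w)) \<and>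
        (len (s \<otimes> w) < len w \<longrightarrow> \<tau> s * \<tau> w = \<tau> (s \<otimes> w) + \<xi> s \<cdot>\<^sub>m \<tau> w))"

context
  fixes \<xi> :: "'a \<Rightarrow> 'k::comm_ring_1" and n :: nat and \<tau> :: "'a \<Rightarrow> 'k mat"
  assumes rep: "hecke_rep \<xi> n \<tau>"
begin

lemma hecke_rep_carrier: "w \<in> carrier W \<Longrightarrow> \<tau> w \<in> carrier_mat n n"
  using rep by (auto simp: hecke_rep_def)

lemma hecke_rep_one: "\<tau> \<one> = 1\<^sub>m n"
  using rep by (auto simp: hecke_rep_def)

lemma hecke_rep_up: "s \<in> S \<Longrightarrow> w \<in> carrier W \<Longrightarrow> len w < len (s \<otimes> w) \<Longrightarrow> \<tau> (s \<otimes> w) = \<tau> s * \<tau> w"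
  using rep by (auto simp: hecke_rep_def)

lemma hecke_rep_down:
  "s \<in> S \<Longrightarrow> w \<in> carrier W \<Longrightarrow> len (s \<otimes> w) < len w \<Longrightarrow> \<tau> s * \<tau> w = \<tau> (s \<otimes> w) + \<xi> s \<cdot>\<^sub>m \<tau> w"
  using rep by (auto simp: hecke_rep_def)

lemma hecke_rep_square: "s \<in> S \<Longrightarrow> \<tau> s * \<tau> s = 1\<^sub>m n + \<xi> s \<cdot>\<^sub>m \<tau> s"
  using hecke_rep_down[of s s] len_S_mult_neq[of s \<one>]
  by (simp add: S_carrier S_square len_one hecke_rep_one)

text \<open>The relations prescribe multiplication by generators on the left only. Since one letter
  changes the length by at most one, the length of \<open>t \<otimes> w \<otimes> s\<close> forces
  it to grow along \<open>w\<close>, \<open>w \<otimes> s\<close>,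
  \<open>t \<otimes> w \<otimes> s\<close>, so induction and left relation both apply.\<close>

lemma hecke_rep_right_up:
  assumes "w \<in> carrier W" "s \<in> S" "len w < len (w \<otimes> s)"
  shows "\<tau> (w \<otimes> s) = \<tau> w * \<tau> s"
  using assms
proof (induction w rule: len_induct)
  case one
  then show ?case using hecke_rep_carrier[of s] by (simp add: hecke_rep_one S_carrier)
next
  case (mult t w)
  note [simp] = S_carrier hecke_rep_carrier
  have 1: "len (t \<otimes> w \<otimes> s) \<le> len (w \<otimes> s) + 1"
    using len_S_mult_le[of t "w \<otimes> s"] mult by (simp add: m_assoc)
  moreover have "len (w \<otimes> s) \<le> len w + 1" using len_mult_S_le[of s w] mult by simp
  ultimately have up: "len w < len (w \<otimes> s)" "len (w \<otimes> s) < len (t \<otimes> (w \<otimes> s))"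
    using mult by (auto simp: m_assoc)
  have "\<tau> (t \<otimes> w \<otimes> s) = \<tau> t * (\<tau> w * \<tau> s)"
    using up mult by (simp add: m_assoc hecke_rep_up)
  also have "\<dots> = \<tau> (t \<otimes> w) * \<tau> s"
    using mult by (simp add: hecke_rep_up assoc_mult_mat[of _ n n _ n _ n])
  finally show ?case .
qed

lemma hecke_rep_right_down:
  assumes "w \<in> carrier W" "s \<in> S" "len (w \<otimes> s) < len w"
  shows "\<tau> w * \<tau> s = \<tau> (w \<otimes> s) + \<xi> s \<cdot>\<^sub>m \<tau> w"
proof -
  note [simp] = S_carrier hecke_rep_carrier
  have w: "\<tau> w = \<tau> (w \<otimes> s) * \<tau> s"
    using hecke_rep_right_up[of "w \<otimes> s" s] assms by (simp add: S_cancel_right)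
  then have "\<tau> w * \<tau> s = \<tau> (w \<otimes> s) * (\<tau> s * \<tau> s)"
    using assms by (simp add: assoc_mult_mat[of _ n n _ n _ n])
  also have "\<dots> = \<tau> (w \<otimes> s) + \<xi> s \<cdot>\<^sub>m (\<tau> (w \<otimes> s) * \<tau> s)"
    using assms by (simp add: hecke_rep_square mult_add_distrib_mat[of _ n n _ n]
        mult_smult_distrib[of _ n n _ n] right_mult_one_mat[of _ n n])
  finally show ?thesis using w by simp
qed

text \<open>The dual representation: inversion and transposition both reverse products. Invariant
  bilinear forms are intertwiners from \<tau> to it.\<close>

lemma hecke_rep_transpose: "hecke_rep \<xi> n (\<lambda>w. (\<tau> (inv w))\<^sup>T)"
proof -
  note [simp] = S_carrier hecke_rep_carrier
  have "(\<tau> (inv s))\<^sup>T * (\<tau> (inv w))\<^sup>T = (\<tau> (inv w) * \<tau> s)\<^sup>T" if "s \<in> S" "w \<in> carrier W" for s w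
    using that by (simp add: inv_S transpose_mult[of _ n n _ n])
  moreover have "len (inv w \<otimes> s) = len (s \<otimes> w)" "inv (s \<otimes> w) = inv w \<otimes> s" if "s \<in> S" "w \<in> carrier W" for s w
    using that by (simp_all add: len_mult_S inv_mult_group inv_S)
  ultimately show ?thesis
    using hecke_rep_right_up[of "inv _"] hecke_rep_right_down[of "inv _"]
    by (auto simp: hecke_rep_def hecke_rep_one len_inv transpose_add[of _ n n] transpose_smult_mat)
qed

end

text \<open>Terms are paired as \<open>w\<close> and \<open>s \<otimes> w\<close>. The defect of
  each term is the negative of the defect of its partner, so twice the total defect is zero; this is
  where \<open>two\<close> enters.\<close>

lemma casimir_intertwines:
  fixes \<xi> :: "'a \<Rightarrow> 'k::field"
  assumes rep': "hecke_rep \<xi> n \<tau>'" and rep: "hecke_rep \<xi> n \<tau>" and Z: "Z \<in> carrier_mat n n"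
    and two: "(2 :: 'k) \<noteq> 0" and s: "s \<in> S"
  defines "C \<equiv> matsum n (\<lambda>w. \<tau>' w * Z * \<tau> (inv w)) (carrier W)"
  shows "\<tau>' s * C = C * \<tau> s"
proof -
  define f where "f w = \<tau>' w * Z * \<tau> (inv w)" for w
  note [simp] = S_carrier hecke_rep_carrier[OF rep] hecke_rep_carrier[OF rep'] Z
  note assoc = assoc_mult_mat[of _ n n _ n _ n] mult_carrier_mat[of _ n n _ n]
  have f [simp]: "w \<in> carrier W \<Longrightarrow> f w \<in> carrier_mat n n" for w by (auto simp: f_def intro!: mult_carrier_mat[of _ n n])
  \<comment> \<open>Here \<open>f (s \<otimes> w)\<close> is
    \<open>\<tau>' s * f w * \<tau> s\<close>. Both quadratic relations produce the same \<xi>-term,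
    and what remains of each product is the term that the other side contributes at
    \<open>w\<close>.\<close>
  have up: "\<tau>' s * f (s \<otimes> w) + \<tau>' s * f w = f (s \<otimes> w) * \<tau> s + f w * \<tau> s"
    if w: "w \<in> carrier W" and lt: "len w < len (s \<otimes> w)" for w
  proof -
    have "f (s \<otimes> w) = \<tau>' s * f w * \<tau> s"
    proof -
      have "\<tau> (inv (s \<otimes> w)) = \<tau> (inv w) * \<tau> s"
        using hecke_rep_right_up[OF rep, of "inv w" s] w lt s
        by (simp add: inv_mult_group inv_S len_mult_S len_inv)
      then show ?thesis using w lt s by (simp add: f_def hecke_rep_up[OF rep'] assoc)
    qed
    then have "\<tau>' s * f (s \<otimes> w) = \<tau>' s * \<tau>' s * (f w * \<tau> s)"
      "f (s \<otimes> w) * \<tau> s = \<tau>' s * f w * (\<tau> s * \<tau> s)"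
      using w s by (simp_all add: assoc)
    moreover have "\<tau>' s * \<tau>' s * (f w * \<tau> s) = f w * \<tau> s + \<xi> s \<cdot>\<^sub>m (\<tau>' s * (f w * \<tau> s))"
      using w s by (simp add: hecke_rep_square[OF rep'] add_mult_distrib_mat[of _ n n _ _ n]
          mult_smult_assoc_mat[of _ n n _ n] mult_carrier_mat[of _ n n _ n] left_mult_one_mat[of _ n n])
    moreover have "\<tau>' s * f w * (\<tau> s * \<tau> s) = \<tau>' s * f w + \<xi> s \<cdot>\<^sub>m (\<tau>' s * (f w * \<tau> s))"
      using w s by (simp add: hecke_rep_square[OF rep] mult_add_distrib_mat[of _ n n _ n]
          mult_smult_distrib[of _ n n _ n] assoc right_mult_one_mat[of _ n n])
    moreover have "P + c \<cdot>\<^sub>m U + Q = Q + c \<cdot>\<^sub>m U + P"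
      if "P \<in> carrier_mat n n" "Q \<in> carrier_mat n n" "U \<in> carrier_mat n n" for P Q U :: "'k mat" and c
      using that by (intro eq_matI) auto
    from this[of "f w * \<tau> s" "\<tau>' s * f w" "\<tau>' s * (f w * \<tau> s)" "\<xi> s"] w s
    have "f w * \<tau> s + \<xi> s \<cdot>\<^sub>m (\<tau>' s * (f w * \<tau> s)) + \<tau>' s * f w =
        \<tau>' s * f w + \<xi> s \<cdot>\<^sub>m (\<tau>' s * (f w * \<tau> s)) + f w * \<tau> s"
      by (simp add: assoc(2))
    ultimately show ?thesis by simp
  qed
  show ?thesis
  proof (rule eq_matI)
    fix i j assume "i < dim_row (C * \<tau> s)" "j < dim_col (C * \<tau> s)"
    then have ij: "i < n" "j < n" using s carrier_matD[OF hecke_rep_carrier[OF rep, of s]] by (simp_all add: C_def matsum_def)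
    define h where "h w = (\<tau>' s * f w) $$ (i, j) - (f w * \<tau> s) $$ (i, j)" for w
    \<comment> \<open>As \<open>h\<close> changes sign under \<open>w \<mapsto> s w\<close>, its sum over the group vanishes.\<close>
    have anti: "h (s \<otimes> w) = - h w" if w: "w \<in> carrier W" for w
    proof -
      have eq: "h (s \<otimes> w) + h w = 0" if w: "w \<in> carrier W" and lt: "len w < len (s \<otimes> w)" for w
        using arg_cong[OF up[OF w lt], of "\<lambda>M. M $$ (i, j)"] ij w s
            carrier_matD[OF hecke_rep_carrier[OF rep, of s]] carrier_matD[OF f, of w]
            carrier_matD[OF f, of "s \<otimes> w"] carrier_matD[OF hecke_rep_carrier[OF rep', of s]]
        by (simp add: h_def algebra_simps del: index_mult_mat(1))
      show ?thesis
      proof (cases "len w < len (s \<otimes> w)")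
        case True
        then show ?thesis using eq[OF w] by (simp add: eq_neg_iff_add_eq_0)
      next
        case False
        then have "len (s \<otimes> w) < len (s \<otimes> (s \<otimes> w))"
          using len_S_mult_neq[OF s w] s w by (simp add: S_cancel)
        then show ?thesis using eq[of "s \<otimes> w"] s w by (simp add: S_cancel eq_neg_iff_add_eq_0 add.commute)
      qed
    qed
    have "(\<Sum>w\<in>carrier W. h w) = (\<Sum>w\<in>carrier W. h (s \<otimes> w))"
      by (rule sum.reindex_bij_witness[of _ "\<lambda>w. s \<otimes> w" "\<lambda>w. s \<otimes> w"]) (use s in \<open>auto simp: S_cancel\<close>)
    also have "\<dots> = - (\<Sum>w\<in>carrier W. h w)" by (simp add: anti sum_negf)
    finally have "2 * (\<Sum>w\<in>carrier W. h w) = 0" by (simp only: mult_2 eq_neg_iff_add_eq_0)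
    then have "(\<Sum>w\<in>carrier W. h w) = 0" using two by simp
    then have "(\<Sum>w\<in>carrier W. (\<tau>' s * f w) $$ (i, j)) = (\<Sum>w\<in>carrier W. (f w * \<tau> s) $$ (i, j))"
      by (simp add: h_def sum_subtractf)
    then show "(\<tau>' s * C) $$ (i, j) = (C * \<tau> s) $$ (i, j)"
      using s ij unfolding C_def f_def[symmetric]
      by (simp add: mult_matsum matsum_mult matsum_index)
  qed (use s carrier_matD[OF hecke_rep_carrier[OF rep, of s]] carrier_matD[OF hecke_rep_carrier[OF rep', of s]] in \<open>auto simp: C_def matsum_def\<close>)
qed

lemma intertwiner_extends:
  assumes rep': "hecke_rep \<xi> n \<tau>'" and rep: "hecke_rep \<xi> n \<tau>" and C: "C \<in> carrier_mat n n"
    and "\<And>s. s \<in> S \<Longrightarrow> \<tau>' s * C = C * \<tau> s" and "w \<in> carrier W"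
  shows "\<tau>' w * C = C * \<tau> w"
  using assms(5)
proof (induction w rule: len_induct)
  case one
  then show ?case using C by (simp add: hecke_rep_one[OF rep] hecke_rep_one[OF rep'])
next
  case (mult s w)
  note [simp] = S_carrier hecke_rep_carrier[OF rep] hecke_rep_carrier[OF rep'] C
  note assoc = assoc_mult_mat[of _ n n _ n _ n]
  have "\<tau>' (s \<otimes> w) * C = \<tau>' s * (C * \<tau> w)"
    using mult by (simp add: hecke_rep_up[OF rep'] assoc)
  also have "\<dots> = C * \<tau> s * \<tau> w" using mult assms(4) by (simp flip: assoc)
  also have "\<dots> = C * \<tau> (s \<otimes> w)" using mult by (simp add: hecke_rep_up[OF rep] assoc)
  finally show ?case .
qed

text \<open>Casimir sums of matrix units commute with \<tau> and so are scalar. The set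
  \<open>k\<close> restricts \<open>scalar\<close> to commuting matrices over a smaller field: over
  \<complex> the splitting hypothesis speaks of matrices over F only.\<close>

lemma schur_relations:
  fixes \<xi> :: "'a \<Rightarrow> 'k::field"
  assumes rep: "hecke_rep \<xi> n \<tau>" and two: "(2 :: 'k) \<noteq> 0"
    and k: "0 \<in> k" "1 \<in> k" "\<And>x y. x \<in> k \<Longrightarrow> y \<in> k \<Longrightarrow> x + y \<in> k" "\<And>x y. x \<in> k \<Longrightarrow> y \<in> k \<Longrightarrow> x * y \<in> k"
    and entries: "\<And>w i j. w \<in> carrier W \<Longrightarrow> i < n \<Longrightarrow> j < n \<Longrightarrow> \<tau> w $$ (i, j) \<in> k"
    and scalar: "\<And>C. C \<in> carrier_mat n n \<Longrightarrow> (\<And>i j. i < n \<Longrightarrow> j < n \<Longrightarrow> C $$ (i, j) \<in> k) \<Longrightarrow>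
      (\<And>w. w \<in> carrier W \<Longrightarrow> C * \<tau> w = \<tau> w * C) \<Longrightarrow> \<exists>c. C = c \<cdot>\<^sub>m 1\<^sub>m n"
  obtains c where "\<And>i j p l. i < n \<Longrightarrow> j < n \<Longrightarrow> p < n \<Longrightarrow> l < n \<Longrightarrow>
    (\<Sum>w\<in>carrier W. \<tau> w $$ (i, j) * \<tau> (inv w) $$ (p, l)) = (if i = l \<and> j = p then c else 0)"
proof -
  note [simp] = S_carrier hecke_rep_carrier[OF rep]
  have "\<exists>c. \<forall>i<n. \<forall>l<n. (\<Sum>w\<in>carrier W. \<tau> w $$ (i, j) * \<tau> (inv w) $$ (p, l)) = (if i = l then c else 0)"
    if jp: "j < n" "p < n" for j p
  proof -
    \<comment> \<open>With the matrix unit at position \<open>(j, p)\<close>, an entry of the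
      Casimir sum is exactly a sum of products of two coefficients.\<close>
    define Z :: "'k mat" where "Z = mat n n (\<lambda>(a, b). if a = j \<and> b = p then 1 else 0)"
    have Z: "Z \<in> carrier_mat n n" by (simp add: Z_def)
    define C where "C = matsum n (\<lambda>w. \<tau> w * Z * \<tau> (inv w)) (carrier W)"
    have C: "C \<in> carrier_mat n n" by (simp add: C_def)
    have C_ij: "C $$ (i, l) = (\<Sum>w\<in>carrier W. \<tau> w $$ (i, j) * \<tau> (inv w) $$ (p, l))" if il: "i < n" "l < n" for i l
    proof -
      have "(\<tau> w * Z * \<tau> (inv w)) $$ (i, l) = \<tau> w $$ (i, j) * \<tau> (inv w) $$ (p, l)" if w: "w \<in> carrier W" for w
      proof -
        have entry: "(\<tau> w * Z) $$ (i, b) = (if b = p then \<tau> w $$ (i, j) else 0)" if "b < n" for b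
        proof -
          have "(\<tau> w * Z) $$ (i, b) = (\<Sum>a<n. \<tau> w $$ (i, a) * Z $$ (a, b))"
            using that w il Z by (intro mat_mult_index) auto
          also have "\<dots> = (\<Sum>a<n. if a = j then (if b = p then \<tau> w $$ (i, j) else 0) else 0)"
            using that by (intro sum.cong) (auto simp: Z_def)
          finally show ?thesis using jp by simp
        qed
        have "(\<tau> w * Z * \<tau> (inv w)) $$ (i, l) = (\<Sum>b<n. (\<tau> w * Z) $$ (i, b) * \<tau> (inv w) $$ (b, l))"
          using w il Z by (intro mat_mult_index[of _ n n _ n] mult_carrier_mat[of _ n n]) auto
        also have "\<dots> = (\<Sum>b<n. if b = p then \<tau> w $$ (i, j) * \<tau> (inv w) $$ (b, l) else 0)"
          by (rule sum.cong) (simp_all add: entry del: index_mult_mat)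
        finally show ?thesis using jp by simp
      qed
      then show ?thesis using il by (simp add: C_def matsum_index)
    qed
    have "C * \<tau> w = \<tau> w * C" if "w \<in> carrier W" for w
      using intertwiner_extends[OF rep rep C casimir_intertwines[OF rep rep Z two, folded C_def] that] by simp
    moreover have "C $$ (i, l) \<in> k" if "i < n" "l < n" for i l
      using that jp by (auto simp: C_ij intro!: sum_in_closed k(1,3) k(4) entries)
    ultimately obtain c where "C = c \<cdot>\<^sub>m 1\<^sub>m n" using scalar[OF C] by blast
    then have "C $$ (i, l) = (if i = l then c else 0)" if "i < n" "l < n" for i l using that by simp
    with C_ij show ?thesis by (intro exI[of _ c] allI impI) metis
  qed
  note ex = this
  define \<kappa> where "\<kappa> j p = (\<Sum>w\<in>carrier W. \<tau> w $$ (0, j) * \<tau> (inv w) $$ (p, 0))" for j p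
  have \<kappa>: "(\<Sum>w\<in>carrier W. \<tau> w $$ (i, j) * \<tau> (inv w) $$ (p, l)) = (if i = l then \<kappa> j p else 0)"
    if il: "i < n" "j < n" "p < n" "l < n" for i j p l
  proof -
    obtain c where c: "\<And>i l. i < n \<Longrightarrow> l < n \<Longrightarrow>
      (\<Sum>w\<in>carrier W. \<tau> w $$ (i, j) * \<tau> (inv w) $$ (p, l)) = (if i = l then c else 0)"
      using ex[OF il(2,3)] by blast
    have "\<kappa> j p = c" using c[of 0 0] il unfolding \<kappa>_def by simp
    then show ?thesis using c il by simp
  qed
  \<comment> \<open>Inversion of \<open>w\<close> exchanges the roles of \<open>(i, l)\<close> and
    \<open>(p, j)\<close>, so the dependence on the inner indices follows from the dependence on the
    outer ones.\<close>
  have swap: "(\<Sum>w\<in>carrier W. \<tau> w $$ (i, j) * \<tau> (inv w) $$ (p, l)) = (\<Sum>w\<in>carrier W. \<tau> w $$ (p, l) * \<tau> (inv w) $$ (i, j))" for i j p l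
    by (rule sum.reindex_bij_witness[of _ "\<lambda>w. inv w" "\<lambda>w. inv w"]) (auto simp: mult.commute)
  have \<kappa>2: "(if i = l then \<kappa> j p else 0) = (if p = j then \<kappa> l i else 0)" if "i < n" "j < n" "p < n" "l < n" for i j p l
    using \<kappa>[of i j p l] \<kappa>[of p l i j] swap[of i j p l] that by simp
  have "(\<Sum>w\<in>carrier W. \<tau> w $$ (i, j) * \<tau> (inv w) $$ (p, l)) = (if i = l \<and> j = p then \<kappa> 0 0 else 0)"
    if "i < n" "j < n" "p < n" "l < n" for i j p l
  proof -
    have "\<kappa> j p = 0" if "j \<noteq> p" using \<kappa>2[of i j p i] that \<open>i < n\<close> \<open>j < n\<close> \<open>p < n\<close> by auto
    moreover have "\<kappa> j j = \<kappa> 0 0" using \<kappa>2[of 0 j j 0] \<open>j < n\<close> by auto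
    ultimately show ?thesis using \<kappa>[OF that] by auto
  qed
  with that show thesis by blast
qed

end

section \<open>Specialisation\<close>

lemma theta1_superset:
  "finite I \<Longrightarrow> Poly_Mapping.keys p \<subseteq> I \<Longrightarrow> theta1 p = (\<Sum>g\<in>I. Poly_Mapping.lookup p g)"
  unfolding theta1_def by (rule sum.mono_neutral_left) (auto simp: in_keys_iff)

lemma theta1_add: "theta1 (p + q) = theta1 p + theta1 q"
proof -
  let ?I = "Poly_Mapping.keys p \<union> Poly_Mapping.keys q"
  have "theta1 (p + q) = (\<Sum>g\<in>?I. Poly_Mapping.lookup (p + q) g)"
    using keys_add[of p q] by (intro theta1_superset) auto
  also have "\<dots> = theta1 p + theta1 q"
    by (simp add: lookup_add sum.distrib theta1_superset[of ?I])
  finally show ?thesis .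
qed

lemma theta1_sum: "theta1 (\<Sum>i\<in>I. p i) = (\<Sum>i\<in>I. theta1 (p i))"
  by (induction I rule: infinite_finite_induct) (simp_all add: theta1_add, simp_all add: theta1_def)

lemma theta1_single: "theta1 (Poly_Mapping.single g c) = c"
  by (simp add: theta1_def)

lemma poly_mapping_eq_sum_single: "p = (\<Sum>g\<in>Poly_Mapping.keys p. Poly_Mapping.single g (Poly_Mapping.lookup p g))"
  by (rule poly_mapping_eqI) (auto simp: lookup_sum lookup_single when_def in_keys_iff)

lemma theta1_single_mult: 
  fixes q :: "'g::linordered_ab_group_add \<Rightarrow>\<^sub>0 complex"
  shows "theta1 (Poly_Mapping.single g c * q) = c * theta1 q"
proof -
  have "Poly_Mapping.single g c * q =
    (\<Sum>h\<in>Poly_Mapping.keys q. Poly_Mapping.single (g + h) (c * Poly_Mapping.lookup q h))"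
    by (subst poly_mapping_eq_sum_single[of q]) (simp add: sum_distrib_left mult_single)
  then show ?thesis by (simp add: theta1_sum theta1_single sum_distrib_left theta1_def[of q])
qed

lemma theta1_mult: 
  fixes p q :: "'g::linordered_ab_group_add \<Rightarrow>\<^sub>0 complex"
  shows "theta1 (p * q) = theta1 p * theta1 q"
proof -
  have "p * q = (\<Sum>g\<in>Poly_Mapping.keys p. Poly_Mapping.single g (Poly_Mapping.lookup p g) * q)"
    by (subst poly_mapping_eq_sum_single[of p]) (simp add: sum_distrib_right)
  then show ?thesis by (simp add: theta1_sum theta1_single_mult sum_distrib_right theta1_def[of p])
qed

lemma theta1_hom: "comm_ring_hom (theta1 :: ('g::linordered_ab_group_add \<Rightarrow>\<^sub>0 complex) \<Rightarrow> complex)"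
  by unfold_locales (simp_all add: theta1_add theta1_mult, simp_all add: theta1_def flip: single_one)

lemma to_fract_hom: "comm_ring_hom (to_fract :: 'a::idom \<Rightarrow> 'a fract)"
  by unfold_locales simp_all

lemma theta1_eps_diff:
  "\<exists>p. to_fract p = eps g - inverse (eps g) \<and> theta1 p = 0"
proof (intro exI conjI)
  let ?p = "Poly_Mapping.single g 1 + - Poly_Mapping.single (- g) 1 :: 'a \<Rightarrow>\<^sub>0 complex"
  show "to_fract ?p = eps g - inverse (eps g)" by (simp add: inverse_eps) (simp add: eps_def)
  show "theta1 ?p = 0" by (simp only: theta1_add single_uminus[symmetric] theta1_single) simp
qed

text \<open>The graph of the specialisation from combinations of the \<open>\<tau> w\<close> to
  combinations of the \<open>\<rho> w\<close>. It is a relation since one matrix may arise from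
  several combinations, and nothing says a priori that these specialise alike.\<close>

inductive lifts :: "'a set \<Rightarrow> ('a \<Rightarrow> 'g::linordered_ab_group_add gfrac mat) \<Rightarrow> ('a \<Rightarrow> complex mat) \<Rightarrow>
    'g gfrac mat \<Rightarrow> complex mat \<Rightarrow> bool"
  for G \<tau> \<rho> where
  base: "w \<in> G \<Longrightarrow> lifts G \<tau> \<rho> (\<tau> w) (\<rho> w)"
| add: "lifts G \<tau> \<rho> M m \<Longrightarrow> lifts G \<tau> \<rho> M' m' \<Longrightarrow> lifts G \<tau> \<rho> (M + M') (m + m')"
| smult: "lifts G \<tau> \<rho> M m \<Longrightarrow> lifts G \<tau> \<rho> (to_fract p \<cdot>\<^sub>m M) (theta1 p \<cdot>\<^sub>m m)"

text \<open>Flattens pairs of indices, so that matrices can be treated as vectors of length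
  \<open>n * n\<close> and tested for independence by a determinant.\<close>

lemma sum_div_mod:
  fixes f :: "nat \<Rightarrow> nat \<Rightarrow> 'b::comm_monoid_add"
  shows "(\<Sum>v<n * n. f (v div n) (v mod n)) = (\<Sum>a<n. \<Sum>b<n. f a b)"
proof -
  have "(\<Sum>v<n * n. f (v div n) (v mod n)) = (\<Sum>x\<in>{..<n} \<times> {..<n}. case x of (a, b) \<Rightarrow> f a b)"
  proof (rule sum.reindex_bij_witness[where i = "\<lambda>(a, b). a * n + b" and j = "\<lambda>v. (v div n, v mod n)"])
    fix v assume v: "v \<in> {..<n * n}"
    then have "0 < n" by (cases n) auto
    with v show "(v div n, v mod n) \<in> {..<n} \<times> {..<n}" by (simp add: less_mult_imp_div_less)
  next
    fix x assume "x \<in> {..<n} \<times> {..<n}"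
    then show "(case x of (a, b) \<Rightarrow> a * n + b) \<in> {..<n * n}"
      by (auto intro: less_le_trans[OF _ mult_le_mono1, of _ "Suc _"] simp: Suc_le_eq)
         (metis Suc_leI add_less_mono1 add.commute less_le_trans mult_Suc mult_le_mono1)
  qed auto
  then show ?thesis by (simp add: sum.cartesian_product)
qed

lemma mat_trace_add:
  "A \<in> carrier_mat n n \<Longrightarrow> B \<in> carrier_mat n n \<Longrightarrow> mat_trace (A + B) = mat_trace A + mat_trace B"
  by (auto simp: mat_trace_def sum.distrib)

lemma mat_trace_smult:
  "A \<in> carrier_mat n n \<Longrightarrow> mat_trace (c \<cdot>\<^sub>m A) = c * mat_trace (A :: 'k::comm_ring_1 mat)"
  by (auto simp: mat_trace_def sum_distrib_left)

section \<open>Lifting the matrix units and density of the generic representation\<close>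

context coxeter_group
begin

context
  fixes L :: "'a \<Rightarrow> 'g::linordered_ab_group_add" and n :: nat
    and \<tau> :: "'a \<Rightarrow> 'g gfrac mat" and \<rho> :: "'a \<Rightarrow> complex mat" and c :: complex
  assumes rep: "hecke_rep (\<lambda>s. eps (L s) - inverse (eps (L s))) n \<tau>"
    and rep1: "hecke_rep (\<lambda>_. 0) n \<rho>"
    and traces: "\<And>w. w \<in> carrier W \<Longrightarrow> \<exists>p. mat_trace (\<tau> w) = to_fract p \<and> mat_trace (\<rho> w) = theta1 p"
    and c: "c \<noteq> 0"
    and schur: "\<And>i j p l. i < n \<Longrightarrow> j < n \<Longrightarrow> p < n \<Longrightarrow> l < n \<Longrightarrow>
      (\<Sum>w\<in>carrier W. \<rho> w $$ (i, j) * \<rho> (inv w) $$ (p, l)) = (if i = l \<and> j = p then c else 0)"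
begin

abbreviation "lft \<equiv> lifts (carrier W) \<tau> \<rho>"

lemma lifts_carrier: "lft M m \<Longrightarrow> M \<in> carrier_mat n n \<and> m \<in> carrier_mat n n"
  by (induction rule: lifts.induct) (auto simp: hecke_rep_carrier[OF rep] hecke_rep_carrier[OF rep1])

lemma lifts_trace: "lft M m \<Longrightarrow> \<exists>p. mat_trace M = to_fract p \<and> mat_trace m = theta1 p"
proof (induction rule: lifts.induct)
  case (add M m M' m')
  then obtain p q where "mat_trace M = to_fract p" "mat_trace m = theta1 p"
    "mat_trace M' = to_fract q" "mat_trace m' = theta1 q" by blast
  then show ?case using lifts_carrier[OF add(1)] lifts_carrier[OF add(2)]
    by (intro exI[of _ "p + q"]) (simp add: mat_trace_add[of _ n] theta1_add)
next
  case (smult M m p)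
  then obtain q where "mat_trace M = to_fract q" "mat_trace m = theta1 q" by blast
  then show ?case using lifts_carrier[OF smult(1)]
    by (intro exI[of _ "p * q"]) (simp add: mat_trace_smult[of _ n] theta1_mult)
qed (rule traces)

text \<open>In the length-decreasing case the additional coefficient
  \<open>eps (L s) - inverse (eps (L s))\<close> specialises to 0, in agreement with the group
  relation for \<rho>.\<close>

lemma lifts_S_mult: "s \<in> S \<Longrightarrow> lft M m \<Longrightarrow> lft (\<tau> s * M) (\<rho> s * m)"
proof (rotate_tac 1, induction rule: lifts.induct)
  case (base w)
  have "lft (\<tau> (s \<otimes> w)) (\<rho> (s \<otimes> w))" using base S_carrier by (intro lifts.base) simp
  show ?case
  proof (cases "len w < len (s \<otimes> w)")
    case True
    with \<open>lft (\<tau> (s \<otimes> w)) _\<close> base show ?thesis by (simp add: hecke_rep_up[OF rep] hecke_rep_up[OF rep1])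
  next
    case False
    then have down: "len (s \<otimes> w) < len w" using len_S_mult_neq[of s w] base by simp
    obtain p where p: "to_fract p = eps (L s) - inverse (eps (L s))" "theta1 p = 0"
      using theta1_eps_diff by blast
    have "lft (\<tau> (s \<otimes> w) + to_fract p \<cdot>\<^sub>m \<tau> w) (\<rho> (s \<otimes> w) + theta1 p \<cdot>\<^sub>m \<rho> w)"
      by (intro lifts.add lifts.smult lifts.base) (use base S_carrier in auto)
    then show ?thesis
      using hecke_rep_down[OF rep _ _ down] hecke_rep_down[OF rep1 _ _ down] base p by simp
  qed
next
  case (add M m M' m')
  then show ?case
    using lifts_carrier[OF add(1)] lifts_carrier[OF add(2)] lifts.add[OF add(3,4)]
      hecke_rep_carrier[OF rep, of s] hecke_rep_carrier[OF rep1, of s] S_carrier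
    by (simp add: mult_add_distrib_mat[of _ n n _ n])
next
  case (smult M m p)
  then show ?case
    using lifts_carrier[OF smult(1)] lifts.smult[OF smult(2), of p]
      hecke_rep_carrier[OF rep, of s] hecke_rep_carrier[OF rep1, of s] S_carrier
    by (simp add: mult_smult_distrib[of _ n n _ n])
qed

lemma lifts_base_mult: "w \<in> carrier W \<Longrightarrow> lft M m \<Longrightarrow> lft (\<tau> w * M) (\<rho> w * m)"
proof (induction w rule: len_induct)
  case one
  then show ?case using lifts_carrier[OF one] by (simp add: hecke_rep_one[OF rep] hecke_rep_one[OF rep1] left_mult_one_mat[of _ n n])
next
  case (mult s w)
  then show ?case using lifts_S_mult[OF mult(1), of "\<tau> w * M" "\<rho> w * m"] lifts_carrier[OF mult(5)]
      hecke_rep_carrier[OF rep] hecke_rep_carrier[OF rep1] S_carrier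
    by (simp add: hecke_rep_up[OF rep] hecke_rep_up[OF rep1] assoc_mult_mat[of _ n n _ n _ n])
qed

lemma lifts_mult: "lft M m \<Longrightarrow> lft M' m' \<Longrightarrow> lft (M * M') (m * m')"
proof (induction rule: lifts.induct)
  case (add M1 m1 M2 m2)
  then show ?case
    using lifts_carrier[OF add(1)] lifts_carrier[OF add(2)] lifts_carrier[OF add(5)]
      lifts.add[OF add(3)[OF add(5)] add(4)[OF add(5)]]
    by (simp add: add_mult_distrib_mat[of _ n n _ _ n])
next
  case (smult M m p)
  then show ?case
    using lifts_carrier[OF smult(1)] lifts_carrier[OF smult(3)] lifts.smult[OF smult(2)[OF smult(3)], of p]
    by (simp add: mult_smult_assoc_mat[of _ n n _ n])
qed (rule lifts_base_mult)

lemma lifts_matsum: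
  fixes M :: "'i \<Rightarrow> 'g gfrac mat" and m :: "'i \<Rightarrow> complex mat"
  assumes "finite I" "\<And>i. i \<in> I \<Longrightarrow> lft (M i) (m i)"
  shows "lft (matsum n M I) (matsum n m I)"
  using assms
proof (induction I)
  case empty
  \<comment> \<open>\<open>lifts\<close> has no rule for the zero matrix; it is obtained as zero
    times the identity.\<close>
  have "to_fract 0 \<cdot>\<^sub>m \<tau> \<one> = 0\<^sub>m n n" "theta1 (0 :: 'g \<Rightarrow>\<^sub>0 complex) \<cdot>\<^sub>m \<rho> \<one> = 0\<^sub>m n n"
    by (auto simp: hecke_rep_one[OF rep] hecke_rep_one[OF rep1] theta1_def)
  moreover have "lft (to_fract 0 \<cdot>\<^sub>m \<tau> \<one>) (theta1 (0 :: 'g \<Rightarrow>\<^sub>0 complex) \<cdot>\<^sub>m \<rho> \<one>)" by (intro lifts.smult lifts.base) simp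
  ultimately show ?case by (simp add: matsum_empty)
next
  case (insert i I)
  have "lft (M i) (m i)" using insert by simp
  then have "lft (M i + matsum n M I) (m i + matsum n m I)" using insert by (intro lifts.add) auto
  with lifts_carrier[OF \<open>lft (M i) (m i)\<close>] insert(1,2) show ?case by (simp add: matsum_insert)
qed

abbreviation unit_mat :: "nat \<Rightarrow> nat \<Rightarrow> complex mat" where
  "unit_mat i j \<equiv> mat n n (\<lambda>(a, b). if a = i \<and> b = j then 1 else 0)"

text \<open>The Schur relations invert the Fourier transform: the matrix unit is the combination of
  the \<open>\<rho> w\<close> with coefficients \<open>\<rho> (inv w) $$ (j, i) / c\<close>, which
  lift as constants.\<close>

lemma lifts_unit_mat:
  assumes "i < n" "j < n"
  shows "\<exists>M. lft M (unit_mat i j)"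
proof -
  define q where "q w = Poly_Mapping.single (0 :: 'g) (\<rho> (inv w) $$ (j, i) / c)" for w
  have "lft (matsum n (\<lambda>w. to_fract (q w) \<cdot>\<^sub>m \<tau> w) (carrier W)) (matsum n (\<lambda>w. theta1 (q w) \<cdot>\<^sub>m \<rho> w) (carrier W))"
    by (intro lifts_matsum finite_carrier lifts.smult lifts.base)
  moreover have "matsum n (\<lambda>w. theta1 (q w) \<cdot>\<^sub>m \<rho> w) (carrier W) = unit_mat i j"
  proof (rule eq_matI)
    fix a b assume "a < dim_row (unit_mat i j)" "b < dim_col (unit_mat i j)"
    then have ab: "a < n" "b < n" by simp_all
    have "matsum n (\<lambda>w. theta1 (q w) \<cdot>\<^sub>m \<rho> w) (carrier W) $$ (a, b) =
      (\<Sum>w\<in>carrier W. \<rho> w $$ (a, b) * \<rho> (inv w) $$ (j, i)) / c"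
      using ab carrier_matD[OF hecke_rep_carrier[OF rep1]]
      by (simp add: matsum_index q_def theta1_single sum_divide_distrib mult.commute)
    then show "matsum n (\<lambda>w. theta1 (q w) \<cdot>\<^sub>m \<rho> w) (carrier W) $$ (a, b) = unit_mat i j $$ (a, b)"
      using schur[OF ab assms(2,1)] ab c by auto
  qed (simp_all add: matsum_def)
  ultimately show ?thesis by metis
qed

text \<open>A functional vanishing on all \<open>\<tau> w\<close> vanishes on every lift. The lifts
  of the matrix units are linearly independent and there are \<open>n * n\<close> of them, so the
  functional is zero.\<close>

lemma generic_density:
  fixes \<psi> :: "nat \<Rightarrow> nat \<Rightarrow> 'g gfrac"
  assumes \<psi>: "\<And>w. w \<in> carrier W \<Longrightarrow> (\<Sum>a<n. \<Sum>b<n. \<psi> a b * \<tau> w $$ (a, b)) = 0"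
    and ab: "a < n" "b < n"
  shows "\<psi> a b = 0"
proof -
  have lifts_\<psi>: "(\<Sum>a<n. \<Sum>b<n. \<psi> a b * M $$ (a, b)) = 0" if "lft M m" for M m
    using that
  proof (induction rule: lifts.induct)
    case (add M m M' m')
    then show ?case using lifts_carrier[OF add(1)] lifts_carrier[OF add(2)]
      by (auto simp: distrib_left sum.distrib)
  next
    case (smult M m p)
    have "(\<Sum>a<n. \<Sum>b<n. \<psi> a b * (to_fract p \<cdot>\<^sub>m M) $$ (a, b)) =
      to_fract p * (\<Sum>a<n. \<Sum>b<n. \<psi> a b * M $$ (a, b))"
      using lifts_carrier[OF smult(1)] by (auto simp: sum_distrib_left algebra_simps)
    with smult show ?case by simp
  qed (rule \<psi>)
  have "\<forall>i j. \<exists>M. i < n \<longrightarrow> j < n \<longrightarrow> lft M (unit_mat i j)" using lifts_unit_mat by blast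
  then have "\<exists>U. \<forall>i j. i < n \<longrightarrow> j < n \<longrightarrow> lft (U i j) (unit_mat i j)"
    by (simp only: choice_iff)
  then obtain U where U: "lft (U i j) (unit_mat i j)" if "i < n" "j < n" for i j by blast
  define N where "N = n * n"
  have n: "0 < n" using ab by simp
  have dm: "u div n < n" "u mod n < n" if "u < N" for u
    using that n by (simp_all add: N_def less_mult_imp_div_less)
  \<comment> \<open>The second family lifts the transposed units, which form the dual basis under
    the trace form; hence the Gram matrix specialises to the identity.\<close>
  let ?U = "\<lambda>u. U (u div n) (u mod n)" and ?V = "\<lambda>u. U (u mod n) (u div n)"
  let ?e = "\<lambda>u. unit_mat (u div n) (u mod n)" and ?f = "\<lambda>u. unit_mat (u mod n) (u div n)"
  have "\<forall>u v. \<exists>p. u < N \<longrightarrow> v < N \<longrightarrow>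
      mat_trace (?U u * ?V v) = to_fract p \<and> mat_trace (?e u * ?f v) = theta1 p"
  proof (intro allI)
    fix u v
    show "\<exists>p. u < N \<longrightarrow> v < N \<longrightarrow>
      mat_trace (?U u * ?V v) = to_fract p \<and> mat_trace (?e u * ?f v) = theta1 p"
    proof (cases "u < N \<and> v < N")
      case True
      then have "lft (?U u * ?V v) (?e u * ?f v)" by (intro lifts_mult U dm) simp_all
      from lifts_trace[OF this] show ?thesis by blast
    qed auto
  qed
  then have "\<exists>g. \<forall>u v. u < N \<longrightarrow> v < N \<longrightarrow>
      mat_trace (?U u * ?V v) = to_fract (g u v) \<and> mat_trace (?e u * ?f v) = theta1 (g u v)"
    by (simp only: choice_iff)
  then obtain g where g: "mat_trace (?U u * ?V v) = to_fract (g u v)" "mat_trace (?e u * ?f v) = theta1 (g u v)"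
    if "u < N" "v < N" for u v by blast
  have unit: "mat_trace (?e u * ?f v) = (if u = v then 1 else 0)" if "u < N" "v < N" for u v
  proof -
    have "u div n * n + u mod n = u" "v div n * n + v mod n = v" by simp_all
    then have eq: "(u div n = v div n \<and> u mod n = v mod n) = (u = v)" by metis
    have "mat_trace (?e u * ?f v) = (\<Sum>a<n. \<Sum>b<n. ?e u $$ (a, b) * ?f v $$ (b, a))"
      by (simp add: mat_trace_def mat_mult_index[of _ n n _ n] del: index_mult_mat(1) index_mat(1))
    also have "\<dots> = (\<Sum>a<n. \<Sum>b<n. if b = u mod n then if a = u div n then if u = v then 1 else 0 else 0 else 0)"
      unfolding eq[symmetric] by (intro sum.cong) auto
    also have "\<dots> = (if u = v then 1 else 0)" using dm[OF that(1)] by simp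
    finally show ?thesis .
  qed
  have "det (mat N N (\<lambda>(u, v). g u v)) \<noteq> 0"
  proof
    assume "det (mat N N (\<lambda>(u, v). g u v)) = 0"
    moreover have "theta1 (det (mat N N (\<lambda>(u, v). g u v))) = det (map_mat theta1 (mat N N (\<lambda>(u, v). g u v)))"
      using comm_ring_hom.hom_det[OF theta1_hom] by metis
    moreover have "map_mat theta1 (mat N N (\<lambda>(u, v). g u v)) = 1\<^sub>m N"
      using g unit by (intro eq_matI) auto
    ultimately show False by (simp add: theta1_def)
  qed
  \<comment> \<open>The trace of a product is a scalar product of entries, so the Gram matrix
    factors. Row \<open>u\<close> of the first factor lists the entries of the lift
    \<open>?U u\<close>; a nonzero determinant is their independence.\<close>
  moreover have "map_mat to_fract (mat N N (\<lambda>(u, v). g u v)) =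
      mat N N (\<lambda>(u, v). ?U u $$ (v div n, v mod n)) * mat N N (\<lambda>(v, u). ?V u $$ (v mod n, v div n))"
    (is "_ = ?B * ?B'")
  proof (rule eq_matI)
    fix u v assume "u < dim_row (?B * ?B')" "v < dim_col (?B * ?B')"
    then have uv: "u < N" "v < N" by simp_all
    note carr = lifts_carrier[OF U[OF dm[OF uv(1)]], THEN conjunct1] lifts_carrier[OF U[OF dm(2,1)[OF uv(2)]], THEN conjunct1]
    have "to_fract (g u v) = (\<Sum>a<n. \<Sum>b<n. ?U u $$ (a, b) * ?V v $$ (b, a))"
      using carr by (auto simp add: g(1)[OF uv, symmetric] mat_trace_def mat_mult_index[OF carr] simp del: index_mult_mat(1))
    also have "\<dots> = (\<Sum>x<N. ?B $$ (u, x) * ?B' $$ (x, v))"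
      using uv by (simp add: sum_div_mod[symmetric] N_def)
    also have "\<dots> = (?B * ?B') $$ (u, v)"
      using uv by (subst mat_mult_index[of _ N N _ N]) auto
    finally show "map_mat to_fract (mat N N (\<lambda>(u, v). g u v)) $$ (u, v) = (?B * ?B') $$ (u, v)"
      using uv by simp
  qed simp_all
  ultimately have "det ?B * det ?B' \<noteq> 0"
    using comm_ring_hom.hom_det[OF to_fract_hom, of "mat N N (\<lambda>(u, v). g u v)"] det_mult[of ?B N ?B'] by simp
  then have "det ?B \<noteq> 0" by simp
  define x where "x = vec N (\<lambda>v. \<psi> (v div n) (v mod n))"
  have "?B *\<^sub>v x = 0\<^sub>v N"
  proof (rule eq_vecI)
    fix u assume "u < dim_vec (0\<^sub>v N :: 'g gfrac vec)"
    then have u: "u < N" by simp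
    then have "(?B *\<^sub>v x) $ u = (\<Sum>v<N. \<psi> (v div n) (v mod n) * ?U u $$ (v div n, v mod n))"
      by (auto simp: x_def scalar_prod_def lessThan_atLeast0 mult.commute intro!: sum.cong)
    also have "\<dots> = 0" unfolding N_def sum_div_mod[of "\<lambda>a b. \<psi> a b * ?U u $$ (a, b)"]
      by (rule lifts_\<psi>[OF U[OF dm[OF u]]])
    finally show "(?B *\<^sub>v x) $ u = 0\<^sub>v N $ u" using u by simp
  qed simp
  moreover have "x \<in> carrier_vec N" by (simp add: x_def)
  ultimately have "x = 0\<^sub>v N"
    using \<open>det ?B \<noteq> 0\<close> det_0_iff_vec_prod_zero_field[of ?B N] by force
  moreover have "a * n + b < N"
  proof -
    have "a * n + b < Suc a * n" using ab by simp
    also have "\<dots> \<le> N" unfolding N_def using ab by (intro mult_le_mono1) simp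
    finally show ?thesis .
  qed
  ultimately have "x $ (a * n + b) = 0" by simp
  with \<open>a * n + b < N\<close> ab show ?thesis by (simp add: x_def)
qed

lemma generic_commutant_scalar:
  assumes C: "C \<in> carrier_mat n n" and comm: "\<And>w. w \<in> carrier W \<Longrightarrow> C * \<tau> w = \<tau> w * C"
  shows "\<exists>d. C = d \<cdot>\<^sub>m 1\<^sub>m n"
proof -
  \<comment> \<open>These are the coefficients of the functional taking \<open>M\<close> to the
    entry \<open>(p, q)\<close> of \<open>C * M - M * C\<close>.\<close>
  have *: "(if b = q then C $$ (p, a) else 0) - (if a = p then C $$ (b, q) else 0) = 0"
    if "p < n" "q < n" "a < n" "b < n" for p q a b
  proof (rule generic_density[where \<psi> = "\<lambda>a b. (if b = q then C $$ (p, a) else 0) - (if a = p then C $$ (b, q) else 0)"])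
    fix w assume w: "w \<in> carrier W"
    note t = hecke_rep_carrier[OF rep w]
    have "(\<Sum>a<n. \<Sum>b<n. ((if b = q then C $$ (p, a) else 0) - (if a = p then C $$ (b, q) else 0)) * \<tau> w $$ (a, b)) =
      (\<Sum>a<n. \<Sum>b<n. if b = q then C $$ (p, a) * \<tau> w $$ (a, b) else 0) -
      (\<Sum>a<n. \<Sum>b<n. if a = p then \<tau> w $$ (a, b) * C $$ (b, q) else 0)"
      unfolding sum_subtractf[symmetric] by (intro sum.cong) (auto simp: algebra_simps)
    also have "(\<Sum>a<n. \<Sum>b<n. if b = q then C $$ (p, a) * \<tau> w $$ (a, b) else 0) = (C * \<tau> w) $$ (p, q)"
      using that by (simp add: mat_mult_index[OF C t] del: index_mult_mat(1))
    also have "(\<Sum>a<n. \<Sum>b<n. if a = p then \<tau> w $$ (a, b) * C $$ (b, q) else 0) = (\<tau> w * C) $$ (p, q)"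
      using that by (subst sum.swap) (simp add: mat_mult_index[OF t C] del: index_mult_mat(1))
    finally show "(\<Sum>a<n. \<Sum>b<n. ((if b = q then C $$ (p, a) else 0) - (if a = p then C $$ (b, q) else 0)) * \<tau> w $$ (a, b)) = 0"
      using comm[OF w] by simp
  qed (use that in auto)
  have "C = C $$ (0, 0) \<cdot>\<^sub>m 1\<^sub>m n"
  proof (rule eq_matI)
    fix i j assume "i < dim_row (C $$ (0, 0) \<cdot>\<^sub>m 1\<^sub>m n)" "j < dim_col (C $$ (0, 0) \<cdot>\<^sub>m 1\<^sub>m n)"
    then have ij: "i < n" "j < n" by simp_all
    then show "C $$ (i, j) = (C $$ (0, 0) \<cdot>\<^sub>m 1\<^sub>m n) $$ (i, j)"
      using *[of i 0 j 0] by (cases "i = j") auto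
  qed (use C in auto)
  then show ?thesis by blast
qed

end

end

section \<open>Invariant forms\<close>

text \<open>The kernel vector is a plain function on indices, which suits the manipulation of nested
  sums below.\<close>

lemma det_zero_iff_kernel:
  fixes A :: "'k::field mat"
  assumes "A \<in> carrier_mat n n"
  shows "det A = 0 \<longleftrightarrow> (\<exists>v. (\<exists>i<n. v i \<noteq> 0) \<and> (\<forall>i<n. (\<Sum>j<n. A $$ (i, j) * v j) = 0))"
proof
  assume "det A = 0"
  then obtain x where x: "x \<in> carrier_vec n" "x \<noteq> 0\<^sub>v n" "A *\<^sub>v x = 0\<^sub>v n"
    using det_0_iff_vec_prod_zero_field[OF assms] by blast
  have "\<exists>i<n. x $ i \<noteq> 0" using x(1,2) by (metis carrier_vecD eq_vecI index_zero_vec)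
  moreover have "(\<Sum>j<n. A $$ (i, j) * x $ j) = 0" if "i < n" for i
    using arg_cong[OF x(3), of "\<lambda>y. vec_index y i"] that assms x(1)
    by (simp add: scalar_prod_def lessThan_atLeast0)
  ultimately show "\<exists>v. (\<exists>i<n. v i \<noteq> 0) \<and> (\<forall>i<n. (\<Sum>j<n. A $$ (i, j) * v j) = 0)"
    by (intro exI[of _ "\<lambda>i. x $ i"]) simp
next
  assume "\<exists>v. (\<exists>i<n. v i \<noteq> 0) \<and> (\<forall>i<n. (\<Sum>j<n. A $$ (i, j) * v j) = 0)"
  then obtain v i where v: "i < n" "v i \<noteq> 0" "\<forall>i<n. (\<Sum>j<n. A $$ (i, j) * v j) = 0" by blast
  have "vec n v $ i \<noteq> 0\<^sub>v n $ i" using v by simp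
  then have "vec n v \<noteq> 0\<^sub>v n" by metis
  moreover have "A *\<^sub>v vec n v = 0\<^sub>v n"
    using assms v(3) by (intro eq_vecI) (auto simp: scalar_prod_def lessThan_atLeast0)
  ultimately show "det A = 0" using det_0_iff_vec_prod_zero_field[OF assms] by (metis vec_carrier)
qed

lemma det_nonzero_obtain_inverse:
  fixes A :: "'k::field mat"
  assumes "A \<in> carrier_mat n n" "det A \<noteq> 0"
  obtains B where "B \<in> carrier_mat n n" "A * B = 1\<^sub>m n" "B * A = 1\<^sub>m n"
  using det_non_zero_imp_unit[OF assms, of "()"] unfolding Units_def ring_mat_def by auto

section \<open>Determinants of residues, sums of real squares and leading terms\<close>

lemma has_residue_signof: "has_residue (signof p) (signof p)"
  by (simp add: sign_def has_residue_1 has_residue_uminus)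

lemma permutes_less_bound: "p permutes {0..<n} \<Longrightarrow> i < n \<Longrightarrow> p i < n" for n :: nat
  using permutes_in_image[of p "{0..<n}" i] by simp

lemma has_residue_det:
  assumes "A \<in> carrier_mat n n" "\<And>i j. i < n \<Longrightarrow> j < n \<Longrightarrow> has_residue (A $$ (i, j)) (r i j)"
  shows "has_residue (det A) (det (mat n n (\<lambda>(i, j). r i j)))"
proof -
  have "has_residue (\<Sum>p\<in>{p. p permutes {0..<n}}. signof p * (\<Prod>i = 0..<n. A $$ (i, p i)))
    (\<Sum>p\<in>{p. p permutes {0..<n}}. signof p * (\<Prod>i = 0..<n. r i (p i)))"
    by (intro has_residue_sum has_residue_mult has_residue_signof has_residue_prod assms) (auto simp: permutes_less_bound)
  also have "(\<Sum>p\<in>{p. p permutes {0..<n}}. signof p * (\<Prod>i = 0..<n. A $$ (i, p i))) = det A"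
    by (rule det_def'[OF assms(1), symmetric])
  also have "(\<Sum>p\<in>{p. p permutes {0..<n}}. signof p * (\<Prod>i = 0..<n. r i (p i))) =
    det (mat n n (\<lambda>(i, j). r i j))"
    by (subst det_def'[of _ n]) (auto intro!: sum.cong prod.cong simp: permutes_less_bound)
  finally show ?thesis .
qed

lemma det_in_closed:
  assumes "A \<in> carrier_mat n n" "\<And>i j. i < n \<Longrightarrow> j < n \<Longrightarrow> A $$ (i, j) \<in> k"
    and "0 \<in> k" "1 \<in> k" "\<And>x y. x \<in> k \<Longrightarrow> y \<in> k \<Longrightarrow> x + y \<in> k" "\<And>x y. x \<in> k \<Longrightarrow> y \<in> k \<Longrightarrow> x * y \<in> k"
      "\<And>x. x \<in> k \<Longrightarrow> - x \<in> k"
  shows "det A \<in> k"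
proof -
  have "signof p \<in> k" for p :: "nat \<Rightarrow> nat" using assms by (simp add: sign_def)
  then show ?thesis unfolding det_def'[OF assms(1)]
    by (intro sum_in_closed prod_in_closed assms) (auto simp: permutes_less_bound)
qed

lemma sum_squares_real_pos:
  assumes "finite I" "\<And>x. x \<in> I \<Longrightarrow> f x \<in> \<real>" "y \<in> I" "f y \<noteq> (0 :: complex)"
  shows "\<exists>t::real. 0 < t \<and> (\<Sum>x\<in>I. f x * f x) = complex_of_real t"
proof (intro exI conjI)
  have *: "f x * f x = complex_of_real (Re (f x) * Re (f x))" if "x \<in> I" for x
    using assms(2)[OF that] by (metis of_real_Re of_real_mult)
  then show "(\<Sum>x\<in>I. f x * f x) = complex_of_real (\<Sum>x\<in>I. Re (f x) * Re (f x))" by simp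
  have "Re (f y) \<noteq> 0" using assms(2-4) by (metis of_real_0 of_real_Re)
  then have "0 < Re (f y) * Re (f y)" by (metis not_real_square_gt_zero)
  then show "0 < (\<Sum>x\<in>I. Re (f x) * Re (f x))"
    using assms(1,3) by (intro sum_pos2[of _ y]) auto
qed

lemma sum_squares_real_eq_0:
  assumes "finite I" "\<And>x. x \<in> I \<Longrightarrow> f x \<in> \<real>" "(\<Sum>x\<in>I. f x * f x) = (0 :: complex)" "y \<in> I"
  shows "f y = 0"
  using sum_squares_real_pos[OF assms(1,2,4)] assms(3) by fastforce

text \<open>The vector \<open>v\<close> is complex while the rows \<open>r x\<close> are real, so
  pairing the kernel equation with the conjugate of \<open>v\<close> gives the sum of the squared
  moduli of the products of the rows with \<open>v\<close>.\<close>

lemma gram_kernel: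
  fixes r :: "'x \<Rightarrow> nat \<Rightarrow> complex"
  assumes "finite I" "\<And>x j. x \<in> I \<Longrightarrow> j < n \<Longrightarrow> r x j \<in> \<real>"
    and 0: "\<And>i. i < n \<Longrightarrow> (\<Sum>j<n. (\<Sum>x\<in>I. r x i * r x j) * v j) = 0" and y: "y \<in> I"
  shows "(\<Sum>j<n. r y j * v j) = 0"
proof -
  let ?z = "\<lambda>x. \<Sum>j<n. r x j * v j"
  have "(\<Sum>x\<in>I. cnj (?z x) * ?z x) = (\<Sum>x\<in>I. \<Sum>i<n. \<Sum>j<n. cnj (v i) * (r x i * r x j * v j))"
  proof (rule sum.cong)
    fix x assume "x \<in> I"
    then have "cnj (r x i) = r x i" if "i < n" for i using assms(2) that by (simp add: Reals_cnj_iff)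
    then have "cnj (?z x) = (\<Sum>i<n. cnj (v i) * r x i)" by (simp add: mult.commute)
    then show "cnj (?z x) * ?z x = (\<Sum>i<n. \<Sum>j<n. cnj (v i) * (r x i * r x j * v j))"
      by (simp add: sum_product mult.assoc)
  qed simp
  also have "\<dots> = (\<Sum>i<n. cnj (v i) * (\<Sum>j<n. (\<Sum>x\<in>I. r x i * r x j) * v j))"
    unfolding sum_distrib_left sum_distrib_right
    by (subst sum.swap, rule sum.cong, simp, subst sum.swap, simp)
  also have "\<dots> = 0" using 0 by simp
  finally have "(\<Sum>x\<in>I. complex_of_real ((cmod (?z x))\<^sup>2)) = 0"
    by (simp add: complex_norm_square mult.commute del: of_real_power)
  then have "complex_of_real (\<Sum>x\<in>I. (cmod (?z x))\<^sup>2) = 0" by (simp only: of_real_sum)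
  then have "(\<Sum>x\<in>I. (cmod (?z x))\<^sup>2) = 0" by (simp only: of_real_eq_0_iff)
  then have "(cmod (?z y))\<^sup>2 = 0" using assms(1) y by (subst (asm) sum_nonneg_eq_0_iff) auto
  then show ?thesis by simp
qed

lemma of_nat_gfrac: "of_nat k = (to_fract (Poly_Mapping.single 0 (of_nat k)) :: 'g::linordered_ab_group_add gfrac)"
  by (induction k) (simp_all add: single_add)

lemma of_nat_gfrac_neq_0: "0 < k \<Longrightarrow> of_nat k \<noteq> (0 :: 'g::linordered_ab_group_add gfrac)"
  unfolding of_nat_gfrac by (metis gr_implies_not0 lookup_single_eq lookup_zero of_nat_eq_0_iff to_fract_eq_0_iff)

lemma has_residue_of_nat: "has_residue (of_nat k) (of_nat k)"
  using has_residue_to_fract[OF single_nonneg_keys[OF order_refl, of "of_nat k"]]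
  by (simp only: of_nat_gfrac lookup_single_eq)

text \<open>Evaluates the definite description of the a-invariant. A rival exponent \<open>b\<close>
  also gives a nonzero residue, so \<open>a + a\<close> and \<open>b + b\<close> bound each other,
  and doubling is injective in a linearly ordered group.\<close>

lemma leading_term_the_eq:
  fixes a :: "'g::linordered_ab_group_add"
  assumes res: "has_residue (eps (a + a) * to_fract q) (complex_of_real f)" and f: "0 < f" and a: "0 \<le> a"
  shows "(THE a. 0 \<le> a \<and> (\<exists>f::real. \<exists>p. 0 < f \<and>
     (\<forall>g\<in>Poly_Mapping.keys p. - (a + a) < g) \<and>
     to_fract q = to_fract (Poly_Mapping.single (- (a + a)) (complex_of_real f) + p))) = a"
proof (rule the_equality)
  define p where "p = q - Poly_Mapping.single (- (a + a)) (complex_of_real f)"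
  have "has_residue (to_fract (Poly_Mapping.single (a + a) 1 * q)) (complex_of_real f)"
    using res by (simp add: eps_def)
  from has_residue_to_fractD[OF this]
  have q: "Poly_Mapping.lookup q g = 0" if "g < - (a + a)" for g
    using that nonneg_keysD[of "Poly_Mapping.single (a + a) 1 * q" "g + (a + a)"]
    by (simp add: lookup_single_times less_diff_eq[symmetric])
  have q0: "Poly_Mapping.lookup q (- (a + a)) = complex_of_real f"
    using has_residue_to_fractD[OF \<open>has_residue (to_fract (Poly_Mapping.single (a + a) 1 * q)) _\<close>]
    by (simp add: lookup_single_times)
  have "to_fract q = to_fract (Poly_Mapping.single (- (a + a)) (complex_of_real f) + p)"
    by (simp add: p_def)
  moreover have "- (a + a) < g" if "g \<in> Poly_Mapping.keys p" for g
  proof (rule ccontr)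
    assume "\<not> - (a + a) < g"
    then have "Poly_Mapping.lookup p g = 0"
      using q[of g] q0 by (cases "g = - (a + a)") (auto simp: p_def lookup_minus lookup_single when_def)
    with that show False by (simp add: in_keys_iff)
  qed
  ultimately show "0 \<le> a \<and> (\<exists>f::real. \<exists>p. 0 < f \<and> (\<forall>g\<in>Poly_Mapping.keys p. - (a + a) < g) \<and>
     to_fract q = to_fract (Poly_Mapping.single (- (a + a)) (complex_of_real f) + p))"
    using a f by blast
next
  fix b assume "0 \<le> b \<and> (\<exists>f::real. \<exists>p. 0 < f \<and> (\<forall>g\<in>Poly_Mapping.keys p. - (b + b) < g) \<and>
     to_fract q = to_fract (Poly_Mapping.single (- (b + b)) (complex_of_real f) + p))"
  then obtain f' p where f': "0 < (f'::real)" and keys: "\<forall>g\<in>Poly_Mapping.keys p. - (b + b) < g"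
    and q: "q = Poly_Mapping.single (- (b + b)) (complex_of_real f') + p"
    by (auto simp only: to_fract_eq_iff)
  let ?q = "Poly_Mapping.single (b + b) 1 * q"
  have "Poly_Mapping.lookup ?q g = 0" if "g < 0" for g
  proof -
    have "g - (b + b) < - (b + b)" using that by simp
    moreover from this have "g - (b + b) \<notin> Poly_Mapping.keys p" using keys by (meson less_asym)
    ultimately show ?thesis by (simp add: lookup_single_times q lookup_add lookup_single in_keys_iff)
  qed
  then have "?q \<in> nonneg_keys" by (rule nonneg_keysI)
  moreover have "- (b + b) \<notin> Poly_Mapping.keys p" using keys by blast
  then have "Poly_Mapping.lookup ?q 0 = complex_of_real f'"
    by (simp add: lookup_single_times q lookup_add lookup_single in_keys_iff)
  ultimately have res': "has_residue (eps (b + b) * to_fract q) (complex_of_real f')"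
    using has_residue_to_fract[of ?q] by (simp add: eps_def)
  have "a + a \<le> b + b" "b + b \<le> a + a"
    using has_residue_exponent_le[OF res _ res'] has_residue_exponent_le[OF res' _ res] f f' by simp_all
  then show "b = a" by (metis add_strict_mono antisym leD not_le)
qed

section \<open>Invariant forms of a dense representation with trivial commutant\<close>

locale hecke_rep_over_K = coxeter_group W S for W :: "('w, 'x) monoid_scheme" (structure) and S +
  fixes R :: "complex set" and \<xi> :: "'w \<Rightarrow> 'g::linordered_ab_group_add gfrac" and n :: nat
    and \<tau> :: "'w \<Rightarrow> 'g gfrac mat"
  assumes R: "subring R (ring_of_type_algebra :: complex ring)" and real: "frac_field R \<subseteq> \<real>"
    and rep: "hecke_rep \<xi> n \<tau>" and n: "0 < n"
    and entries: "\<And>w i j. w \<in> carrier W \<Longrightarrow> i < n \<Longrightarrow> j < n \<Longrightarrow> \<tau> w $$ (i, j) \<in> K_field R"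
    and density: "\<And>\<psi> a b. (\<And>w. w \<in> carrier W \<Longrightarrow> (\<Sum>a<n. \<Sum>b<n. \<psi> a b * \<tau> w $$ (a, b)) = 0) \<Longrightarrow>
      a < n \<Longrightarrow> b < n \<Longrightarrow> \<psi> a b = 0"
    and commutant: "\<And>C. C \<in> carrier_mat n n \<Longrightarrow> (\<And>w. w \<in> carrier W \<Longrightarrow> C * \<tau> w = \<tau> w * C) \<Longrightarrow>
      \<exists>d. C = d \<cdot>\<^sub>m 1\<^sub>m n"
begin

lemmas carr = hecke_rep_carrier[OF rep]

lemma two_neq_0: "(2 :: 'g gfrac) \<noteq> 0"
  using of_nat_gfrac_neq_0[of 2] by simp

definition c_tau where
  "c_tau = (\<Sum>w\<in>carrier W. mat_trace (\<tau> w) * mat_trace (\<tau> (inv w))) / of_nat n"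

lemma mat_trace_tau: "w \<in> carrier W \<Longrightarrow> mat_trace (\<tau> w) = (\<Sum>i<n. \<tau> w $$ (i, i))"
  using carrier_matD(1)[OF carr] by (simp add: mat_trace_def)

text \<open>The constant is found by summing the relations for pairs of diagonal coefficients, which
  gives the sum of products of characters on one side and \<open>n\<close> times the constant on the
  other.\<close>

lemma schur:
  assumes "i < n" "j < n" "p < n" "l < n"
  shows "(\<Sum>w\<in>carrier W. \<tau> w $$ (i, j) * \<tau> (inv w) $$ (p, l)) = (if i = l \<and> j = p then c_tau else 0)"
proof -
  obtain c where c: "\<And>i j p l. i < n \<Longrightarrow> j < n \<Longrightarrow> p < n \<Longrightarrow> l < n \<Longrightarrow>
    (\<Sum>w\<in>carrier W. \<tau> w $$ (i, j) * \<tau> (inv w) $$ (p, l)) = (if i = l \<and> j = p then c else 0)"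
    by (rule schur_relations[OF rep two_neq_0, where k = UNIV]) (use commutant in auto)
  have "(\<Sum>w\<in>carrier W. mat_trace (\<tau> w) * mat_trace (\<tau> (inv w))) =
    (\<Sum>w\<in>carrier W. \<Sum>i<n. \<Sum>p<n. \<tau> w $$ (i, i) * \<tau> (inv w) $$ (p, p))"
    by (simp add: mat_trace_tau sum_product)
  also have "\<dots> = (\<Sum>i<n. \<Sum>p<n. \<Sum>w\<in>carrier W. \<tau> w $$ (i, i) * \<tau> (inv w) $$ (p, p))"
    by (subst sum.swap) (intro sum.cong refl sum.swap)
  also have "\<dots> = (\<Sum>i<n. \<Sum>p<n. if i = p then c else 0)"
    by (intro sum.cong refl) (auto simp: c)
  also have "\<dots> = of_nat n * c" by simp
  finally have "c_tau = of_nat n * c / of_nat n" by (simp only: c_tau_def)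
  moreover have "(of_nat n :: 'g gfrac) \<noteq> 0" by (rule of_nat_gfrac_neq_0[OF n])
  ultimately have "c_tau = c" by simp
  with c assms show ?thesis by simp
qed

definition gram where "gram = matsum n (\<lambda>w. (\<tau> w)\<^sup>T * \<tau> w) (carrier W)"

lemma gram_carrier [simp]: "gram \<in> carrier_mat n n"
  by (simp add: gram_def)

lemma gram_index:
  assumes "i < n" "j < n"
  shows "gram $$ (i, j) = (\<Sum>(w, k)\<in>carrier W \<times> {..<n}. \<tau> w $$ (k, i) * \<tau> w $$ (k, j))"
proof -
  have "((\<tau> w)\<^sup>T * \<tau> w) $$ (i, j) = (\<Sum>k<n. \<tau> w $$ (k, i) * \<tau> w $$ (k, j))" if "w \<in> carrier W" for w
  proof -
    have "((\<tau> w)\<^sup>T * \<tau> w) $$ (i, j) = (\<Sum>k<n. (\<tau> w)\<^sup>T $$ (i, k) * \<tau> w $$ (k, j))"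
      using carr[OF that] assms by (intro mat_mult_index[of _ n n _ n]) auto
    then show ?thesis using carrier_matD[OF carr[OF that]] assms by simp
  qed
  then show ?thesis using assms by (simp add: gram_def matsum_index sum.cartesian_product del: index_mult_mat(1))
qed

lemma gram_symmetric: "gram\<^sup>T = gram"
  by (rule eq_matI) (auto simp: gram_index mult.commute carrier_matD[OF gram_carrier])

text \<open>\<open>gram\<close> is the Casimir sum for the identity matrix between \<tau> and its
  dual, after replacing \<open>w\<close> by its inverse.\<close>

lemma gram_intertwines:
  assumes "w \<in> carrier W"
  shows "gram * \<tau> (inv w) = (\<tau> w)\<^sup>T * gram"
proof -
  let ?f = "\<lambda>w. (\<tau> (inv w))\<^sup>T * 1\<^sub>m n * \<tau> (inv w)"
  have "matsum n ?f (carrier W) = matsum n (\<lambda>w. (\<tau> (inv w))\<^sup>T * \<tau> (inv w)) (carrier W)"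
    by (intro matsum_cong) (simp add: carr right_mult_one_mat[of _ n n])
  also have "\<dots> = gram" unfolding gram_def
    by (rule matsum_reindex_bij_betw[where f = "\<lambda>w. (\<tau> w)\<^sup>T * \<tau> w"]) (rule bij_betwI[where g = "\<lambda>w. inv w"], auto)
  finally have eq: "matsum n ?f (carrier W) = gram" .
  have "(\<tau> (inv (inv w)))\<^sup>T * gram = gram * \<tau> (inv w)"
    by (rule intertwiner_extends[OF hecke_rep_transpose[OF rep] rep gram_carrier
      casimir_intertwines[OF hecke_rep_transpose[OF rep] rep one_carrier_mat two_neq_0, unfolded eq]])
      (use assms in auto)
  with assms show ?thesis by simp
qed

lemma residue_real:
  assumes "x \<in> K_field R" "has_residue (eps g * x) r"
  shows "r \<in> \<real>"
  using residue_in_frac_field[OF R K_field_closed(5)[OF R K_field_closed(3)[OF R, of g] assms(1)] assms(2)] real by blast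

text \<open>The index is split as \<open>(w, i)\<close> against \<open>j\<close> so that
  \<open>r\<close> is a family of row vectors, namely the reduced rows of the matrices
  \<open>\<tau> w\<close>, and the residue of \<open>gram\<close> is their Gram matrix.\<close>

definition leading_coeffs :: "'g \<Rightarrow> ('w \<times> nat \<Rightarrow> nat \<Rightarrow> complex) \<Rightarrow> bool" where
  "leading_coeffs g r \<longleftrightarrow>
     (\<forall>w\<in>carrier W. \<forall>i<n. \<forall>j<n. has_residue (eps g * \<tau> w $$ (i, j)) (r (w, i) j))"

lemma leading_coeffsD:
  "leading_coeffs g r \<Longrightarrow> w \<in> carrier W \<Longrightarrow> i < n \<Longrightarrow> j < n \<Longrightarrow>
   has_residue (eps g * \<tau> w $$ (i, j)) (r (w, i) j)"
  by (simp add: leading_coeffs_def)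

lemma gram_residue:
  assumes "leading_coeffs g r"
    and "i < n" "j < n"
  shows "has_residue (eps (g + g) * gram $$ (i, j)) (\<Sum>x\<in>carrier W \<times> {..<n}. r x i * r x j)"
proof -
  have "eps (g + g) * gram $$ (i, j) =
    (\<Sum>x\<in>carrier W \<times> {..<n}. (eps g * \<tau> (fst x) $$ (snd x, i)) * (eps g * \<tau> (fst x) $$ (snd x, j)))"
    using assms by (simp add: gram_index sum_distrib_left eps_add case_prod_unfold algebra_simps)
  also have "has_residue \<dots> (\<Sum>x\<in>carrier W \<times> {..<n}. r x i * r x j)"
    using assms by (intro has_residue_sum has_residue_mult) (auto intro: leading_coeffsD assms)
  finally show ?thesis .
qed

lemma obtain_leading_coeffs:
  obtains g r w i j where
    "leading_coeffs g r"
    "w \<in> carrier W" "i < n" "j < n" "r (w, i) j \<noteq> 0"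
proof -
  let ?I = "carrier W \<times> {..<n} \<times> {..<n}"
  let ?f = "\<lambda>(w, i, j). \<tau> w $$ (i, j)"
  have "finite ?I" "(\<one>, 0, 0) \<in> ?I" "?f (\<one>, 0, 0) \<noteq> 0"
    using finite_carrier n by (auto simp: hecke_rep_one[OF rep])
  then obtain g r where r: "\<And>x. x \<in> ?I \<Longrightarrow> has_residue (eps g * ?f x) (r x)" "\<exists>x\<in>?I. r x \<noteq> 0"
    by (rule exists_common_valuation) blast
  from r(2) obtain w i j where "w \<in> carrier W" "i < n" "j < n" "r (w, i, j) \<noteq> 0" by auto
  moreover have "leading_coeffs g (\<lambda>x j. r (fst x, snd x, j))"
    using r(1) by (fastforce simp: leading_coeffs_def)
  ultimately show thesis using that by fastforce
qed

lemma leading_coeffs_real: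
  assumes "leading_coeffs g r"
    and "x \<in> carrier W \<times> {..<n}" "j < n"
  shows "r x j \<in> \<real>"
  using residue_real[OF entries leading_coeffsD[OF assms(1)]] assms(2,3) by (cases x) auto

lemma gram_diagonal_residue_neq_0:
  assumes r: "leading_coeffs g r"
    and "w \<in> carrier W" "i < n" "j < n" "r (w, i) j \<noteq> 0"
  shows "(\<Sum>x\<in>carrier W \<times> {..<n}. r x j * r x j) \<noteq> 0"
  using sum_squares_real_pos[of "carrier W \<times> {..<n}" "\<lambda>x. r x j" "(w, i)"] finite_carrier assms(2-)
    leading_coeffs_real[OF r] by fastforce

text \<open>The kernel of \<open>gram\<close> is stable under all \<open>\<tau> w\<close>. A kernel
  vector \<open>v\<close> thus makes the functional with coefficients
  \<open>gram $$ (j, a) * v b\<close> vanish on the representation; density then kills a diagonal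
  entry whose scaled residue is a nonzero sum of squares.\<close>

lemma det_gram: "det gram \<noteq> 0"
proof
  assume "det gram = 0"
  then obtain v b where b: "b < n" "v b \<noteq> 0" and v: "\<And>i. i < n \<Longrightarrow> (\<Sum>j<n. gram $$ (i, j) * v j) = 0"
    using det_zero_iff_kernel[OF gram_carrier] by blast
  obtain g r w i j where r:
    "leading_coeffs g r"
    "w \<in> carrier W" "i < n" "j < n" "r (w, i) j \<noteq> 0"
    by (rule obtain_leading_coeffs)
  have "gram $$ (j, j) * v b = 0"
  proof (rule density[where \<psi> = "\<lambda>a b. gram $$ (j, a) * v b"])
    fix w assume w: "w \<in> carrier W"
    have c: "\<tau> w \<in> carrier_mat n n" "(\<tau> (inv w))\<^sup>T \<in> carrier_mat n n" using w carr by auto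
    have eq: "gram * \<tau> w = (\<tau> (inv w))\<^sup>T * gram" using gram_intertwines[of "inv w"] w by simp
    have "(\<Sum>a<n. \<Sum>b<n. gram $$ (j, a) * v b * \<tau> w $$ (a, b)) = (\<Sum>b<n. (gram * \<tau> w) $$ (j, b) * v b)"
      using \<open>j < n\<close> by (subst sum.swap) (simp add: mat_mult_index[OF gram_carrier c(1)] sum_distrib_right sum_distrib_left mult_ac del: index_mult_mat(1))
    also have "\<dots> = (\<Sum>b<n. \<Sum>k<n. (\<tau> (inv w))\<^sup>T $$ (j, k) * (gram $$ (k, b) * v b))"
      using \<open>j < n\<close> unfolding eq
      by (simp add: mat_mult_index[OF c(2) gram_carrier] sum_distrib_right mult.assoc del: index_mult_mat(1) index_transpose_mat(1))
    also have "\<dots> = (\<Sum>k<n. (\<tau> (inv w))\<^sup>T $$ (j, k) * (\<Sum>b<n. gram $$ (k, b) * v b))"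
      by (subst sum.swap) (simp add: sum_distrib_left)
    also have "\<dots> = 0" by (simp add: v)
    finally show "(\<Sum>a<n. \<Sum>b<n. gram $$ (j, a) * v b * \<tau> w $$ (a, b)) = 0" .
  qed (use b r in auto)
  then have "gram $$ (j, j) = 0" using b by simp
  then have "(\<Sum>x\<in>carrier W \<times> {..<n}. r x j * r x j) = 0"
    using gram_residue[OF r(1) r(4,4)] has_residue_0_iff by auto
  with gram_diagonal_residue_neq_0[OF r] show False by simp
qed

lemma mat_trace_inv: 
  assumes "w \<in> carrier W"
  shows "mat_trace (\<tau> (inv w)) = mat_trace (\<tau> w)"
proof -
  obtain Q where Q: "Q \<in> carrier_mat n n" "gram * Q = 1\<^sub>m n" "Q * gram = 1\<^sub>m n"
    using det_nonzero_obtain_inverse[OF gram_carrier det_gram] .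
  have c: "\<tau> (inv w) \<in> carrier_mat n n" "(\<tau> w)\<^sup>T \<in> carrier_mat n n" using assms carr by auto
  have "\<tau> (inv w) = Q * gram * \<tau> (inv w)" using Q c by (simp add: left_mult_one_mat[of _ n n])
  also have "\<dots> = Q * ((\<tau> w)\<^sup>T * gram)"
    by (subst assoc_mult_mat[of _ n n _ n _ n]) (use Q c in \<open>simp_all add: gram_intertwines[OF assms]\<close>)
  also have "mat_trace \<dots> = mat_trace ((\<tau> w)\<^sup>T * gram * Q)"
    using Q c by (intro mat_trace_mult_comm[of _ n n]) auto
  also have "(\<tau> w)\<^sup>T * gram * Q = (\<tau> w)\<^sup>T"
    using Q c by (simp add: assoc_mult_mat[of _ n n _ n _ n] right_mult_one_mat[of _ n n])
  also have "mat_trace (\<tau> w)\<^sup>T = mat_trace (\<tau> w)"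
    using carrier_matD[OF carr[OF assms]] by (simp add: mat_trace_def)
  finally show ?thesis .
qed

text \<open>Here \<open>a\<close> is the least exponent making all scaled character values integral.
  It is nonnegative because the value at the identity is the integer \<open>n\<close>, and the
  residue of the scaled \<open>c_tau\<close> is a sum of real squares divided by
  \<open>n\<close>.\<close>

lemma c_tau_leading:
  obtains a f where "0 \<le> a" "0 < f" "has_residue (eps (a + a) * c_tau) (complex_of_real f)"
proof -
  let ?\<chi> = "\<lambda>w. mat_trace (\<tau> w)"
  have \<chi>1: "?\<chi> \<one> = of_nat n" using mat_trace_tau[OF one_closed] by (simp add: hecke_rep_one[OF rep])
  then have "?\<chi> \<one> \<noteq> 0" using of_nat_gfrac_neq_0[OF n] by simp
  then obtain a r where r: "\<And>w. w \<in> carrier W \<Longrightarrow> has_residue (eps a * ?\<chi> w) (r w)" "\<exists>w\<in>carrier W. r w \<noteq> 0"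
    using exists_common_valuation[OF finite_carrier one_closed, of ?\<chi>] by blast
  have "has_residue (eps 0 * of_nat n) (of_nat n)" using has_residue_of_nat by (simp add: eps_0)
  from has_residue_exponent_le[OF this _ r(1)[OF one_closed, unfolded \<chi>1]] n have a: "0 \<le> a" by simp
  have "?\<chi> w \<in> K_field R" if "w \<in> carrier W" for w
    using that entries by (auto simp: mat_trace_tau intro!: sum_in_closed K_field_closed[OF R])
  then have "r w \<in> \<real>" if "w \<in> carrier W" for w using residue_real r(1) that by blast
  then obtain t where t: "0 < (t::real)" "(\<Sum>w\<in>carrier W. r w * r w) = complex_of_real t"
    using sum_squares_real_pos[OF finite_carrier] r(2) by metis
  have "eps (a + a) * c_tau = inverse (of_nat n) * (\<Sum>w\<in>carrier W. (eps a * ?\<chi> w) * (eps a * ?\<chi> w))"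
    by (simp add: c_tau_def mat_trace_inv eps_add sum_distrib_left divide_inverse mult_ac)
  also have "has_residue \<dots> (inverse (of_nat n) * (\<Sum>w\<in>carrier W. r w * r w))"
    using n by (intro has_residue_mult has_residue_inverse has_residue_of_nat has_residue_sum r(1)) auto
  also have "inverse (of_nat n) * (\<Sum>w\<in>carrier W. r w * r w) = complex_of_real (t / real n)"
    by (simp add: t divide_inverse mult.commute)
  finally show thesis using that[OF a, of "t / real n"] t(1) n by simp
qed

lemma balanced_imp_form:
  assumes f: "has_residue (eps (a + a) * c_tau) f" "f \<noteq> 0"
    and bal: "\<And>w i j. w \<in> carrier W \<Longrightarrow> i < n \<Longrightarrow> j < n \<Longrightarrow> \<exists>r. has_residue (eps a * \<tau> w $$ (i, j)) r"
  shows "\<exists>\<Omega>\<in>mats (O_ring R) n. \<Omega>\<^sup>T = \<Omega> \<and> det \<Omega> \<in> O_units R \<and>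
    (\<forall>w\<in>carrier W. \<Omega> * \<tau> (inv w) = (\<tau> w)\<^sup>T * \<Omega>)"
proof (intro bexI[of _ "eps (a + a) \<cdot>\<^sub>m gram"] conjI ballI)
  have "\<forall>x j. \<exists>r. fst x \<in> carrier W \<longrightarrow> snd x < n \<longrightarrow> j < n \<longrightarrow> has_residue (eps a * \<tau> (fst x) $$ (snd x, j)) r"
    using bal by blast
  then have "\<exists>r. \<forall>x j. fst x \<in> carrier W \<longrightarrow> snd x < n \<longrightarrow> j < n \<longrightarrow> has_residue (eps a * \<tau> (fst x) $$ (snd x, j)) (r x j)"
    by (simp only: choice_iff)
  then obtain r where "\<forall>x j. fst x \<in> carrier W \<longrightarrow> snd x < n \<longrightarrow> j < n \<longrightarrow> has_residue (eps a * \<tau> (fst x) $$ (snd x, j)) (r x j)" ..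
  then have r: "leading_coeffs a r" unfolding leading_coeffs_def by fastforce
  let ?\<Omega> = "eps (a + a) \<cdot>\<^sub>m gram"
  let ?P = "\<lambda>i j. \<Sum>x\<in>carrier W \<times> {..<n}. r x i * r x j"
  have \<Omega>: "?\<Omega> \<in> carrier_mat n n" by simp
  have res: "has_residue (?\<Omega> $$ (i, j)) (?P i j)" if "i < n" "j < n" for i j
    using gram_residue[OF r that] that carrier_matD[OF gram_carrier] by simp
  have K: "?\<Omega> $$ (i, j) \<in> K_field R" if "i < n" "j < n" for i j
    using that carrier_matD[OF gram_carrier] entries
    by (auto simp: gram_index intro!: K_field_closed(3,5)[OF R] sum_in_closed K_field_closed(1,4)[OF R])
  have "?\<Omega> $$ (i, j) \<in> O_ring R" if "i < n" "j < n" for i j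
    using K[OF that] res[OF that] unfolding O_ring_iff[OF R] by blast
  then show "?\<Omega> \<in> mats (O_ring R) n"
    using carrier_matD[OF gram_carrier] unfolding mats_def by (fastforce simp del: index_smult_mat(1))
  show "?\<Omega>\<^sup>T = ?\<Omega>" by (simp add: transpose_smult_mat gram_symmetric)
  show "?\<Omega> * \<tau> (inv w) = (\<tau> w)\<^sup>T * ?\<Omega>" if "w \<in> carrier W" for w
    using gram_intertwines[OF that] that carr[OF that] carr[of "inv w"]
    by (simp add: mult_smult_assoc_mat[of _ n n _ n] mult_smult_distrib[of _ n n _ n])
  \<comment> \<open>A kernel vector of this Gram matrix is orthogonal to all rows
    \<open>r (w, k)\<close>. Reduced modulo the maximal ideal, the Schur relations recover each of
    its coordinates from these products, up to the factor \<open>f\<close>.\<close>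
  have "det (mat n n (\<lambda>(i, j). ?P i j)) \<noteq> 0"
  proof
    assume "det (mat n n (\<lambda>(i, j). ?P i j)) = 0"
    then have "\<exists>v. (\<exists>i<n. v i \<noteq> 0) \<and> (\<forall>i<n. (\<Sum>j<n. mat n n (\<lambda>(i, j). ?P i j) $$ (i, j) * v j) = 0)"
      by (subst (asm) det_zero_iff_kernel[of _ n]) simp_all
    then obtain v p where p: "p < n" "v p \<noteq> 0" and v: "\<And>i. i < n \<Longrightarrow> (\<Sum>j<n. ?P i j * v j) = 0" by auto
    have 0: "(\<Sum>j<n. r (w, k) j * v j) = 0" if "w \<in> carrier W" "k < n" for w k
      by (rule gram_kernel[where r = r and I = "carrier W \<times> {..<n}"])
        (use finite_carrier leading_coeffs_real[OF r] v that in auto)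
    \<comment> \<open>The product of two scaled coefficients carries \<open>eps (a + a)\<close>,
      exactly the scaling under which \<open>c_tau\<close> has residue \<open>f\<close>.\<close>
    have schur_r: "(\<Sum>w\<in>carrier W. r (w, p) j * r (inv w, p) p) = (if j = p then f else 0)" if j: "j < n" for j
    proof -
      have "has_residue (\<Sum>w\<in>carrier W. (eps a * \<tau> w $$ (p, j)) * (eps a * \<tau> (inv w) $$ (p, p)))
        (\<Sum>w\<in>carrier W. r (w, p) j * r (inv w, p) p)"
        using p j by (intro has_residue_sum has_residue_mult leading_coeffsD[OF r]) auto
      moreover have "(\<Sum>w\<in>carrier W. (eps a * \<tau> w $$ (p, j)) * (eps a * \<tau> (inv w) $$ (p, p))) =
        eps (a + a) * (\<Sum>w\<in>carrier W. \<tau> w $$ (p, j) * \<tau> (inv w) $$ (p, p))"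
        by (simp add: eps_add sum_distrib_left mult_ac)
      then have "(\<Sum>w\<in>carrier W. (eps a * \<tau> w $$ (p, j)) * (eps a * \<tau> (inv w) $$ (p, p))) =
        eps (a + a) * (if j = p then c_tau else 0)"
        by (simp only: schur[OF p(1) j p(1,1)] simp_thms)
      ultimately show ?thesis using f has_residue_0_iff has_residue_unique by (cases "j = p") auto
    qed
    have "f * v p = (\<Sum>j<n. (if j = p then f else 0) * v j)" using p by (simp add: if_distrib[of "\<lambda>x. x * _"] cong: if_cong)
    also have "\<dots> = (\<Sum>j<n. (\<Sum>w\<in>carrier W. r (w, p) j * r (inv w, p) p) * v j)" by (simp add: schur_r)
    also have "\<dots> = (\<Sum>w\<in>carrier W. r (inv w, p) p * (\<Sum>j<n. r (w, p) j * v j))"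
      unfolding sum_distrib_left sum_distrib_right by (subst sum.swap) (simp add: mult_ac)
    also have "\<dots> = 0" using 0 p by simp
    finally show False using f p by simp
  qed
  moreover have "det ?\<Omega> \<in> K_field R" by (rule det_in_closed[OF \<Omega> K]) (auto intro: K_field_closed[OF R])
  ultimately show "det ?\<Omega> \<in> O_units R"
    using has_residue_det[OF \<Omega> res] by (auto simp: O_units_iff[OF R])
qed

lemma casimir_scalar: "matsum n (\<lambda>w. \<tau> (inv w) * \<tau> w) (carrier W) = (of_nat n * c_tau) \<cdot>\<^sub>m 1\<^sub>m n"
proof (rule eq_matI)
  fix i l assume "i < dim_row ((of_nat n * c_tau) \<cdot>\<^sub>m 1\<^sub>m n :: 'g gfrac mat)" "l < dim_col ((of_nat n * c_tau) \<cdot>\<^sub>m 1\<^sub>m n :: 'g gfrac mat)"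
  then have il: "i < n" "l < n" by simp_all
  have "matsum n (\<lambda>w. \<tau> (inv w) * \<tau> w) (carrier W) $$ (i, l) =
    (\<Sum>w\<in>carrier W. \<Sum>j<n. \<tau> w $$ (j, l) * \<tau> (inv w) $$ (i, j))"
    using il by (simp add: matsum_index mat_mult_index[OF carr carr] mult.commute del: index_mult_mat(1))
  also have "\<dots> = (\<Sum>j<n. if i = l then c_tau else 0)"
    by (subst sum.swap) (intro sum.cong refl, use il in \<open>auto simp: schur\<close>)
  also have "\<dots> = ((of_nat n * c_tau) \<cdot>\<^sub>m 1\<^sub>m n) $$ (i, l)" using il by simp
  finally show "matsum n (\<lambda>w. \<tau> (inv w) * \<tau> w) (carrier W) $$ (i, l) = ((of_nat n * c_tau) \<cdot>\<^sub>m 1\<^sub>m n) $$ (i, l)" .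
qed (simp_all add: matsum_def)

text \<open>Moving \<open>gram\<close> across turns the transpose of \<open>\<tau> w\<close> into
  \<open>\<tau> (inv w)\<close>, and the remaining Casimir sum is the scalar
  \<open>of_nat n * c_tau\<close>.\<close>

lemma gram_sandwich: 
  assumes "j < n"
  shows "(\<Sum>w\<in>carrier W. \<Sum>k<n. \<Sum>l<n. \<tau> w $$ (k, j) * gram $$ (k, l) * \<tau> w $$ (l, j)) =
    of_nat n * c_tau * gram $$ (j, j)"
proof -
  have "matsum n (\<lambda>w. (\<tau> w)\<^sup>T * gram * \<tau> w) (carrier W) = matsum n (\<lambda>w. gram * (\<tau> (inv w) * \<tau> w)) (carrier W)"
    by (intro matsum_cong) (simp add: gram_intertwines[symmetric] assoc_mult_mat[of _ n n _ n _ n] carr)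
  also have "\<dots> = gram * ((of_nat n * c_tau) \<cdot>\<^sub>m 1\<^sub>m n)"
    by (subst casimir_scalar[symmetric]) (simp add: mult_matsum carr mult_carrier_mat[of _ n n])
  also have "\<dots> $$ (j, j) = of_nat n * c_tau * gram $$ (j, j)"
    using assms carrier_matD[OF gram_carrier]
    by (simp add: mult_smult_distrib[OF gram_carrier one_carrier_mat] right_mult_one_mat[OF gram_carrier])
  finally have eq: "matsum n (\<lambda>w. (\<tau> w)\<^sup>T * gram * \<tau> w) (carrier W) $$ (j, j) = \<dots>" by simp
  have "((\<tau> w)\<^sup>T * gram * \<tau> w) $$ (j, j) = (\<Sum>k<n. \<Sum>l<n. \<tau> w $$ (k, j) * gram $$ (k, l) * \<tau> w $$ (l, j))"
    if w: "w \<in> carrier W" for w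
  proof -
    have c: "(\<tau> w)\<^sup>T \<in> carrier_mat n n" "(\<tau> w)\<^sup>T * gram \<in> carrier_mat n n" using carr[OF w] by (auto intro: mult_carrier_mat)
    have "((\<tau> w)\<^sup>T * gram * \<tau> w) $$ (j, j) = (\<Sum>l<n. (\<Sum>k<n. (\<tau> w)\<^sup>T $$ (j, k) * gram $$ (k, l)) * \<tau> w $$ (l, j))"
      using assms by (simp add: mat_mult_index[OF c(2) carr[OF w]] mat_mult_index[OF c(1) gram_carrier]
          del: index_mult_mat(1) index_transpose_mat(1))
    also have "\<dots> = (\<Sum>k<n. \<Sum>l<n. \<tau> w $$ (k, j) * gram $$ (k, l) * \<tau> w $$ (l, j))"
      unfolding sum_distrib_right by (subst sum.swap) (use assms carrier_matD[OF carr[OF w]] in simp)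
    finally show ?thesis .
  qed
  with eq show ?thesis using assms by (simp add: matsum_index del: index_mult_mat(1))
qed

lemma form_imp_balanced:
  assumes f: "has_residue (eps (a + a) * c_tau) f"
    and \<Omega>: "\<Omega> \<in> carrier_mat n n" "\<And>i j. i < n \<Longrightarrow> j < n \<Longrightarrow> has_residue (\<Omega> $$ (i, j)) (u i j)"
    and det_u: "det (mat n n (\<lambda>(i, j). u i j)) \<noteq> 0"
    and inter: "\<And>w. w \<in> carrier W \<Longrightarrow> \<Omega> * \<tau> (inv w) = (\<tau> w)\<^sup>T * \<Omega>"
    and wij: "w \<in> carrier W" "i < n" "j < n"
  shows "\<exists>r. has_residue (eps a * \<tau> w $$ (i, j)) r"
proof -
  obtain g r w0 i0 j0 where r:
    "leading_coeffs g r"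
    "w0 \<in> carrier W" "i0 < n" "j0 < n" "r (w0, i0) j0 \<noteq> 0"
    by (rule obtain_leading_coeffs)
  let ?I = "carrier W \<times> {..<n}"
  define P where "P i j = (\<Sum>x\<in>?I. r x i * r x j)" for i j
  note real_r = leading_coeffs_real[OF r(1)]
  have P: "has_residue (eps (g + g) * gram $$ (i, j)) (P i j)" if "i < n" "j < n" for i j
    using gram_residue[OF r(1) that] unfolding P_def .
  have u_kernel: "v i = 0" if "\<And>i. i < n \<Longrightarrow> (\<Sum>j<n. u i j * v j) = 0" "i < n" for v i
    using det_u that by (subst (asm) det_zero_iff_kernel[of _ n]) auto
  have "det \<Omega> \<noteq> 0" using has_residue_det[OF \<Omega>] det_u has_residue_0_iff by metis
  then obtain Q where Q: "Q \<in> carrier_mat n n" "\<Omega> * Q = 1\<^sub>m n" "Q * \<Omega> = 1\<^sub>m n"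
    using det_nonzero_obtain_inverse[OF \<Omega>(1)] by blast
  note [simp] = carr \<Omega>(1) Q(1)
  note assoc = assoc_mult_mat[of _ n n _ n _ n] mult_carrier_mat[of _ n n _ n]
  \<comment> \<open>Both forms intertwine \<tau> with its dual, so their quotient lies in the
    commutant and \<open>gram\<close> is a multiple of \<Omega>.\<close>
  have "Q * gram * \<tau> w = \<tau> w * (Q * gram)" if w: "w \<in> carrier W" for w
  proof -
    have "Q * gram * \<tau> w = Q * ((\<tau> (inv w))\<^sup>T * gram)"
      using gram_intertwines[of "inv w"] w by (simp add: assoc)
    also have "\<dots> = Q * ((\<tau> (inv w))\<^sup>T * (\<Omega> * Q * gram))"
      using w by (simp add: Q(2) left_mult_one_mat[of _ n n])
    also have "\<dots> = Q * ((\<tau> (inv w))\<^sup>T * \<Omega> * (Q * gram))"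
      using w by (simp add: assoc)
    also have "\<dots> = Q * \<Omega> * (\<tau> w * (Q * gram))"
      using w inter[of "inv w", symmetric] by (simp add: assoc)
    also have "\<dots> = \<tau> w * (Q * gram)" using w by (simp add: Q(3) assoc left_mult_one_mat[of _ n n])
    finally show ?thesis .
  qed
  then obtain \<gamma> where \<gamma>: "Q * gram = \<gamma> \<cdot>\<^sub>m 1\<^sub>m n"
    using commutant[of "Q * gram"] by (auto simp: assoc)
  have "gram = \<Omega> * Q * gram" by (simp add: Q(2) left_mult_one_mat[of _ n n])
  also have "\<dots> = \<Omega> * (\<gamma> \<cdot>\<^sub>m 1\<^sub>m n)" by (simp add: assoc \<gamma>)
  also have "\<dots> = \<gamma> \<cdot>\<^sub>m \<Omega>" by (simp add: mult_smult_distrib[of _ n n _ n] right_mult_one_mat[of _ n n])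
  finally have gram: "gram = \<gamma> \<cdot>\<^sub>m \<Omega>" .
  \<comment> \<open>Were all residues of \<Omega> zero, the constant vector 1 would lie in the
    kernel of a nonsingular matrix. At this entry \<Omega> can be divided out, which shows the
    scaled factor \<gamma> to be integral.\<close>
  obtain i1 j1 where u1: "i1 < n" "j1 < n" "u i1 j1 \<noteq> 0"
    using u_kernel[of "\<lambda>_. 1" 0] n by force
  define \<kappa> where "\<kappa> = P i1 j1 * inverse (u i1 j1)"
  have "\<Omega> $$ (i1, j1) \<noteq> 0" using \<Omega>(2)[OF u1(1,2)] u1(3) has_residue_0_iff by metis
  then have "eps (g + g) * \<gamma> = (eps (g + g) * gram $$ (i1, j1)) * inverse (\<Omega> $$ (i1, j1))"
    using u1 carrier_matD[OF \<Omega>(1)] by (simp add: gram)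
  then have \<kappa>: "has_residue (eps (g + g) * \<gamma>) \<kappa>"
    unfolding \<kappa>_def using u1 by (simp only:) (intro has_residue_mult P has_residue_inverse \<Omega>(2))
  have P_eq: "P i j = \<kappa> * u i j" if "i < n" "j < n" for i j
  proof -
    have "has_residue (eps (g + g) * \<gamma> * \<Omega> $$ (i, j)) (\<kappa> * u i j)"
      by (intro has_residue_mult \<kappa> \<Omega>(2) that)
    moreover have "eps (g + g) * \<gamma> * \<Omega> $$ (i, j) = eps (g + g) * gram $$ (i, j)"
      using that carrier_matD[OF \<Omega>(1)] by (simp add: gram)
    ultimately show ?thesis using P[OF that] has_residue_unique by metis
  qed
  have "P j0 j0 \<noteq> 0" unfolding P_def by (rule gram_diagonal_residue_neq_0[OF r])
  then have "\<kappa> \<noteq> 0" using P_eq r(4) by auto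
  \<comment> \<open>The product of a reduced row with column \<open>j0\<close> of a reduced matrix.
    The sum of the squares of these numbers is the residue of the scaled left side of
    \<open>gram_sandwich\<close>.\<close>
  define z where "z x w = (\<Sum>k<n. r x k * r (w, k) j0)" for x w
  have z_real: "z x w \<in> \<real>" if "x \<in> ?I" "w \<in> carrier W" for x w
    unfolding z_def using that r(4) by (intro sum_in_Reals Reals_mult real_r) auto
  \<comment> \<open>If the squares cancelled, column \<open>j0\<close> of the reduced matrix at
    \<open>w0\<close> would lie in the kernel of \<open>P\<close>, which is \<kappa> times the
    nonsingular matrix \<open>u\<close>; but that column is nonzero at \<open>i0\<close>.\<close>
  have nz: "(\<Sum>(w, x)\<in>carrier W \<times> ?I. z x w * z x w) \<noteq> 0"
  proof
    assume sum0: "(\<Sum>(w, x)\<in>carrier W \<times> ?I. z x w * z x w) = 0"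
    have z0: "z x w0 = 0" if "x \<in> ?I" for x
      using sum_squares_real_eq_0[of "carrier W \<times> ?I" "\<lambda>y. z (snd y) (fst y)" "(w0, x)"] sum0 that r(2) z_real
        finite_carrier by (auto simp: case_prod_unfold)
    have "(\<Sum>j<n. u i j * r (w0, j) j0) = 0" if i: "i < n" for i
    proof -
      have "\<kappa> * (\<Sum>j<n. u i j * r (w0, j) j0) = (\<Sum>j<n. P i j * r (w0, j) j0)"
        using i by (simp add: P_eq sum_distrib_left mult.assoc)
      also have "\<dots> = (\<Sum>x\<in>?I. r x i * z x w0)"
        unfolding P_def z_def sum_distrib_left sum_distrib_right by (subst sum.swap) (simp add: mult.assoc)
      also have "\<dots> = 0" by (simp add: z0)
      finally show ?thesis using \<open>\<kappa> \<noteq> 0\<close> by simp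
    qed
    from u_kernel[OF this r(3)] r(5) show False by simp
  qed
  have z_eq: "(\<Sum>(w, x)\<in>carrier W \<times> ?I. z x w * z x w) =
    (\<Sum>w\<in>carrier W. \<Sum>k<n. \<Sum>l<n. r (w, k) j0 * P k l * r (w, l) j0)"
  proof -
    have "(\<Sum>x\<in>?I. z x w * z x w) = (\<Sum>k<n. \<Sum>l<n. r (w, k) j0 * P k l * r (w, l) j0)" for w
    proof -
      have "(\<Sum>x\<in>?I. z x w * z x w) = (\<Sum>x\<in>?I. \<Sum>k<n. \<Sum>l<n. r (w, k) j0 * (r x k * r x l) * r (w, l) j0)"
        by (simp add: z_def sum_product mult_ac)
      also have "\<dots> = (\<Sum>k<n. \<Sum>l<n. r (w, k) j0 * P k l * r (w, l) j0)"
        unfolding P_def sum_distrib_left sum_distrib_right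
        by (subst sum.swap, rule sum.cong, simp, subst sum.swap, simp)
      finally show ?thesis .
    qed
    then show ?thesis by (simp add: sum.cartesian_product[symmetric])
  qed
  have res: "has_residue (\<Sum>w\<in>carrier W. \<Sum>k<n. \<Sum>l<n.
      (eps g * \<tau> w $$ (k, j0)) * (eps (g + g) * gram $$ (k, l)) * (eps g * \<tau> w $$ (l, j0)))
    (\<Sum>w\<in>carrier W. \<Sum>k<n. \<Sum>l<n. r (w, k) j0 * P k l * r (w, l) j0)"
    using r(4) by (intro has_residue_sum has_residue_mult P leading_coeffsD[OF r(1)]) auto
  have sandwich: "(\<Sum>w\<in>carrier W. \<Sum>k<n. \<Sum>l<n.
      (eps g * \<tau> w $$ (k, j0)) * (eps (g + g) * gram $$ (k, l)) * (eps g * \<tau> w $$ (l, j0))) =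
    of_nat n * (eps (g + g) * c_tau) * (eps (g + g) * gram $$ (j0, j0))"
  proof -
    have "(\<Sum>w\<in>carrier W. \<Sum>k<n. \<Sum>l<n.
      (eps g * \<tau> w $$ (k, j0)) * (eps (g + g) * gram $$ (k, l)) * (eps g * \<tau> w $$ (l, j0))) =
      eps g * eps g * eps (g + g) *
      (\<Sum>w\<in>carrier W. \<Sum>k<n. \<Sum>l<n. \<tau> w $$ (k, j0) * gram $$ (k, l) * \<tau> w $$ (l, j0))"
      by (simp add: sum_distrib_left mult_ac)
    then show ?thesis unfolding gram_sandwich[OF r(4)] by (simp add: eps_add mult_ac)
  qed
  obtain s where s: "s \<noteq> 0"
    "has_residue (of_nat n * (eps (g + g) * c_tau) * (eps (g + g) * gram $$ (j0, j0))) s"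
    using res nz unfolding sandwich z_eq by blast
  have "g \<le> a"
  proof (rule ccontr)
    assume "\<not> g \<le> a"
    then have "a + a < g + g" by (simp add: add_strict_mono)
    with has_residue_eps_mult[OF _ f, of "g + g"] have "has_residue (eps (g + g) * c_tau) 0" by auto
    from has_residue_mult[OF has_residue_mult[OF has_residue_of_nat this] P[OF r(4,4)]]
    have "s = of_nat n * 0 * P j0 j0" by (rule has_residue_unique[OF s(2)])
    with s(1) show False by simp
  qed
  from has_residue_eps_mult[OF this leading_coeffsD[OF r(1) wij]] show ?thesis by blast
qed

end


section \<open>From representations of W and of the Hecke algebra to matrix families\<close>

lemma index_mats:
  "M \<in> mats k n \<Longrightarrow> i < n \<Longrightarrow> j < n \<Longrightarrow> M $$ (i, j) \<in> k"
  unfolding mats_def by fastforce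

lemma group_rep_imp_hecke_rep:
  fixes \<rho> :: "'w \<Rightarrow> 'b::field mat"
  assumes "coxeter_system W S" "finite (carrier W)" "group_rep k n W \<rho>"
  shows "coxeter_group.hecke_rep W S (\<lambda>_. 0) n \<rho>"
proof -
  interpret group W using assms by (simp add: coxeter_system_def)
  interpret coxeter_group W S by unfold_locales (use assms in auto)
  have "\<rho> w \<in> carrier_mat n n" if "w \<in> carrier W" for w
    using assms that by (auto simp: group_rep_def mats_def)
  moreover have "M + 0 \<cdot>\<^sub>m N = M" if "M \<in> carrier_mat n n" "N \<in> carrier_mat n n" for M N :: "'b mat"
    using that by (intro eq_matI) auto
  ultimately show ?thesis using assms(3) S_carrier
    by (simp add: hecke_rep_def group_rep_def mult_carrier_mat[of _ n n _ n])
qed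

lemma algebra_rep_imp_hecke_rep:
  assumes "coxeter_system W S" "finite (carrier W)" "hecke_algebra (K_field R) W S L H T"
    and R: "subring R (ring_of_type_algebra :: complex ring)" and "algebra_rep (K_field R) n H \<sigma>"
  shows "coxeter_group.hecke_rep W S (\<lambda>s. eps (L s) - inverse (eps (L s))) n (\<lambda>w. \<sigma> (T w))"
proof -
  interpret group W using assms by (simp add: coxeter_system_def)
  interpret coxeter_group W S by unfold_locales (use assms in auto)
  have T: "T w \<in> carrier H" if "w \<in> carrier W" for w
    using assms(3) that by (auto simp: hecke_algebra_def)
  have one: "\<sigma> (T \<one>\<^bsub>W\<^esub>) = 1\<^sub>m n" using assms(3,5) by (simp add: hecke_algebra_def algebra_rep_def)
  have carr: "\<sigma> (T w) \<in> carrier_mat n n" if "w \<in> carrier W" for w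
    using T[OF that] assms(5) by (auto simp: algebra_rep_def mats_def)
  have mult: "\<sigma> (T s) * \<sigma> (T w) = \<sigma> (T s \<otimes>\<^bsub>H\<^esub> T w)" if "s \<in> S" "w \<in> carrier W" for s w
    using T[OF that(2)] T[OF S_carrier[OF that(1)]] assms(5) by (simp add: algebra_rep_def)
  have up: "\<sigma> (T s) * \<sigma> (T w) = \<sigma> (T (s \<otimes>\<^bsub>W\<^esub> w))"
    if "s \<in> S" "w \<in> carrier W" "len w < len (s \<otimes>\<^bsub>W\<^esub> w)" for s w
    using that mult assms(3) by (simp add: hecke_algebra_def)
  have down: "\<sigma> (T s) * \<sigma> (T w) = \<sigma> (T (s \<otimes>\<^bsub>W\<^esub> w)) + (eps (L s) - inverse (eps (L s))) \<cdot>\<^sub>m \<sigma> (T w)"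
    if sw: "s \<in> S" "w \<in> carrier W" "len (s \<otimes>\<^bsub>W\<^esub> w) < len w" for s w
  proof -
    let ?c = "eps (L s) - inverse (eps (L s))"
    have c: "?c \<in> K_field R"
      using K_field_closed(4)[OF R K_field_closed(3)[OF R] K_field_closed(6)[OF R K_field_closed(3)[OF R]]]
      by (simp add: inverse_eps)
    have H: "ring H" "Module.module (ring_of_type_algebra\<lparr>carrier := K_field R\<rparr>) H"
      using assms(3) by (simp_all add: hecke_algebra_def)
    interpret H: Module.module "ring_of_type_algebra\<lparr>carrier := K_field R\<rparr>" H by (rule H)
    have "?c \<odot>\<^bsub>H\<^esub> T w \<in> carrier H" using c T sw by (intro H.smult_closed) auto
    moreover have "T (s \<otimes>\<^bsub>W\<^esub> w) \<in> carrier H" using T sw S_carrier by simp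
    moreover have "T s \<otimes>\<^bsub>H\<^esub> T w = T (s \<otimes>\<^bsub>W\<^esub> w) \<oplus>\<^bsub>H\<^esub> ?c \<odot>\<^bsub>H\<^esub> T w"
      using assms(3) sw by (simp add: hecke_algebra_def)
    ultimately show ?thesis using mult[OF sw(1,2)] assms(5) c T[OF sw(2)] by (simp add: algebra_rep_def)
  qed
  show ?thesis unfolding hecke_rep_def using one carr up down by blast
qed

text \<open>The constant is nonzero in characteristic 0: each product of \<open>\<rho> w\<close>
  with the matrix at the inverse is the identity, so summing the relations at entry
  \<open>(0, 0)\<close> equates the group order with \<open>n * c\<close>.\<close>

lemma group_schur_relations:
  fixes \<rho> :: "'w \<Rightarrow> complex mat"
  assumes "coxeter_system W S" "finite (carrier W)"
    and R: "subring R (ring_of_type_algebra :: complex ring)"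
    and split: "splitting_field (frac_field R) W"
    and irr: "irred_group_rep (frac_field R) n W \<rho>"
  obtains c where "c \<noteq> 0" "\<And>i j p l. i < n \<Longrightarrow> j < n \<Longrightarrow> p < n \<Longrightarrow> l < n \<Longrightarrow>
    (\<Sum>w\<in>carrier W. \<rho> w $$ (i, j) * \<rho> (inv\<^bsub>W\<^esub> w) $$ (p, l)) = (if i = l \<and> j = p then c else 0)"
proof -
  interpret group W using assms by (simp add: coxeter_system_def)
  interpret coxeter_group W S by unfold_locales (use assms in auto)
  have grp: "group_rep (frac_field R) n W \<rho>" and n: "0 < n"
    using irr by (auto simp: irred_group_rep_def irreducible_mats_def)
  note rep = group_rep_imp_hecke_rep[OF assms(1,2) grp]
  obtain c where c: "\<And>i j p l. i < n \<Longrightarrow> j < n \<Longrightarrow> p < n \<Longrightarrow> l < n \<Longrightarrow>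
    (\<Sum>w\<in>carrier W. \<rho> w $$ (i, j) * \<rho> (inv\<^bsub>W\<^esub> w) $$ (p, l)) = (if i = l \<and> j = p then c else 0)"
  proof (rule schur_relations[OF rep, where k = "frac_field R"])
    show "\<exists>c. C = c \<cdot>\<^sub>m 1\<^sub>m n"
      if "C \<in> carrier_mat n n" "\<And>i j. i < n \<Longrightarrow> j < n \<Longrightarrow> C $$ (i, j) \<in> frac_field R"
        "\<And>w. w \<in> carrier W \<Longrightarrow> C * \<rho> w = \<rho> w * C" for C
    proof -
      have "C \<in> mats (frac_field R) n" using that(1,2) unfolding mats_def by fastforce
      with split irr that(3) show ?thesis unfolding splitting_field_def by blast
    qed
    show "\<rho> w $$ (i, j) \<in> frac_field R" if "w \<in> carrier W" "i < n" "j < n" for w i j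
      using grp that by (auto simp: group_rep_def intro: index_mats)
    note cl = subring_of_typeD[OF R]
    show "0 \<in> frac_field R" "1 \<in> frac_field R"
      using cl(1,2) unfolding frac_field_def by (force intro: exI[of _ 1])+
    show "x + y \<in> frac_field R" "x * y \<in> frac_field R" if "x \<in> frac_field R" "y \<in> frac_field R" for x y
    proof -
      from that obtain a b a' b' where ab: "x = a / b" "y = a' / b'" "a \<in> R" "b \<in> R" "a' \<in> R" "b' \<in> R" "b \<noteq> 0" "b' \<noteq> 0"
        by (auto simp: frac_field_def)
      then have "x + y = (a * b' + a' * b) / (b * b')" "x * y = (a * a') / (b * b')"
        by (simp_all add: add_frac_eq)
      moreover have "a * b' + a' * b \<in> R" "a * a' \<in> R" "b * b' \<in> R" "b * b' \<noteq> 0" using ab cl(3,4) by auto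
      ultimately show "x + y \<in> frac_field R" "x * y \<in> frac_field R" unfolding frac_field_def by blast+
    qed
  qed (use that in simp_all)
  have "of_nat (card (carrier W)) = (\<Sum>w\<in>carrier W. (\<rho> w * \<rho> (inv\<^bsub>W\<^esub> w)) $$ (0, 0))"
  proof -
    have "\<rho> w * \<rho> (inv\<^bsub>W\<^esub> w) = 1\<^sub>m n" if "w \<in> carrier W" for w
      using grp that unfolding group_rep_def by (metis inv_closed r_inv)
    then show ?thesis using n by (simp del: index_mult_mat(1))
  qed
  also have "\<dots> = (\<Sum>j<n. \<Sum>w\<in>carrier W. \<rho> w $$ (0, j) * \<rho> (inv\<^bsub>W\<^esub> w) $$ (j, 0))"
    by (subst sum.swap) (use n in \<open>simp add: mat_mult_index[OF hecke_rep_carrier[OF rep] hecke_rep_carrier[OF rep]] del: index_mult_mat(1)\<close>)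
  also have "\<dots> = of_nat n * c" using n by (simp add: c)
  finally have "of_nat (card (carrier W)) = of_nat n * c" .
  moreover have "card (carrier W) \<noteq> 0" using finite_carrier one_closed by (metis card_0_eq empty_iff)
  ultimately have "c \<noteq> 0" by auto
  with that c show thesis by blast
qed

theorem proposition4p3:
  fixes W :: "('w, 'x) monoid_scheme"
    and S :: "'w set"
    and L :: "'w \<Rightarrow> 'g::linordered_ab_group_add"
    and R :: "complex set"
    and H\<^sub>K :: "('g gfrac, 'h) module"
    and T :: "'w \<Rightarrow> 'h"
    and \<Lambda> :: "'l set"
    and d :: "'l \<Rightarrow> nat"
    and E :: "'l \<Rightarrow> 'w \<Rightarrow> complex mat"
    and E\<^sub>\<epsilon> :: "'l \<Rightarrow> 'h \<Rightarrow> 'g gfrac mat"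
    and \<sigma> :: "'h \<Rightarrow> 'g gfrac mat"
  assumes coxeter: "coxeter_system W S" "finite (carrier W)"
    and weight: "weight_function W S L" "\<forall>s\<in>S. 0 < L s"
    and coeffs: "subring R (ring_of_type_algebra :: complex ring)" "Z_W W S \<subseteq> R"
    and hecke: "hecke_algebra (K_field R) W S L H\<^sub>K T"
    and split: "splitting_field (frac_field R) W"
    and irreps: "irred_reps_family (frac_field R) W \<Lambda> d E"
    and generic: "\<forall>l\<in>\<Lambda>. generic_rep R W H\<^sub>K T (d l) (E l) (E\<^sub>\<epsilon> l)"
    and real: "frac_field R \<subseteq> \<real>"
    and lam: "l \<in> \<Lambda>"
    and afforded: "algebra_rep (K_field R) (d l) H\<^sub>K \<sigma>" "equiv_reps (K_field R) (d l) (carrier H\<^sub>K) \<sigma> (E\<^sub>\<epsilon> l)"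
  shows "balanced R W T (d l) (a_invariant W T (d l) (E\<^sub>\<epsilon> l)) \<sigma> \<longleftrightarrow>
    (\<exists>\<Omega>\<in>mats (O_ring R) (d l).
       \<Omega>\<^sup>T = \<Omega> \<and> det \<Omega> \<in> O_units R \<and>
       (\<forall>w\<in>carrier W. \<Omega> * \<sigma> (T (inv\<^bsub>W\<^esub> w)) = (\<sigma> (T w))\<^sup>T * \<Omega>))"
proof -
  note cox = coxeter
  interpret group W using cox by (simp add: coxeter_system_def)
  interpret coxeter_group W S by unfold_locales (use cox in auto)
  let ?\<tau> = "\<lambda>w. \<sigma> (T w)" and ?n = "d l"
  note R = coeffs(1)
  have T: "T w \<in> carrier H\<^sub>K" if "w \<in> carrier W" for w
    using hecke that by (auto simp: hecke_algebra_def)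
  have irr: "irred_group_rep (frac_field R) ?n W (E l)"
    using irreps lam by (simp add: irred_reps_family_def)
  then have n: "0 < ?n" and grp: "group_rep (frac_field R) ?n W (E l)"
    by (auto simp: irred_group_rep_def irreducible_mats_def)
  have gen: "generic_rep R W H\<^sub>K T ?n (E l) (E\<^sub>\<epsilon> l)" using generic lam by blast
  have trace_eq: "mat_trace (E\<^sub>\<epsilon> l (T w)) = mat_trace (?\<tau> w)" if "w \<in> carrier W" for w
    using afforded(2) T[OF that] unfolding equiv_reps_def by (metis similar_mat_wit_trace)
  have traces: "\<exists>p. mat_trace (?\<tau> w) = to_fract p \<and> mat_trace (E l w) = theta1 p" if "w \<in> carrier W" for w
    using gen that unfolding generic_rep_def trace_eq[OF that, symmetric] by blast
  note rep = algebra_rep_imp_hecke_rep[OF cox hecke R afforded(1)]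
  note rep1 = group_rep_imp_hecke_rep[OF cox grp]
  obtain c where c: "c \<noteq> 0" and schur: "\<And>i j p q. i < ?n \<Longrightarrow> j < ?n \<Longrightarrow> p < ?n \<Longrightarrow> q < ?n \<Longrightarrow>
    (\<Sum>w\<in>carrier W. E l w $$ (i, j) * E l (inv\<^bsub>W\<^esub> w) $$ (p, q)) = (if i = q \<and> j = p then c else 0)"
    by (rule group_schur_relations[OF cox R split irr]) blast
  have \<tau>_K: "?\<tau> w $$ (i, j) \<in> K_field R" if "w \<in> carrier W" "i < ?n" "j < ?n" for w i j
    using T afforded(1) that by (auto simp: algebra_rep_def intro: index_mats)
  have dens: "\<psi> a b = 0"
    if "\<And>w. w \<in> carrier W \<Longrightarrow> (\<Sum>a<?n. \<Sum>b<?n. \<psi> a b * ?\<tau> w $$ (a, b)) = 0" "a < ?n" "b < ?n" for \<psi> a b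
    by (rule generic_density[OF rep rep1 traces c schur that])
  have comm: "\<exists>b. C = b \<cdot>\<^sub>m 1\<^sub>m ?n"
    if "C \<in> carrier_mat ?n ?n" "\<And>w. w \<in> carrier W \<Longrightarrow> C * ?\<tau> w = ?\<tau> w * C" for C
    by (rule generic_commutant_scalar[OF rep rep1 traces c schur that])
  interpret hecke_rep_over_K W S R "\<lambda>s. eps (L s) - inverse (eps (L s))" ?n ?\<tau>
    by (rule hecke_rep_over_K.intro[OF coxeter_group_axioms hecke_rep_over_K_axioms.intro])
      (fact R real rep n \<tau>_K dens comm)+
  let ?c = "c_elt W T ?n (E\<^sub>\<epsilon> l)" and ?a = "a_invariant W T ?n (E\<^sub>\<epsilon> l)"
  have c_eq: "?c = c_tau" by (simp add: c_elt_def c_tau_def trace_eq)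
  obtain a f where af: "0 \<le> a" "0 < f" "has_residue (eps (a + a) * c_tau) (complex_of_real f)"
    by (rule c_tau_leading)
  \<comment> \<open>The description of the a-invariant expands c in \<complex>[\<Gamma>]. The traces
    lie there by the specialisation hypothesis, and the division by the degree is multiplication by
    a constant.\<close>
  have "\<exists>q. c_tau = to_fract q"
  proof -
    have "\<forall>w. \<exists>p. w \<in> carrier W \<longrightarrow> mat_trace (?\<tau> w) = to_fract p" using traces by blast
    then have "\<exists>p. \<forall>w. w \<in> carrier W \<longrightarrow> mat_trace (?\<tau> w) = to_fract (p w)" by (simp only: choice_iff)
    then obtain p where p: "\<And>w. w \<in> carrier W \<Longrightarrow> mat_trace (?\<tau> w) = to_fract (p w)" by blast
    have "Poly_Mapping.single (0 :: 'g) (inverse (of_nat ?n :: complex)) * Poly_Mapping.single 0 (of_nat ?n) = 1"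
      using n by (simp only: mult_single) simp
    then have "to_fract (Poly_Mapping.single (0 :: 'g) (inverse (of_nat ?n))) * of_nat ?n = (1 :: 'g gfrac)"
      by (metis of_nat_gfrac to_fract_1 to_fract_mult)
    then have "to_fract (Poly_Mapping.single (0 :: 'g) (inverse (of_nat ?n))) = inverse (of_nat ?n :: 'g gfrac)"
      by (metis inverse_unique mult.commute)
    then have "c_tau = to_fract ((\<Sum>w\<in>carrier W. p w * p (inv\<^bsub>W\<^esub> w)) * Poly_Mapping.single 0 (inverse (of_nat ?n)))"
      by (simp add: c_tau_def p divide_inverse)
    then show ?thesis by blast
  qed
  then obtain q where q: "c_tau = to_fract q" by blast
  have a: "?a = a" unfolding a_invariant_def c_eq q
    by (rule leading_term_the_eq[OF af(3)[unfolded q] af(2,1)])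
  have bal: "balanced R W T ?n a \<sigma> \<longleftrightarrow>
    (\<forall>w\<in>carrier W. \<forall>i<?n. \<forall>j<?n. \<exists>r. has_residue (eps a * ?\<tau> w $$ (i, j)) r)"
    using K_field_closed(5)[OF R K_field_closed(3)[OF R] \<tau>_K] unfolding balanced_def O_ring_iff[OF R] by blast
  show ?thesis unfolding a
  proof
    assume "balanced R W T ?n a \<sigma>"
    with af(2) show "\<exists>\<Omega>\<in>mats (O_ring R) ?n. \<Omega>\<^sup>T = \<Omega> \<and> det \<Omega> \<in> O_units R \<and>
       (\<forall>w\<in>carrier W. \<Omega> * ?\<tau> (inv\<^bsub>W\<^esub> w) = (?\<tau> w)\<^sup>T * \<Omega>)"
      unfolding bal by (intro balanced_imp_form[OF af(3)]) auto
  next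
    assume "\<exists>\<Omega>\<in>mats (O_ring R) ?n. \<Omega>\<^sup>T = \<Omega> \<and> det \<Omega> \<in> O_units R \<and>
       (\<forall>w\<in>carrier W. \<Omega> * ?\<tau> (inv\<^bsub>W\<^esub> w) = (?\<tau> w)\<^sup>T * \<Omega>)"
    then obtain \<Omega> where \<Omega>: "\<Omega> \<in> mats (O_ring R) ?n" "det \<Omega> \<in> O_units R"
      "\<And>w. w \<in> carrier W \<Longrightarrow> \<Omega> * ?\<tau> (inv\<^bsub>W\<^esub> w) = (?\<tau> w)\<^sup>T * \<Omega>" by blast
    have carr_\<Omega>: "\<Omega> \<in> carrier_mat ?n ?n" using \<Omega>(1) by (simp add: mats_def)
    define u where "u i j = (SOME r. has_residue (\<Omega> $$ (i, j)) r)" for i j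
    have u: "has_residue (\<Omega> $$ (i, j)) (u i j)" if "i < ?n" "j < ?n" for i j
      using index_mats[OF \<Omega>(1) that] unfolding O_ring_iff[OF R] u_def by (auto intro: someI_ex)
    \<comment> \<open>The residue of the determinant is the determinant of the residues, and for a
      unit it is nonzero.\<close>
    have "det (mat ?n ?n (\<lambda>(i, j). u i j)) \<noteq> 0"
      using \<Omega>(2) has_residue_det[OF carr_\<Omega> u] has_residue_unique unfolding O_units_iff[OF R] by blast
    then show "balanced R W T ?n a \<sigma>"
      unfolding bal using form_imp_balanced[OF af(3) carr_\<Omega> u _ \<Omega>(3)] by blast
  qed
qed

end
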